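(* For each of the classical affine types $A_{n-1}^{(1)},B_n^{(1)},C_n^{(1)},D_n^{(1)}$, let $\mathcal Z\subset W_{\mathrm{af}}$ be the Bruhat order ideal generated by the elements $u\in W_{\mathrm{af}}$ such that $uA_0=A_0+\mu$ for some $\mu$ in the finite Weyl group orbit $\mathcal O=W\cdot\nu(\omega_1^\vee)$. Then $\mathcal Z$ coincides with the following Bruhat order ideal of $W_{\mathrm{af}}$. Type $A$ (generators $s_0,\dots,s_{n-1}$, indices modulo $n$): the ideal generated by the length-maximal cyclically decreasing elements $s_rs_{r-1}\cdots s_1s_0s_{n-1}\cdots s_{r+2}$, $r\in\mathbb Z/n\mathbb Z$. Type $B$: the ideal generated by the elements with reduced words $s_0s_2\cdots s_n\cdots s_2s_0$, $s_1s_2\cdots s_n\cdots s_2s_1$, $s_2s_3\cdots s_n\cdots s_2s_1s_0$, and all cyclic rotations of the last word in which $s_0$ and $s_1$ remain adjacent. Type $C$: the ideal generated by the conjugates of the element with reduced word $s_1s_2\cdots s_{n-1}s_ns_{n-1}\cdots s_2s_1s_0$. Type $D$: the ideal generated by $s_0s_2\cdots s_{n-2}s_ns_{n-1}s_{n-2}\cdots s_2s_0$, $s_0s_1s_2\cdots s_{n-2}s_ns_{n-1}s_{n-2}\cdots s_2$, all cyclic rotations of the latter word in which $s_0,s_1$ remain adjacent and $s_{n-1},s_n$ remain adjacent, and all images of these words under Dynkin diagram automorphisms.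
   Context: Types are untwisted affine types with the standard (Kac/Bourbaki) labelling of the affine Dynkin diagram: type $A$ is a cycle on $\mathbb Z/n\mathbb Z$; in type $B$ nodes $0,1$ are both joined to $2$, then a path $2,3,\dots,n$ with double bond between $n-1$ and $n$; type $C$ is a path $0,1,\dots,n$ with double bonds at both ends; in type $D$ nodes $0,1$ are joined to $2$, a path $2,\dots,n-2$, and $n-2$ is joined to $n-1$ and $n$. $\mathfrak h$ is the Cartan subalgebra of the associated finite-dimensional simple Lie algebra, with finite Weyl group $W$ generated by the $s_i$, $i\ne0$; $\theta$ is the highest root; $(\cdot\mid\cdot)$ is the normalized invariant form ($(\theta\mid\theta)=2$) and $\nu:\mathfrak h\to\mathfrak h^*$ the induced isomorphism. $\omega_1^\vee$ is the first fundamental coweight: $\alpha_i(\omega_1^\vee)=\delta_{i1}$. $W_{\mathrm{af}}=W\ltimes T_M$, where $M=\nu(Q^\vee)$ ($Q^\vee$ the coroot lattice) and $T_M$ acts by translations $t_\alpha$, acts on $\mathfrak h^*_{\mathbb R}$ by affine transformations: $s_i$ ($i\neq0$) is the reflection in $\{x:(\alpha_i\mid x)=0\}$ and $s_0$ the reflection in $\{x:(\theta\mid x)=1\}$. The fundamental (identity) alcove $A_0$ is the domain bounded by the hyperplanes $\{(\alpha_i\mid x)=0\}$, $i\ne0$, and $\{(\theta\mid x)=1\}$; $w\mapsto wA_0$ is a bijection from $W_{\mathrm{af}}$ to the set of alcoves. A Bruhat order ideal generated by a set is the set of all elements below some element of that set in Bruhat order.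
   Formalization: In type D with n = 4, only Dynkin diagram automorphisms preserving the partition of the leaves into {0,1} and {3,4} are used, since with the triality-type automorphisms the claim is false. *)

theory Defs
  imports "HOL-Analysis.Analysis"
begin

section \<open>Finite root data of classical type\<close>

text \<open>
  The type \<open>'a :: euclidean_space\<close> plays the role of the real form of the dual of the Cartan
  subalgebra, its inner product that of the normalized invariant form, and \<open>\<alpha> 1, \<dots>, \<alpha> l\<close> are
  the simple roots (values of \<open>\<alpha>\<close> at other arguments are irrelevant).
  The node 0 of the affine diagram corresponds to \<open>- \<theta>\<close>, with \<open>\<theta>\<close> the highest root.
\<close>

datatype classical_type = TypeA | TypeB | TypeC | TypeD

text \<open>
  Finite Cartan matrices of rank \<open>l\<close> in Kac's convention: the \<open>(i, j)\<close> entry is the value of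
  the root \<open>\<alpha> j\<close> at the coroot of \<open>\<alpha> i\<close>.  Thus \<open>\<alpha> l\<close> is short in type B and long in type C.
\<close>

definition path_cartan_entry :: "nat \<Rightarrow> nat \<Rightarrow> real" where
  "path_cartan_entry i j = (if i = j then 2 else if i = Suc j \<or> j = Suc i then - 1 else 0)"

fun cartan_matrix :: "classical_type \<Rightarrow> nat \<Rightarrow> nat \<Rightarrow> nat \<Rightarrow> real" where
  "cartan_matrix TypeA l i j = path_cartan_entry i j"
| "cartan_matrix TypeB l i j = (if i = l \<and> l = Suc j then - 2 else path_cartan_entry i j)"
| "cartan_matrix TypeC l i j = (if j = l \<and> l = Suc i then - 2 else path_cartan_entry i j)"
| "cartan_matrix TypeD l i j =
     (if {i, j} = {l - 1, l} then 0 else if {i, j} = {l - 2, l} then - 1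
      else path_cartan_entry i j)"

text \<open>Orthogonal reflection in the affine hyperplane \<open>{x. a \<bullet> x = c}\<close>.\<close>

definition hyperplane_reflection :: "'a::euclidean_space \<Rightarrow> real \<Rightarrow> 'a \<Rightarrow> 'a" where
  "hyperplane_reflection a c x = x - (2 * (a \<bullet> x - c) / (a \<bullet> a)) *\<^sub>R a"

definition simple_reflection :: "(nat \<Rightarrow> 'a::euclidean_space) \<Rightarrow> 'a \<Rightarrow> nat \<Rightarrow> 'a \<Rightarrow> 'a" where
  "simple_reflection \<alpha> \<theta> i =
     (if i = 0 then hyperplane_reflection \<theta> 1 else hyperplane_reflection (\<alpha> i) 0)"

text \<open>The word \<open>[i, j, \<dots>, k]\<close> stands for the product \<open>s\<^sub>i s\<^sub>j \<cdots> s\<^sub>k\<close>, which applies \<open>s\<^sub>k\<close> first.\<close>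

definition word_element :: "(nat \<Rightarrow> 'a::euclidean_space) \<Rightarrow> 'a \<Rightarrow> nat list \<Rightarrow> 'a \<Rightarrow> 'a" where
  "word_element \<alpha> \<theta> ws = foldr (\<lambda>i f. simple_reflection \<alpha> \<theta> i \<circ> f) ws id"

text \<open>
  As the generators are involutions, the group they generate is the set of their products.
  The finite Weyl group does not involve the letter 0, so the second argument of
  \<^const>\<open>word_element\<close> is immaterial here.
\<close>

definition finite_weyl_group :: "nat \<Rightarrow> (nat \<Rightarrow> 'a::euclidean_space) \<Rightarrow> ('a \<Rightarrow> 'a) set" where
  "finite_weyl_group l \<alpha> = word_element \<alpha> 0 ` lists {1..l}"

definition finite_roots :: "nat \<Rightarrow> (nat \<Rightarrow> 'a::euclidean_space) \<Rightarrow> 'a set" where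
  "finite_roots l \<alpha> = {w (\<alpha> i) | w i. w \<in> finite_weyl_group l \<alpha> \<and> i \<in> {1..l}}"

definition highest_root :: "nat \<Rightarrow> (nat \<Rightarrow> 'a::euclidean_space) \<Rightarrow> 'a \<Rightarrow> bool" where
  "highest_root l \<alpha> \<theta> \<longleftrightarrow> \<theta> \<in> finite_roots l \<alpha> \<and>
     (\<forall>\<beta>\<in>finite_roots l \<alpha>. \<exists>c :: nat \<Rightarrow> nat. \<theta> - \<beta> = (\<Sum>i=1..l. real (c i) *\<^sub>R \<alpha> i))"

definition classical_root_datum ::
    "classical_type \<Rightarrow> nat \<Rightarrow> (nat \<Rightarrow> 'a::euclidean_space) \<Rightarrow> 'a \<Rightarrow> bool" where
  "classical_root_datum X l \<alpha> \<theta> \<longleftrightarrow>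
     inj_on \<alpha> {1..l} \<and> independent (\<alpha> ` {1..l}) \<and> span (\<alpha> ` {1..l}) = UNIV \<and>
     (\<forall>i\<in>{1..l}. \<forall>j\<in>{1..l}. 2 * (\<alpha> i \<bullet> \<alpha> j) / (\<alpha> i \<bullet> \<alpha> i) = cartan_matrix X l i j) \<and>
     highest_root l \<alpha> \<theta> \<and> \<theta> \<bullet> \<theta> = 2"


section \<open>Coroots, coweights and the affine Weyl group\<close>

text \<open>
  The Cartan subalgebra (its real form) is represented by the linear functionals on \<open>'a\<close>, an
  element \<open>h\<close> being identified with evaluation \<open>\<lambda>x. x(h)\<close>.  In these terms the isomorphism
  \<open>\<nu>\<close> induced by the form is characterised by \<open>x(h) = (x | \<nu> h)\<close>.
\<close>

definition nu :: "('a::euclidean_space \<Rightarrow> real) \<Rightarrow> 'a" where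
  "nu h = (THE v. \<forall>x. h x = x \<bullet> v)"

definition coroot :: "'a::euclidean_space \<Rightarrow> 'a \<Rightarrow> real" where
  "coroot a x = 2 * (a \<bullet> x) / (a \<bullet> a)"

definition coroot_lattice :: "nat \<Rightarrow> (nat \<Rightarrow> 'a::euclidean_space) \<Rightarrow> ('a \<Rightarrow> real) set" where
  "coroot_lattice l \<alpha> =
     {\<lambda>x. \<Sum>i=1..l. real_of_int (c i) * coroot (\<alpha> i) x | c :: nat \<Rightarrow> int. True}"

definition first_coweight :: "nat \<Rightarrow> (nat \<Rightarrow> 'a::euclidean_space) \<Rightarrow> 'a \<Rightarrow> real" where
  "first_coweight l \<alpha> =
     (THE h. linear h \<and> (\<forall>i\<in>{1..l}. h (\<alpha> i) = (if i = 1 then 1 else 0)))"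

definition translation_lattice :: "nat \<Rightarrow> (nat \<Rightarrow> 'a::euclidean_space) \<Rightarrow> 'a set" where
  "translation_lattice l \<alpha> = nu ` coroot_lattice l \<alpha>"

definition affine_weyl_group :: "nat \<Rightarrow> (nat \<Rightarrow> 'a::euclidean_space) \<Rightarrow> ('a \<Rightarrow> 'a) set" where
  "affine_weyl_group l \<alpha> =
     {\<lambda>x. w x + \<beta> | w \<beta>. w \<in> finite_weyl_group l \<alpha> \<and> \<beta> \<in> translation_lattice l \<alpha>}"

definition fundamental_alcove :: "nat \<Rightarrow> (nat \<Rightarrow> 'a::euclidean_space) \<Rightarrow> 'a \<Rightarrow> 'a set" where
  "fundamental_alcove l \<alpha> \<theta> = {x. (\<forall>i\<in>{1..l}. 0 < \<alpha> i \<bullet> x) \<and> \<theta> \<bullet> x < 1}"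

definition coweight_orbit :: "nat \<Rightarrow> (nat \<Rightarrow> 'a::euclidean_space) \<Rightarrow> 'a set" where
  "coweight_orbit l \<alpha> = (\<lambda>w. w (nu (first_coweight l \<alpha>))) ` finite_weyl_group l \<alpha>"


section \<open>Length and Bruhat order\<close>

definition weyl_length :: "nat \<Rightarrow> (nat \<Rightarrow> 'a::euclidean_space) \<Rightarrow> 'a \<Rightarrow> ('a \<Rightarrow> 'a) \<Rightarrow> nat" where
  "weyl_length l \<alpha> \<theta> w =
     (LEAST k. \<exists>ws\<in>lists {0..l}. length ws = k \<and> word_element \<alpha> \<theta> ws = w)"

definition reduced_word :: "nat \<Rightarrow> (nat \<Rightarrow> 'a::euclidean_space) \<Rightarrow> 'a \<Rightarrow> nat list \<Rightarrow> bool" where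
  "reduced_word l \<alpha> \<theta> ws \<longleftrightarrow>
     ws \<in> lists {0..l} \<and> length ws = weyl_length l \<alpha> \<theta> (word_element \<alpha> \<theta> ws)"

definition affine_reflections ::
    "nat \<Rightarrow> (nat \<Rightarrow> 'a::euclidean_space) \<Rightarrow> 'a \<Rightarrow> ('a \<Rightarrow> 'a) set" where
  "affine_reflections l \<alpha> \<theta> =
     {g \<circ> simple_reflection \<alpha> \<theta> i \<circ> inv g | g i. g \<in> affine_weyl_group l \<alpha> \<and> i \<in> {0..l}}"

definition bruhat_step ::
    "nat \<Rightarrow> (nat \<Rightarrow> 'a::euclidean_space) \<Rightarrow> 'a \<Rightarrow> ('a \<Rightarrow> 'a) \<Rightarrow> ('a \<Rightarrow> 'a) \<Rightarrow> bool" where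
  "bruhat_step l \<alpha> \<theta> u v \<longleftrightarrow>
     u \<in> affine_weyl_group l \<alpha> \<and> (\<exists>t\<in>affine_reflections l \<alpha> \<theta>. v = u \<circ> t) \<and>
     weyl_length l \<alpha> \<theta> u < weyl_length l \<alpha> \<theta> v"

definition bruhat_le ::
    "nat \<Rightarrow> (nat \<Rightarrow> 'a::euclidean_space) \<Rightarrow> 'a \<Rightarrow> ('a \<Rightarrow> 'a) \<Rightarrow> ('a \<Rightarrow> 'a) \<Rightarrow> bool" where
  "bruhat_le l \<alpha> \<theta> = (bruhat_step l \<alpha> \<theta>)\<^sup>*\<^sup>*"

definition bruhat_ideal ::
    "nat \<Rightarrow> (nat \<Rightarrow> 'a::euclidean_space) \<Rightarrow> 'a \<Rightarrow> ('a \<Rightarrow> 'a) set \<Rightarrow> ('a \<Rightarrow> 'a) set" where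
  "bruhat_ideal l \<alpha> \<theta> G = {u \<in> affine_weyl_group l \<alpha>. \<exists>v\<in>G. bruhat_le l \<alpha> \<theta> u v}"

definition Z_ideal :: "nat \<Rightarrow> (nat \<Rightarrow> 'a::euclidean_space) \<Rightarrow> 'a \<Rightarrow> ('a \<Rightarrow> 'a) set" where
  "Z_ideal l \<alpha> \<theta> = bruhat_ideal l \<alpha> \<theta>
     {u \<in> affine_weyl_group l \<alpha>. \<exists>\<mu>\<in>coweight_orbit l \<alpha>.
        u ` fundamental_alcove l \<alpha> \<theta> = (\<lambda>x. x + \<mu>) ` fundamental_alcove l \<alpha> \<theta>}"


section \<open>The generating words\<close>

definition rotations :: "'b list \<Rightarrow> 'b list set" where
  "rotations ws = {rotate k ws | k. True}"

text \<open>Adjacency refers to neighbouring positions of the linear (not cyclic) word.\<close>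

definition adjacent_in :: "'b \<Rightarrow> 'b \<Rightarrow> 'b list \<Rightarrow> bool" where
  "adjacent_in a b ws \<longleftrightarrow> (\<exists>i. Suc i < length ws \<and> {ws ! i, ws ! Suc i} = {a, b})"

text \<open>The word \<open>r, r - 1, \<dots>, 1, 0, n - 1, \<dots>, r + 2\<close> modulo \<open>n\<close>, of length \<open>n - 1\<close>.\<close>

definition wordA :: "nat \<Rightarrow> nat \<Rightarrow> nat list" where
  "wordA n r = map (\<lambda>k. (r + n - k) mod n) [0..<n - 1]"

text \<open>
  A word over \<open>\<int>/n\<int>\<close> is cyclically decreasing if its letters are distinct and \<open>i + 1\<close>
  precedes \<open>i\<close> whenever both occur.
\<close>

definition cyclically_decreasing_word :: "nat \<Rightarrow> nat list \<Rightarrow> bool" where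
  "cyclically_decreasing_word n ws \<longleftrightarrow> ws \<in> lists {..<n} \<and> distinct ws \<and>
     (\<forall>p<length ws. \<forall>q<length ws. ws ! q = Suc (ws ! p) mod n \<longrightarrow> q < p)"

definition cyclically_decreasing_elements ::
    "nat \<Rightarrow> (nat \<Rightarrow> 'a::euclidean_space) \<Rightarrow> 'a \<Rightarrow> ('a \<Rightarrow> 'a) set" where
  "cyclically_decreasing_elements n \<alpha> \<theta> =
     {word_element \<alpha> \<theta> ws | ws. cyclically_decreasing_word n ws \<and> reduced_word (n - 1) \<alpha> \<theta> ws}"

definition length_maximal ::
    "nat \<Rightarrow> (nat \<Rightarrow> 'a::euclidean_space) \<Rightarrow> 'a \<Rightarrow> ('a \<Rightarrow> 'a) set \<Rightarrow> ('a \<Rightarrow> 'a) set" where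
  "length_maximal l \<alpha> \<theta> S = {w \<in> S. \<forall>v\<in>S. weyl_length l \<alpha> \<theta> v \<le> weyl_length l \<alpha> \<theta> w}"

text \<open>
  In the words below, \<open>[2..<Suc n] @ rev [2..<n]\<close> is \<open>2, 3, \<dots>, n - 1, n, n - 1, \<dots>, 3, 2\<close>,
  and similarly for the other types.
\<close>

definition wordsB :: "nat \<Rightarrow> nat list set" where
  "wordsB n = (let m = [2..<Suc n] @ rev [2..<n] in
     {[0] @ m @ [0], [1] @ m @ [1]} \<union> {ws \<in> rotations (m @ [1, 0]). adjacent_in 0 1 ws})"

definition wordC :: "nat \<Rightarrow> nat list" where
  "wordC n = [1..<Suc n] @ rev [1..<n] @ [0]"

definition conjugates :: "('a \<Rightarrow> 'a) set \<Rightarrow> ('a \<Rightarrow> 'a) \<Rightarrow> ('a \<Rightarrow> 'a) set" where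
  "conjugates G c = {g \<circ> c \<circ> inv g | g. g \<in> G}"

definition affine_edgesD :: "nat \<Rightarrow> nat set set" where
  "affine_edgesD n = {{0, 2}, {1, 2}, {n - 2, n - 1}, {n - 2, n}} \<union>
     {{i, Suc i} | i. 2 \<le> i \<and> i < n - 2}"

text \<open>
  For \<open>n \<ge> 5\<close> these are all automorphisms of the affine Dynkin diagram.  The diagram for
  \<open>n = 4\<close> is a star with four leaves and has additional, triality-type automorphisms, which
  permute the three minuscule coweights and so do not preserve the Weyl group orbit of the
  first one.  For \<open>n = 4\<close> only the automorphisms following the general pattern are admitted,
  namely those preserving the partition of the leaves into \<open>{0, 1}\<close> and \<open>{n - 1, n}\<close>.
\<close>

definition diagram_automorphismsD :: "nat \<Rightarrow> (nat \<Rightarrow> nat) set" where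
  "diagram_automorphismsD n = {\<sigma>. \<sigma> permutes {0..n} \<and>
     (\<forall>i\<in>{0..n}. \<forall>j\<in>{0..n}. {\<sigma> i, \<sigma> j} \<in> affine_edgesD n \<longleftrightarrow> {i, j} \<in> affine_edgesD n) \<and>
     (n = 4 \<longrightarrow> \<sigma> ` {0, 1} \<in> {{0, 1}, {n - 1, n}})}"

definition wordsD :: "nat \<Rightarrow> nat list set" where
  "wordsD n = (let m = [2..<n - 1] @ [n, n - 1] @ rev [2..<n - 1] in
     {map \<sigma> ws | \<sigma> ws. \<sigma> \<in> diagram_automorphismsD n \<and>
        ws \<in> {[0] @ m @ [0]} \<union>
          {vs \<in> rotations ([0, 1] @ m). adjacent_in 0 1 vs \<and> adjacent_in (n - 1) n vs}})"

end

theory Submission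
  imports Defs
begin

text \<open>
  For every type the two ideals agree because their generating sets are equal. In suitable
  coordinates \<open>e i \<bullet> x\<close> the finite Weyl group permutes the vectors \<open>e i\<close> (type A) or \<open>\<plusminus> e i\<close>
  (types B, C, D), which up to a scalar are the orbit of the first coweight. Up to diagram
  automorphisms in type D, each listed word acts as \<open>x \<mapsto> \<tau> x + \<mu>\<close> with \<open>\<mu>\<close> in this orbit and with
  one fixed symmetry \<open>\<tau>\<close> of the fundamental alcove
  (a cyclic shift in type A, \<open>x\<^sub>1 \<mapsto> 1 - x\<^sub>1\<close> in type B, the identity in type C,
  \<open>(x\<^sub>1, x\<^sub>n) \<mapsto> (1 - x\<^sub>1, - x\<^sub>n)\<close> in type D), and rotating a word conjugates the element and moves
  \<open>\<mu>\<close> by a simple reflection. It remains to see that an element of the affine Weyl group is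
  determined by its alcove, that is, that it is trivial if it maps \<open>p = \<rho>\<^sup>\<or>/h\<close> into the alcove. Such
  an element fixes \<open>p\<close>, and the values of the \<open>e i\<close> at \<open>p\<close> modulo \<open>\<int>\<close>, together with a parity
  argument in types B and D, force it to be the identity.

  Words are reduced by a displacement bound: in a \<open>W\<close>-invariant norm every generator moves a suitable
  point by at most \<open>\<delta>\<close>, so a word of length \<open>k\<close> moves it by at most \<open>k \<delta>\<close>.
\<close>

subsection \<open>Reflections and words\<close>

text \<open>In types A, B and D the vectors \<open>\<mu>\<close> lie outside the translation lattice
  \<open>M\<close>, so translation by \<open>\<mu>\<close> is not in the affine Weyl group; an
  element carrying \<open>A0\<close> to \<open>A0 + \<mu>\<close> must therefore combine it with a
  nontrivial symmetry of the alcove, and this is the origin of \<open>\<tau>\<close>. In type C the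
  orbit lies in \<open>M\<close> and \<open>\<tau>\<close> disappears. The point \<open>p\<close> is
  balanced against all walls: each simple root has value 1/h there and \<open>\<theta>\<close> has
  value 1 - 1/h. These are the extreme values in Z/h that the open alcove admits, which is why a
  point of the orbit of \<open>p\<close> has no room to move inside the alcove. The obstacle is then
  the stabilizer of \<open>p\<close>. Its linear parts permute the vectors \<open>e i\<close> up to
  sign, and a number x in [0, 1/2] is congruent to -x modulo the integers only for x = 0 and x =
  1/2. Type C avoids both values. In type B the first coordinate of \<open>p\<close> is 1/2, in type
  D the first is 1/2 and the last is 0; at exactly these coordinates a sign change escapes the
  congruence and has to be excluded by parity.\<close>

lemma hyperplane_reflection_shift:
  "hyperplane_reflection a c x = hyperplane_reflection a 0 x + (2 * c / (a \<bullet> a)) *\<^sub>R a"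
  by (simp add: hyperplane_reflection_def algebra_simps diff_divide_distrib flip: scaleR_add_left)

lemma hyperplane_reflection_scale:
  assumes "k \<noteq> 0"
  shows "hyperplane_reflection (k *\<^sub>R a) (k * c) = hyperplane_reflection a c"
proof
  fix x
  have "2 * (k * (a \<bullet> x) - k * c) / (k * (k * (a \<bullet> a))) * k = 2 * (a \<bullet> x - c) / (a \<bullet> a)"
    using assms by (cases "a = 0") (auto simp: divide_simps, simp add: algebra_simps)
  then show "hyperplane_reflection (k *\<^sub>R a) (k * c) x = hyperplane_reflection a c x"
    by (simp add: hyperplane_reflection_def)
qed

lemma hyperplane_reflection_minus:
  "hyperplane_reflection (- a) (- c) = hyperplane_reflection a c"
  using hyperplane_reflection_scale[of "-1" a c] by simp

lemma hyperplane_reflection_invol [simp]: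
  "hyperplane_reflection a c (hyperplane_reflection a c x) = x"
proof (cases "a = 0")
  case False
  then have "2 * (a \<bullet> hyperplane_reflection a c x - c) / (a \<bullet> a) = - (2 * (a \<bullet> x - c) / (a \<bullet> a))"
    by (simp add: hyperplane_reflection_def inner_diff_right field_simps)
  then show ?thesis
    unfolding hyperplane_reflection_def[of a c "hyperplane_reflection a c x"]
    by (simp only: scaleR_minus_left) (simp add: hyperplane_reflection_def)
qed (simp add: hyperplane_reflection_def)

lemma hyperplane_reflection_self_adjoint:
  "hyperplane_reflection a 0 x \<bullet> y = x \<bullet> hyperplane_reflection a 0 y"
  by (simp add: hyperplane_reflection_def inner_diff_left inner_diff_right inner_commute)

lemma orthogonal_hyperplane_reflection:
  "orthogonal_transformation (hyperplane_reflection a 0)"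
  unfolding orthogonal_transformation_def
proof (intro conjI allI)
  show "linear (hyperplane_reflection a 0)"
    by (rule linearI)
      (simp_all add: hyperplane_reflection_def inner_add_right algebra_simps add_divide_distrib)
  show "hyperplane_reflection a 0 v \<bullet> hyperplane_reflection a 0 w = v \<bullet> w" for v w
    by (simp add: hyperplane_reflection_self_adjoint)
qed

lemma linear_hyperplane_reflection: "linear (hyperplane_reflection a 0)"
  using orthogonal_hyperplane_reflection orthogonal_transformation_def by blast

lemma hyperplane_reflection_neg [simp]:
  "hyperplane_reflection a 0 (- x) = - hyperplane_reflection a 0 x"
  by (rule linear_neg[OF linear_hyperplane_reflection])

lemma hyperplane_reflection_add:
  "hyperplane_reflection a 0 (x + y) = hyperplane_reflection a 0 x + hyperplane_reflection a 0 y"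
  by (rule linear_add[OF linear_hyperplane_reflection])

lemma hyperplane_reflection_diff:
  "hyperplane_reflection a 0 (x - y) = hyperplane_reflection a 0 x - hyperplane_reflection a 0 y"
  by (rule linear_diff[OF linear_hyperplane_reflection])

lemma hyperplane_reflection_cmul:
  "hyperplane_reflection a 0 (k *\<^sub>R x) = k *\<^sub>R hyperplane_reflection a 0 x"
  by (rule linear_cmul[OF linear_hyperplane_reflection])

lemma orthogonal_conj_reflection:
  assumes "orthogonal_transformation g"
  shows "g (hyperplane_reflection a c x) = hyperplane_reflection (g a) c (g x)"
  using assms
  by (simp add: hyperplane_reflection_def orthogonal_transformation_def linear_diff linear_cmul)

text \<open>The translation by \<open>b\<close> moves the hyperplane and so changes its constant.
  This lets an affine symmetry of the alcove exchange the wall of node 0 with a linear wall.\<close>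

lemma isometry_conj_reflection:
  assumes "orthogonal_transformation g"
  shows "g (hyperplane_reflection a c x) + b = hyperplane_reflection (g a) (c + g a \<bullet> b) (g x + b)"
  using assms
  by (simp add: hyperplane_reflection_def orthogonal_transformation_def linear_diff linear_cmul
      inner_add_right)

lemma word_Nil [simp]: "word_element \<alpha> \<theta> [] = id"
  by (simp add: word_element_def)

lemma word_Cons [simp]:
  "word_element \<alpha> \<theta> (i # ws) = simple_reflection \<alpha> \<theta> i \<circ> word_element \<alpha> \<theta> ws"
  by (simp add: word_element_def)

lemma word_append [simp]:
  "word_element \<alpha> \<theta> (us @ ws) = word_element \<alpha> \<theta> us \<circ> word_element \<alpha> \<theta> ws"
  by (induction us) auto

lemma simple_reflection_invol [simp]:
  "simple_reflection \<alpha> \<theta> i (simple_reflection \<alpha> \<theta> i x) = x"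
  by (simp add: simple_reflection_def)

lemma word_rev_left [simp]: "word_element \<alpha> \<theta> (rev ws) (word_element \<alpha> \<theta> ws x) = x"
  by (induction ws arbitrary: x) auto

lemma word_rev_right [simp]: "word_element \<alpha> \<theta> ws (word_element \<alpha> \<theta> (rev ws) x) = x"
  using word_rev_left[of \<alpha> \<theta> "rev ws"] by simp

lemma word_finite: "0 \<notin> set ws \<Longrightarrow> word_element \<alpha> \<theta> ws = word_element \<alpha> 0 ws"
  by (induction ws) (auto simp: simple_reflection_def)

lemma finite_weyl_group_iff:
  "w \<in> finite_weyl_group l \<alpha> \<longleftrightarrow> (\<exists>ws\<in>lists {1..l}. w = word_element \<alpha> \<theta> ws)"
proof -
  have "word_element \<alpha> 0 ws = word_element \<alpha> \<theta> ws" if "ws \<in> lists {1..l}" for ws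
    using that by (intro word_finite[symmetric]) auto
  then show ?thesis
    unfolding finite_weyl_group_def image_iff by simp
qed

lemma simple_reflection_pos: "i \<noteq> 0 \<Longrightarrow> simple_reflection \<alpha> \<theta> i = hyperplane_reflection (\<alpha> i) 0"
  by (simp add: simple_reflection_def)

lemma finite_weyl_group_orthogonal:
  assumes "w \<in> finite_weyl_group l \<alpha>"
  shows "orthogonal_transformation w"
proof -
  have "orthogonal_transformation (word_element \<alpha> 0 ws)" if "ws \<in> lists {1..l}" for ws
    using that
  proof (induction ws)
    case Nil
    show ?case using orthogonal_transformation_id by (simp add: id_def)
  next
    case (Cons i ws)
    then have "i \<noteq> 0" "orthogonal_transformation (word_element \<alpha> 0 ws)" by auto
    then show ?case
      unfolding word_Cons
      by (intro orthogonal_transformation_compose)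
        (simp_all add: simple_reflection_pos orthogonal_hyperplane_reflection)
  qed
  then show ?thesis using assms by (auto simp: finite_weyl_group_def)
qed

lemma id_in_finite_weyl_group [simp]: "id \<in> finite_weyl_group l \<alpha>"
  by (force simp: finite_weyl_group_def intro!: image_eqI[of _ _ "[]"])

lemma finite_weyl_group_comp:
  "v \<in> finite_weyl_group l \<alpha> \<Longrightarrow> w \<in> finite_weyl_group l \<alpha> \<Longrightarrow> v \<circ> w \<in> finite_weyl_group l \<alpha>"
  unfolding finite_weyl_group_def using append_in_lists_conv by (force simp flip: word_append)

lemma finite_weyl_group_reflection:
  "i \<in> {1..l} \<Longrightarrow> hyperplane_reflection (\<alpha> i) 0 \<in> finite_weyl_group l \<alpha>"
  unfolding finite_weyl_group_def
  by (rule image_eqI[of _ _ "[i]"]) (auto simp: simple_reflection_pos)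

lemma finite_weyl_group_word: "ws \<in> lists {1..l} \<Longrightarrow> word_element \<alpha> \<theta> ws \<in> finite_weyl_group l \<alpha>"
  using finite_weyl_group_iff by blast

lemma finite_weyl_group_inverse:
  assumes "w \<in> finite_weyl_group l \<alpha>"
  obtains v where "v \<in> finite_weyl_group l \<alpha>" "\<And>x. v (w x) = x" "\<And>x. w (v x) = x"
proof -
  obtain ws where ws: "ws \<in> lists {1..l}" "w = word_element \<alpha> 0 ws"
    using assms by (auto simp: finite_weyl_group_def)
  show ?thesis
  proof (rule that)
    show "word_element \<alpha> 0 (rev ws) \<in> finite_weyl_group l \<alpha>"
      using ws by (intro finite_weyl_group_word) auto
  qed (simp_all add: ws)
qed

lemma finite_weyl_group_induct [consumes 1, case_names id step]:
  assumes "w \<in> finite_weyl_group l \<alpha>" and "P id"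
    and "\<And>i w. i \<in> {1..l} \<Longrightarrow> w \<in> finite_weyl_group l \<alpha> \<Longrightarrow> P w
      \<Longrightarrow> P (hyperplane_reflection (\<alpha> i) 0 \<circ> w)"
  shows "P w"
proof -
  have "P (word_element \<alpha> 0 ws)" if "ws \<in> lists {1..l}" for ws
    using that
  proof (induction ws)
    case (Cons i ws)
    then have "i \<in> {1..l}" "ws \<in> lists {1..l}" "P (word_element \<alpha> 0 ws)" "i \<noteq> 0" by auto
    then show ?case
      unfolding word_Cons simple_reflection_pos[OF \<open>i \<noteq> 0\<close>]
      by (intro assms(3) finite_weyl_group_word)
  qed (unfold word_Nil, rule assms(2))
  then show ?thesis using assms(1) by (auto simp: finite_weyl_group_def)
qed

lemma finite_weyl_group_invariant:
  assumes "w \<in> finite_weyl_group l \<alpha>" "x \<in> E"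
    and "\<And>i x. i \<in> {1..l} \<Longrightarrow> x \<in> E \<Longrightarrow> hyperplane_reflection (\<alpha> i) 0 x \<in> E"
  shows "w x \<in> E"
  using assms(1) by (induction rule: finite_weyl_group_induct) (auto simp: assms)

lemma nu_eqI: "(\<And>x. h x = x \<bullet> v) \<Longrightarrow> nu h = v"
  unfolding nu_def by (rule the_equality) (simp, metis vector_eq_ldot)

lemma inner_span_eqI:
  assumes "span E = UNIV" "\<And>e. e \<in> E \<Longrightarrow> e \<bullet> x = e \<bullet> y"
  shows "x = (y :: 'a :: euclidean_space)"
proof -
  have "v \<bullet> (x - y) = 0" for v
  proof -
    have "v \<in> span E" using assms(1) by simp
    then show ?thesis
      by (induction rule: span_induct_alt) (auto simp: inner_add_left inner_diff_right assms(2))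
  qed
  from this[of "x - y"] show ?thesis by simp
qed

lemma linear_span_idI:
  assumes "span E = UNIV" "linear w" "\<And>e. e \<in> E \<Longrightarrow> w e = e"
  shows "w x = x"
proof -
  have "x \<in> span E" using assms(1) by simp
  then show ?thesis
    by (induction rule: span_induct_alt) (auto simp: linear_0 linear_add linear_cmul assms)
qed

text \<open>Pairing with \<open>f\<close> is linear and has the prescribed values on a spanning set,
  so it is the functional chosen by the definite description.\<close>

lemma nu_first_coweight:
  assumes "span (\<alpha> ` {1..l}) = UNIV"
    and f: "\<And>i. i \<in> {1..l} \<Longrightarrow> \<alpha> i \<bullet> f = (if i = 1 then 1 else 0)"
  shows "nu (first_coweight l \<alpha>) = f"
proof -
  have "first_coweight l \<alpha> = (\<lambda>x. x \<bullet> f)"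
    unfolding first_coweight_def
  proof (rule the_equality)
    show "linear (\<lambda>x. x \<bullet> f) \<and> (\<forall>i\<in>{1..l}. \<alpha> i \<bullet> f = (if i = 1 then 1 else 0))"
      by (auto simp: f inner_left_distrib intro!: linearI)
    fix h :: "'a \<Rightarrow> real" assume h: "linear h \<and> (\<forall>i\<in>{1..l}. h (\<alpha> i) = (if i = 1 then 1 else 0))"
    show "h = (\<lambda>x. x \<bullet> f)"
    proof
      fix x
      have "x \<in> span (\<alpha> ` {1..l})" using assms(1) by simp
      then show "h x = x \<bullet> f"
        by (induction rule: span_induct_alt)
          (use h f in \<open>auto simp: linear_0 linear_add linear_cmul inner_left_distrib\<close>)
    qed
  qed
  then show ?thesis by (intro nu_eqI) simp
qed

subsection \<open>The affine Weyl group of an integral root datum\<close>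

text \<open>What the four types share: integral Cartan pairings and a root of norm 2. The actual
  Cartan entries enter later, through coordinates.\<close>

locale integral_datum =
  fixes l :: nat and \<alpha> :: "nat \<Rightarrow> 'a::euclidean_space" and \<theta> :: 'a
  assumes nonzero: "i \<in> {1..l} \<Longrightarrow> \<alpha> i \<noteq> 0"
    and integral: "i \<in> {1..l} \<Longrightarrow> j \<in> {1..l} \<Longrightarrow> 2 * (\<alpha> i \<bullet> \<alpha> j) / (\<alpha> i \<bullet> \<alpha> i) \<in> \<int>"
    and theta_root: "\<theta> \<in> finite_roots l \<alpha>"
    and theta_norm: "\<theta> \<bullet> \<theta> = 2"
    and span_alpha: "span (\<alpha> ` {1..l}) = UNIV"
begin

abbreviation "W \<equiv> finite_weyl_group l \<alpha>"
abbreviation "W_af \<equiv> affine_weyl_group l \<alpha>"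
abbreviation "M \<equiv> translation_lattice l \<alpha>"
abbreviation "A0 \<equiv> fundamental_alcove l \<alpha> \<theta>"
abbreviation "S \<equiv> simple_reflection \<alpha> \<theta>"
abbreviation "wd \<equiv> word_element \<alpha> \<theta>"
abbreviation "Orb \<equiv> coweight_orbit l \<alpha>"

text \<open>The simple coroot carried to the space of roots by \<open>nu\<close>.\<close>

definition cv :: "nat \<Rightarrow> 'a" where "cv i = (2 / (\<alpha> i \<bullet> \<alpha> i)) *\<^sub>R \<alpha> i"

lemma alpha_cv: "i \<in> {1..l} \<Longrightarrow> j \<in> {1..l} \<Longrightarrow> \<alpha> i \<bullet> cv j \<in> \<int>"
  using integral[of j i] by (simp add: cv_def inner_commute)

lemma reflection_cv: "hyperplane_reflection (\<alpha> i) 0 x = x - (\<alpha> i \<bullet> x) *\<^sub>R cv i"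
  by (simp add: hyperplane_reflection_def cv_def)

lemma M_eq: "M = {\<Sum>i=1..l. of_int (c i) *\<^sub>R cv i | c. True}"
proof -
  have "nu (\<lambda>x. \<Sum>i=1..l. real_of_int (c i) * coroot (\<alpha> i) x) = (\<Sum>i=1..l. of_int (c i) *\<^sub>R cv i)" for c
    by (rule nu_eqI) (simp add: inner_sum_right coroot_def cv_def inner_commute mult.assoc)
  then show ?thesis
    unfolding translation_lattice_def coroot_lattice_def by (force simp: image_iff)
qed

lemma M_0: "0 \<in> M"
  unfolding M_eq by (rule CollectI, rule exI[of _ "\<lambda>_. 0"]) simp

lemma M_add: "x \<in> M \<Longrightarrow> y \<in> M \<Longrightarrow> x + y \<in> M"
proof -
  assume "x \<in> M" "y \<in> M"
  then obtain c d where "x = (\<Sum>i=1..l. of_int (c i) *\<^sub>R cv i)" "y = (\<Sum>i=1..l. of_int (d i) *\<^sub>R cv i)"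
    by (auto simp: M_eq)
  then have "x + y = (\<Sum>i=1..l. of_int (c i + d i) *\<^sub>R cv i)"
    by (simp add: sum.distrib scaleR_add_left)
  then show ?thesis unfolding M_eq by (intro CollectI exI[of _ "\<lambda>i. c i + d i"]) simp
qed

lemma M_scale: "x \<in> M \<Longrightarrow> k \<in> \<int> \<Longrightarrow> k *\<^sub>R x \<in> M"
proof -
  assume "x \<in> M" "k \<in> \<int>"
  then obtain c m where "x = (\<Sum>i=1..l. of_int (c i) *\<^sub>R cv i)" "k = of_int m"
    by (auto simp: M_eq elim: Ints_cases)
  then have "k *\<^sub>R x = (\<Sum>i=1..l. of_int (m * c i) *\<^sub>R cv i)"
    by (simp add: scaleR_sum_right)
  then show ?thesis unfolding M_eq by (intro CollectI exI[of _ "\<lambda>i. m * c i"]) simp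
qed

lemma M_minus: "x \<in> M \<Longrightarrow> - x \<in> M"
  using M_scale[of x "-1"] by simp

lemma M_diff: "x \<in> M \<Longrightarrow> y \<in> M \<Longrightarrow> x - y \<in> M"
  using M_add[of x "- y"] M_minus by simp

lemma M_cv: "i \<in> {1..l} \<Longrightarrow> cv i \<in> M"
proof -
  assume i: "i \<in> {1..l}"
  have "(\<Sum>j=1..l. of_int (if j = i then 1 else 0) *\<^sub>R cv j) = (\<Sum>j=1..l. if j = i then cv j else 0)"
    by (rule sum.cong) auto
  also have "\<dots> = cv i" using i by simp
  finally show ?thesis
    unfolding M_eq by (intro CollectI exI[of _ "\<lambda>j. if j = i then 1 else 0"]) simp
qed

text \<open>The factor \<open>k\<close> covers two uses: \<open>k = 1\<close> gives integral
  pairings with \<open>M\<close>, and \<open>k = 1 / 2\<close> gives the evenness of coordinate sums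
  used in the parity arguments.\<close>

lemma M_inner_Ints:
  assumes "\<beta> \<in> M" "\<And>i. i \<in> {1..l} \<Longrightarrow> k * (e \<bullet> cv i) \<in> \<int>"
  shows "k * (e \<bullet> \<beta>) \<in> \<int>"
proof -
  obtain c where "\<beta> = (\<Sum>i=1..l. of_int (c i) *\<^sub>R cv i)" using assms(1) by (auto simp: M_eq)
  then have "k * (e \<bullet> \<beta>) = (\<Sum>i=1..l. of_int (c i) * (k * (e \<bullet> cv i)))"
    by (simp add: inner_sum_right sum_distrib_left mult.left_commute)
  also have "\<dots> \<in> \<int>" using assms(2) by (intro Ints_sum Ints_mult[OF Ints_of_int]) auto
  finally show ?thesis .
qed

lemma M_alpha: "\<beta> \<in> M \<Longrightarrow> i \<in> {1..l} \<Longrightarrow> \<alpha> i \<bullet> \<beta> \<in> \<int>"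
  using M_inner_Ints[of \<beta> 1 "\<alpha> i"] alpha_cv by simp

lemma M_W: "w \<in> W \<Longrightarrow> \<beta> \<in> M \<Longrightarrow> w \<beta> \<in> M"
  by (erule finite_weyl_group_invariant) (auto simp: reflection_cv intro!: M_diff M_scale M_cv M_alpha)

lemma W_linear: "w \<in> W \<Longrightarrow> linear w"
  using finite_weyl_group_orthogonal orthogonal_transformation_def by blast

lemma W_inner: "w \<in> W \<Longrightarrow> w x \<bullet> w y = x \<bullet> y"
  using finite_weyl_group_orthogonal orthogonal_transformation_def by blast

lemma W_af_iff: "u \<in> W_af \<longleftrightarrow> (\<exists>w\<in>W. \<exists>\<beta>\<in>M. u = (\<lambda>x. w x + \<beta>))"
  unfolding affine_weyl_group_def by blast

lemma W_af_I: "w \<in> W \<Longrightarrow> \<beta> \<in> M \<Longrightarrow> (\<lambda>x. w x + \<beta>) \<in> W_af"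
  using W_af_iff by blast

lemma W_subset_W_af: "w \<in> W \<Longrightarrow> w \<in> W_af"
  using W_af_I[of w 0] M_0 by simp

lemma W_af_comp: assumes "u \<in> W_af" "v \<in> W_af" shows "u \<circ> v \<in> W_af"
proof -
  obtain w \<beta> w' \<beta>' where *: "w \<in> W" "\<beta> \<in> M" "u = (\<lambda>x. w x + \<beta>)"
    "w' \<in> W" "\<beta>' \<in> M" "v = (\<lambda>x. w' x + \<beta>')"
    using assms W_af_iff by meson
  have "u \<circ> v = (\<lambda>x. (w \<circ> w') x + (w \<beta>' + \<beta>))"
    using W_linear[OF *(1)] by (auto simp: * linear_add)
  then show ?thesis
    using W_af_I[OF finite_weyl_group_comp[OF *(1,4)] M_add[OF M_W[OF *(1,5)] *(2)]] by metis
qed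

lemma W_af_inverse:
  assumes "u \<in> W_af"
  obtains v where "v \<in> W_af" "\<And>x. v (u x) = x" "\<And>x. u (v x) = x"
proof -
  obtain w \<beta> where *: "w \<in> W" "\<beta> \<in> M" "u = (\<lambda>x. w x + \<beta>)"
    using assms W_af_iff by meson
  obtain w' where w': "w' \<in> W" "\<And>x. w' (w x) = x" "\<And>x. w (w' x) = x"
    using finite_weyl_group_inverse[OF *(1)] by blast
  have "(\<lambda>x. w' x + (- w' \<beta>)) \<in> W_af"
    by (rule W_af_I[OF w'(1) M_minus[OF M_W[OF w'(1) *(2)]]])
  moreover have "w' (w x + \<beta>) + - w' \<beta> = x" for x
    using W_linear[OF w'(1)] w' by (simp add: linear_add)
  moreover have "w (w' x + - w' \<beta>) + \<beta> = x" for x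
    using W_linear[OF *(1)] w' by (simp add: linear_diff)
  ultimately show ?thesis using that * by blast
qed

lemma W_af_inv:
  assumes "u \<in> W_af"
  shows "inv u \<in> W_af" "inv u (u x) = x" "u (inv u x) = x"
proof -
  obtain v where v: "v \<in> W_af" "\<And>x. v (u x) = x" "\<And>x. u (v x) = x"
    using W_af_inverse[OF assms] by blast
  then have "inv u = v" by (intro inv_unique_comp) auto
  with v show "inv u \<in> W_af" "inv u (u x) = x" "u (inv u x) = x" by auto
qed

lemma theta_conj: obtains w i where "w \<in> W" "i \<in> {1..l}" "\<theta> = w (\<alpha> i)"
  using theta_root by (auto simp: finite_roots_def)

lemma reflection_root:
  assumes "w \<in> W" "i \<in> {1..l}"
  shows "hyperplane_reflection (w (\<alpha> i)) 0 \<in> W"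
proof -
  obtain v where v: "v \<in> W" "\<And>x. v (w x) = x" "\<And>x. w (v x) = x"
    using finite_weyl_group_inverse[OF assms(1)] by blast
  have "hyperplane_reflection (w (\<alpha> i)) 0 = w \<circ> (hyperplane_reflection (\<alpha> i) 0 \<circ> v)"
    using orthogonal_conj_reflection[OF finite_weyl_group_orthogonal[OF assms(1)]] v by auto
  then show ?thesis using v assms by (auto intro!: finite_weyl_group_comp finite_weyl_group_reflection)
qed

lemma reflection_theta: "hyperplane_reflection \<theta> 0 \<in> W"
  using theta_conj reflection_root by metis

text \<open>The normalization makes \<open>\<theta>\<close> equal to its own coroot. Hence the
  translation part of the affine generator lies in \<open>M\<close>.\<close>

lemma theta_in_M: "\<theta> \<in> M"
proof -
  obtain w i where w: "w \<in> W" "i \<in> {1..l}" "\<theta> = w (\<alpha> i)" using theta_conj by blast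
  then have "\<alpha> i \<bullet> \<alpha> i = 2" using W_inner theta_norm by metis
  then have "cv i = \<alpha> i" by (simp add: cv_def)
  then show ?thesis using w M_cv M_W by metis
qed

lemma S0: "S 0 x = hyperplane_reflection \<theta> 0 x + \<theta>"
  using hyperplane_reflection_shift[of \<theta> 1 x] by (simp add: simple_reflection_def theta_norm)

lemma S_pos: "i \<noteq> 0 \<Longrightarrow> S i = hyperplane_reflection (\<alpha> i) 0"
  by (rule simple_reflection_pos)

lemma S_in_W_af: "i \<le> l \<Longrightarrow> S i \<in> W_af"
proof (cases "i = 0")
  case True
  then have "S i = (\<lambda>x. hyperplane_reflection \<theta> 0 x + \<theta>)" using S0 by auto
  then show ?thesis using W_af_I reflection_theta theta_in_M by simp
next
  case False
  assume "i \<le> l"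
  with False show ?thesis by (auto simp: S_pos intro!: W_subset_W_af finite_weyl_group_reflection)
qed

lemma wd_in_W_af: "ws \<in> lists {0..l} \<Longrightarrow> wd ws \<in> W_af"
proof (induction ws)
  case Nil
  show ?case unfolding word_Nil by (rule W_subset_W_af[OF id_in_finite_weyl_group])
next
  case (Cons i ws)
  then show ?case unfolding word_Cons by (intro W_af_comp S_in_W_af) auto
qed

text \<open>If \<open>u\<close> and \<open>g\<close> carry \<open>A0\<close> to the same alcove,
  then the inverse of \<open>g\<close> composed with \<open>u\<close> maps \<open>p\<close> into
  \<open>A0\<close>, so \<open>free\<close> gives \<open>u = g\<close>. It remains to match the
  alcoves reached by \<open>G\<close> with the orbit.\<close>

lemma translates_eq:
  assumes p: "p \<in> A0" and free: "\<And>u. u \<in> W_af \<Longrightarrow> u p \<in> A0 \<Longrightarrow> u = id"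
    and sub: "G \<subseteq> W_af"
    and G: "\<And>g. g \<in> G \<Longrightarrow> \<exists>\<mu>\<in>Orb. g ` A0 = (\<lambda>x. x + \<mu>) ` A0"
    and cover: "\<And>\<mu>. \<mu> \<in> Orb \<Longrightarrow> \<exists>g\<in>G. g ` A0 = (\<lambda>x. x + \<mu>) ` A0"
  shows "{u \<in> W_af. \<exists>\<mu>\<in>Orb. u ` A0 = (\<lambda>x. x + \<mu>) ` A0} = G"
proof (intro equalityI subsetI)
  fix u assume "u \<in> {u \<in> W_af. \<exists>\<mu>\<in>Orb. u ` A0 = (\<lambda>x. x + \<mu>) ` A0}"
  then obtain \<mu> where u: "u \<in> W_af" "\<mu> \<in> Orb" "u ` A0 = (\<lambda>x. x + \<mu>) ` A0" by blast
  obtain g where g: "g \<in> G" "g ` A0 = (\<lambda>x. x + \<mu>) ` A0" using cover u by blast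
  obtain v where v: "v \<in> W_af" "\<And>x. v (g x) = x" "\<And>x. g (v x) = x"
    using W_af_inverse sub g by blast
  have "u p \<in> g ` A0" using u g p by blast
  then have "(v \<circ> u) p \<in> A0" using v by auto
  then have "v \<circ> u = id" using free W_af_comp v u by blast
  then have "u = g" using v by (metis comp_apply ext id_apply)
  then show "u \<in> G" using g by simp
qed (use G sub in blast)

text \<open>The point \<open>p\<close> is \<open>\<rho>\<^sup>\<or>\<close> divided by the Coxeter number \<open>h\<close>; no other point of its
  orbit meets the alcove because the simple roots take values in \<open>\<int>/h\<close> on the orbit.\<close>

lemma orbit_in_alcove:
  assumes h: "h > 0" and p: "\<And>i. i \<in> {1..l} \<Longrightarrow> h * (\<alpha> i \<bullet> p) = 1"
    and pt: "h * (\<theta> \<bullet> p) = h - 1" and hZ: "h \<in> \<int>" and u: "u \<in> W_af" "u p \<in> A0"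
  shows "i \<in> {1..l} \<Longrightarrow> \<alpha> i \<bullet> p \<le> \<alpha> i \<bullet> u p" and "\<theta> \<bullet> u p \<le> \<theta> \<bullet> p"
proof -
  \<comment> \<open>The coweight lattice scaled by 1/h. It is stable under \<open>W\<close> because
    the Cartan pairings are integral, and under translation by \<open>M\<close> because
    \<open>h\<close> is an integer.\<close>
  define L where "L = {x. \<forall>i\<in>{1..l}. h * (\<alpha> i \<bullet> x) \<in> \<int>}"
  have L_W: "w x \<in> L" if "w \<in> W" "x \<in> L" for w x
    using that
  proof (rule finite_weyl_group_invariant)
    fix j x assume j: "j \<in> {1..l}" and x: "x \<in> L"
    have "h * (\<alpha> i \<bullet> x - (\<alpha> j \<bullet> x) * (\<alpha> i \<bullet> cv j)) \<in> \<int>" if "i \<in> {1..l}" for i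
    proof -
      have "h * (\<alpha> i \<bullet> x) - (h * (\<alpha> j \<bullet> x)) * (\<alpha> i \<bullet> cv j) \<in> \<int>"
        using j x that alpha_cv[OF that j] unfolding L_def
        by (intro Ints_diff Ints_mult[of "h * (\<alpha> j \<bullet> x)"]) auto
      then show ?thesis by (simp add: algebra_simps)
    qed
    then show "hyperplane_reflection (\<alpha> j) 0 x \<in> L"
      by (simp add: L_def reflection_cv inner_diff_right)
  qed
  have pL: "p \<in> L" by (simp add: L_def p)
  obtain w \<beta> where w: "w \<in> W" "\<beta> \<in> M" "u = (\<lambda>x. w x + \<beta>)"
    using u W_af_iff by meson
  have "w p \<in> L" using L_W pL w by blast
  then have q: "u p \<in> L"
    using M_alpha[OF w(2)] hZ by (auto simp: L_def w inner_add_right distrib_left)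
  { assume i: "i \<in> {1..l}"
    have "h * (\<alpha> i \<bullet> u p) \<in> \<int>" using q i by (simp add: L_def)
    then obtain m where m: "h * (\<alpha> i \<bullet> u p) = of_int m" by (rule Ints_cases)
    have "h * (\<alpha> i \<bullet> u p) > 0" using u i h by (simp add: fundamental_alcove_def)
    then have "h * (\<alpha> i \<bullet> u p) \<ge> h * (\<alpha> i \<bullet> p)" using m p[OF i] by simp
    then show "\<alpha> i \<bullet> p \<le> \<alpha> i \<bullet> u p" using h by simp }
  \<comment> \<open>As \<open>\<theta>\<close> is conjugate to a simple root and \<open>L\<close> is
    stable under \<open>W\<close>, its value at \<open>u p\<close> also lies in Z/h.\<close>
  obtain w' j where w': "w' \<in> W" "j \<in> {1..l}" "\<theta> = w' (\<alpha> j)" using theta_conj by blast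
  obtain v where v: "v \<in> W" "\<And>x. w' (v x) = x"
    using finite_weyl_group_inverse[OF w'(1)] by metis
  have "\<theta> \<bullet> u p = \<alpha> j \<bullet> v (u p)" using W_inner[OF w'(1), of "\<alpha> j" "v (u p)"] v w' by simp
  then have "h * (\<theta> \<bullet> u p) \<in> \<int>" using L_W[OF v(1) q] w' by (simp add: L_def)
  then obtain m where m: "h * (\<theta> \<bullet> u p) = of_int m" by (rule Ints_cases)
  \<comment> \<open>With both sides integers, being less than \<open>h\<close> improves to being at
    most \<open>h - 1\<close>, which is the value at \<open>p\<close>.\<close>
  obtain k where k: "h = of_int k" using hZ by (rule Ints_cases)
  have "h * (\<theta> \<bullet> u p) < h" using u h by (simp add: fundamental_alcove_def)
  then have "h * (\<theta> \<bullet> u p) \<le> h * (\<theta> \<bullet> p)" using m pt k by simp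
  then show "\<theta> \<bullet> u p \<le> \<theta> \<bullet> p" using h by simp
qed

text \<open>Pairing the fixed point equation with \<open>w e\<close> leaves
  \<open>w e \<bullet> \<beta>\<close>, an integer because the test vectors in \<open>E\<close> pair
  integrally with the coroots.\<close>

lemma stabilizer_shift:
  assumes u: "w \<in> W" "\<beta> \<in> M" "w p + \<beta> = p"
    and refl: "\<And>i e. i \<in> {1..l} \<Longrightarrow> e \<in> E \<Longrightarrow> hyperplane_reflection (\<alpha> i) 0 e \<in> E"
    and int: "\<And>i e. i \<in> {1..l} \<Longrightarrow> e \<in> E \<Longrightarrow> e \<bullet> cv i \<in> \<int>"
    and e: "e \<in> E"
  shows "w e \<in> E" "w e \<bullet> p - e \<bullet> p \<in> \<int>"
proof -
  show we: "w e \<in> E" using u(1) e refl by (rule finite_weyl_group_invariant)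
  have "w e \<bullet> p = w e \<bullet> (w p + \<beta>)" using u by simp
  also have "\<dots> = e \<bullet> p + w e \<bullet> \<beta>" using W_inner[OF u(1)] by (simp only: inner_add_right)
  finally show "w e \<bullet> p - e \<bullet> p \<in> \<int>"
    using M_inner_Ints[OF u(2), of 1 "w e"] int we by simp
qed

text \<open>Serves types A and C, where \<open>p\<close> separates the test vectors modulo the
  integers. In types B and D some \<open>e\<close> and \<open>- e\<close> have congruent values, and
  \<open>stabilizer_shift\<close> is combined with parity instead.\<close>

lemma stabilizer_trivial:
  assumes u: "u \<in> W_af" "u p = p"
    and refl: "\<And>i e. i \<in> {1..l} \<Longrightarrow> e \<in> E \<Longrightarrow> hyperplane_reflection (\<alpha> i) 0 e \<in> E"
    and int: "\<And>i e. i \<in> {1..l} \<Longrightarrow> e \<in> E \<Longrightarrow> e \<bullet> cv i \<in> \<int>"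
    and span: "span E = UNIV"
    and sep: "\<And>e e'. e \<in> E \<Longrightarrow> e' \<in> E \<Longrightarrow> e' \<bullet> p - e \<bullet> p \<in> \<int> \<Longrightarrow> e' = e"
  shows "u = id"
proof -
  obtain w \<beta> where w: "w \<in> W" "\<beta> \<in> M" "u = (\<lambda>x. w x + \<beta>)" using u W_af_iff by meson
  have "w e = e" if "e \<in> E" for e
    using stabilizer_shift[OF w(1,2) _ refl int that] u w that by (intro sep) auto
  then have "w x = x" for x using linear_span_idI[OF span W_linear[OF w(1)]] by blast
  then show ?thesis using u w by auto
qed

text \<open>The maximum of the values |e . x| over \<open>E\<close> is a seminorm invariant under
  \<open>W\<close>. Each generator has its linear part in \<open>W\<close>, so applying a further
  letter preserves the displacement made so far in this seminorm and adds at most one step of size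
  \<open>\<delta>\<close>.\<close>

lemma word_displacement:
  assumes refl: "\<And>i e. i \<in> {1..l} \<Longrightarrow> e \<in> E \<Longrightarrow> hyperplane_reflection (\<alpha> i) 0 e \<in> E"
    and step: "\<And>i e. i \<le> l \<Longrightarrow> e \<in> E \<Longrightarrow> \<bar>e \<bullet> (S i p - p)\<bar> \<le> \<delta>"
    and ws: "ws \<in> lists {0..l}" and e: "e \<in> E"
  shows "\<bar>e \<bullet> (wd ws p - p)\<bar> \<le> \<delta> * length ws"
  using ws e
proof (induction ws arbitrary: e)
  case (Cons i ws)
  define a where "a = (if i = 0 then \<theta> else \<alpha> i)"
  have il: "i \<le> l" using Cons.hyps by simp
  have aW: "hyperplane_reflection a 0 \<in> W"
    using il reflection_theta finite_weyl_group_reflection[of i l \<alpha>] by (auto simp: a_def)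
  have diff: "S i x - S i y = hyperplane_reflection a 0 (x - y)" for x y
    using S0 S_pos W_linear[OF aW] by (cases "i = 0") (auto simp: a_def linear_diff)
  have aE: "hyperplane_reflection a 0 e \<in> E"
    using aW Cons.prems refl by (rule finite_weyl_group_invariant)
  have "wd (i # ws) p - p = (S i (wd ws p) - S i p) + (S i p - p)" by simp
  then have "e \<bullet> (wd (i # ws) p - p) = hyperplane_reflection a 0 e \<bullet> (wd ws p - p) + e \<bullet> (S i p - p)"
    by (simp only: diff inner_add_right hyperplane_reflection_self_adjoint)
  moreover have "\<bar>hyperplane_reflection a 0 e \<bullet> (wd ws p - p)\<bar> \<le> \<delta> * length ws"
    using Cons aE by auto
  moreover have "\<bar>e \<bullet> (S i p - p)\<bar> \<le> \<delta>" using step il Cons.prems by simp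
  ultimately show ?case by (simp add: algebra_simps)
qed simp

lemma length_le: "ws \<in> lists {0..l} \<Longrightarrow> weyl_length l \<alpha> \<theta> (wd ws) \<le> length ws"
  unfolding weyl_length_def by (rule Least_le) auto

text \<open>By \<open>far\<close> the word attains the upper bound of
  \<open>word_displacement\<close>, so no shorter word can represent the same element.\<close>

lemma reduced_wordI:
  assumes refl: "\<And>i e. i \<in> {1..l} \<Longrightarrow> e \<in> E \<Longrightarrow> hyperplane_reflection (\<alpha> i) 0 e \<in> E"
    and step: "\<And>i e. i \<le> l \<Longrightarrow> e \<in> E \<Longrightarrow> \<bar>e \<bullet> (S i p - p)\<bar> \<le> \<delta>"
    and ws: "ws \<in> lists {0..l}" and e: "e \<in> E" and \<delta>: "\<delta> > 0"
    and far: "\<delta> * length ws \<le> \<bar>e \<bullet> (wd ws p - p)\<bar>"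
  shows "reduced_word l \<alpha> \<theta> ws"
proof -
  let ?k = "weyl_length l \<alpha> \<theta> (wd ws)"
  have "\<exists>vs\<in>lists {0..l}. length vs = ?k \<and> wd vs = wd ws"
    unfolding weyl_length_def by (rule LeastI[of _ "length ws"]) (use ws in blast)
  then obtain vs where vs: "vs \<in> lists {0..l}" "length vs = ?k" "wd vs = wd ws" by blast
  have "\<delta> * length ws \<le> \<delta> * length vs"
    using word_displacement[OF refl step vs(1) e] far vs(3) by simp
  then have "length ws \<le> ?k" using \<delta> vs by simp
  with length_le[OF ws] ws show ?thesis by (simp add: reduced_word_def)
qed

lemma coweight_orbit_W: "\<mu> \<in> Orb \<Longrightarrow> w \<in> W \<Longrightarrow> w \<mu> \<in> Orb"
  unfolding coweight_orbit_def by (auto simp: image_iff) (metis comp_apply finite_weyl_group_comp)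

lemma nu_in_orbit: "nu (first_coweight l \<alpha>) \<in> Orb"
  unfolding coweight_orbit_def by (rule image_eqI[of _ _ id]) auto

lemma coweight_orbit_subset:
  assumes "nu (first_coweight l \<alpha>) \<in> E"
    and "\<And>i e. i \<in> {1..l} \<Longrightarrow> e \<in> E \<Longrightarrow> hyperplane_reflection (\<alpha> i) 0 e \<in> E"
  shows "Orb \<subseteq> E"
proof
  fix \<mu> assume "\<mu> \<in> Orb"
  then obtain w where w: "w \<in> W" and \<mu>: "\<mu> = w (nu (first_coweight l \<alpha>))"
    by (auto simp: coweight_orbit_def)
  show "\<mu> \<in> E" unfolding \<mu> using w assms by (rule finite_weyl_group_invariant)
qed

end

text \<open>Compare the norms of both sides of \<open>\<theta> = \<theta>\<^sub>0 + (\<theta> - \<theta>\<^sub>0)\<close>.\<close>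

lemma highest_root_unique:
  assumes "highest_root l \<alpha> \<theta>" and root: "\<theta>0 \<in> finite_roots l \<alpha>"
    and dom: "\<And>i. i \<in> {1..l} \<Longrightarrow> 0 \<le> \<theta>0 \<bullet> \<alpha> i"
    and long: "\<And>i. i \<in> {1..l} \<Longrightarrow> \<alpha> i \<bullet> \<alpha> i \<le> \<theta>0 \<bullet> \<theta>0"
  shows "\<theta> = \<theta>0"
proof -
  obtain c :: "nat \<Rightarrow> nat" where c: "\<theta> - \<theta>0 = (\<Sum>i=1..l. real (c i) *\<^sub>R \<alpha> i)"
    using assms(1) root by (auto simp: highest_root_def)
  obtain w i where w: "w \<in> finite_weyl_group l \<alpha>" "i \<in> {1..l}" "\<theta> = w (\<alpha> i)"
    using assms(1) by (auto simp: highest_root_def finite_roots_def)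
  have "\<theta> \<bullet> \<theta> = \<alpha> i \<bullet> \<alpha> i"
    using finite_weyl_group_orthogonal[OF w(1)] w(3) by (simp add: orthogonal_transformation_def)
  then have le: "\<theta> \<bullet> \<theta> \<le> \<theta>0 \<bullet> \<theta>0" using long w by simp
  have "0 \<le> \<theta>0 \<bullet> (\<theta> - \<theta>0)"
    unfolding c inner_sum_right by (intro sum_nonneg) (simp add: dom)
  moreover have "\<theta> \<bullet> \<theta> = \<theta>0 \<bullet> \<theta>0 + 2 * (\<theta>0 \<bullet> (\<theta> - \<theta>0)) + (\<theta> - \<theta>0) \<bullet> (\<theta> - \<theta>0)"
    by (simp add: inner_diff_left inner_diff_right inner_commute)
  ultimately have "(\<theta> - \<theta>0) \<bullet> (\<theta> - \<theta>0) \<le> 0" using le by linarith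
  then have "(\<theta> - \<theta>0) \<bullet> (\<theta> - \<theta>0) = 0" using inner_ge_zero by (rule antisym)
  then show ?thesis by simp
qed

lemma integral_datumI:
  assumes "classical_root_datum X l \<alpha> \<theta>"
  shows "integral_datum l \<alpha> \<theta>"
proof
  note D = assms[unfolded classical_root_datum_def]
  show "\<alpha> i \<noteq> 0" if "i \<in> {1..l}" for i
    using D that dependent_zero by (metis imageI)
  have "cartan_matrix X l i j \<in> \<int>" for i j
    by (cases X) (simp_all add: path_cartan_entry_def)
  moreover have "2 * (\<alpha> i \<bullet> \<alpha> j) / (\<alpha> i \<bullet> \<alpha> i) = cartan_matrix X l i j"
    if "i \<in> {1..l}" "j \<in> {1..l}" for i j
    using D that by blast
  ultimately show "2 * (\<alpha> i \<bullet> \<alpha> j) / (\<alpha> i \<bullet> \<alpha> i) \<in> \<int>"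
    if "i \<in> {1..l}" "j \<in> {1..l}" for i j
    using that by presburger
  show "\<theta> \<in> finite_roots l \<alpha>" using D unfolding highest_root_def by blast
  show "\<theta> \<bullet> \<theta> = 2" "span (\<alpha> ` {1..l}) = UNIV" using D by blast+
qed

subsection \<open>Coordinates\<close>

text \<open>Both Cartan entries of neighbouring nodes are -1, and the inner product is symmetric, so
  neighbours have equal length; induction along the path spreads the length of
  \<open>\<alpha> 1\<close>.\<close>

lemma path_gram:
  fixes \<alpha> :: "nat \<Rightarrow> 'a::euclidean_space"
  assumes nz: "\<And>i. i \<in> {1..<n} \<Longrightarrow> \<alpha> i \<noteq> 0"
    and C: "\<And>i j. i \<in> {1..<n} \<Longrightarrow> j \<in> {1..<n} \<Longrightarrow>
      2 * (\<alpha> i \<bullet> \<alpha> j) / (\<alpha> i \<bullet> \<alpha> i) = path_cartan_entry i j"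
    and d: "d = (\<alpha> 1 \<bullet> \<alpha> 1) / 2"
  shows "i \<in> {1..<n} \<Longrightarrow> j \<in> {1..<n} \<Longrightarrow>
    \<alpha> i \<bullet> \<alpha> j = (if i = j then 2 * d else if i = Suc j \<or> j = Suc i then - d else 0)"
proof -
  have pair: "2 * (\<alpha> i \<bullet> \<alpha> j) = path_cartan_entry i j * (\<alpha> i \<bullet> \<alpha> i)"
    if "i \<in> {1..<n}" "j \<in> {1..<n}" for i j
    using C[OF that] nz[OF that(1)] by (simp add: field_simps)
  have norm: "\<alpha> i \<bullet> \<alpha> i = 2 * d" if "1 \<le> i" "i < n" for i
    using that
  proof (induction i rule: dec_induct)
    case base
    then show ?case by (simp add: d)
  next
    case (step i)
    then show ?case
      using pair[of i "Suc i"] pair[of "Suc i" i] by (simp add: path_cartan_entry_def inner_commute)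
  qed
  assume "i \<in> {1..<n}" "j \<in> {1..<n}"
  then show ?thesis using pair[of i j] norm[of i] norm[of j] by (auto simp: path_cartan_entry_def)
qed

text \<open>The vector \<open>f\<close> is the last coordinate vector, and the roots are added back
  one at a time to obtain the others, so \<open>f\<close> is the only ingredient that depends on the
  type. The inner products follow by induction downwards from \<open>n\<close>.\<close>

lemma chain_coordinates:
  fixes \<alpha> :: "nat \<Rightarrow> 'a::euclidean_space"
  assumes gram: "\<And>i j. i \<in> {1..<n} \<Longrightarrow> j \<in> {1..<n} \<Longrightarrow>
      \<alpha> i \<bullet> \<alpha> j = (if i = j then 2 * d else if i = Suc j \<or> j = Suc i then - d else 0)"
    and e: "\<And>i. e i = f + (\<Sum>k\<in>{i..<n}. \<alpha> k)"
    and f: "\<And>j. j \<in> {1..<n} \<Longrightarrow> \<alpha> j \<bullet> f = (if Suc j = n then - d else 0)"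
  shows "\<And>j. j \<in> {1..<n} \<Longrightarrow> \<alpha> j = e j - e (Suc j)"
    and "\<And>i j. i \<in> {1..n} \<Longrightarrow> j \<in> {1..<n} \<Longrightarrow>
      \<alpha> j \<bullet> e i = (if i = j then d else if i = Suc j then - d else 0)"
    and "\<And>i j. f \<bullet> f = d \<Longrightarrow> i \<in> {1..n} \<Longrightarrow> j \<in> {1..n} \<Longrightarrow> e i \<bullet> e j = (if i = j then d else 0)"
proof -
  have rec: "e j = \<alpha> j + e (Suc j)" if "j < n" for j
    using that by (simp add: e sum.atLeast_Suc_lessThan)
  then show "\<alpha> j = e j - e (Suc j)" if "j \<in> {1..<n}" for j
    using that by simp
  have en: "e n = f" by (simp add: e)
  have ae: "\<alpha> j \<bullet> e i = (if i = j then d else if i = Suc j then - d else 0)"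
    if "j \<in> {1..<n}" "i \<le> n" "1 \<le> i" for i j
    using that(2,3)
  proof (induction i rule: inc_induct)
    case base
    then show ?case using f[OF that(1)] that(1) by (auto simp: en)
  next
    case (step i)
    then show ?case using gram[of j i] that(1) rec[of i] by (auto simp: inner_add_right)
  qed
  then show "\<alpha> j \<bullet> e i = (if i = j then d else if i = Suc j then - d else 0)"
    if "i \<in> {1..n}" "j \<in> {1..<n}" for i j
    using that by simp
  assume ff: "f \<bullet> f = d"
  have ein: "e i \<bullet> e n = (if i = n then d else 0)" if "i \<le> n" "1 \<le> i" for i
    using that
  proof (induction i rule: inc_induct)
    case base
    then show ?case by (simp add: en ff)
  next
    case (step i)
    then show ?case using ae[of i n] rec[of i] by (auto simp: inner_add_left)
  qed
  have "e i \<bullet> e j = (if i = j then d else 0)" if "i \<in> {1..n}" "j \<le> n" "1 \<le> j" for i j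
    using that(2,3)
  proof (induction j rule: inc_induct)
    case base
    then show ?case using ein[of i] that(1) by simp
  next
    case (step j)
    then show ?case using ae[of j i] rec[of j] that(1)
      by (auto simp: inner_add_right inner_commute[of _ "\<alpha> j"])
  qed
  then show "e i \<bullet> e j = (if i = j then d else 0)" if "i \<in> {1..n}" "j \<in> {1..n}" for i j
    using that by simp
qed

text \<open>Here \<open>n\<close> counts coordinate vectors and \<open>l\<close> counts simple
  roots: \<open>l = n - 1\<close> in type A and \<open>l = n\<close> otherwise, which is why only
  inequalities are imposed. The parameter \<open>d\<close> is half the squared length of the roots
  along the path.\<close>

locale chain = integral_datum l \<alpha> \<theta>
  for l :: nat and \<alpha> :: "nat \<Rightarrow> 'a::euclidean_space" and \<theta> +
  fixes e :: "nat \<Rightarrow> 'a" and n :: nat and d :: real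
  assumes n2: "2 \<le> n" and n_le: "n \<le> Suc l" and l_le: "l \<le> n" and d_pos: "0 < d"
    and alpha_diff: "j \<in> {1..<n} \<Longrightarrow> \<alpha> j = e j - e (Suc j)"
    and alpha_e: "i \<in> {1..n} \<Longrightarrow> j \<in> {1..<n} \<Longrightarrow>
      \<alpha> j \<bullet> e i = (if i = j then d else if i = Suc j then - d else 0)"
    and span_e: "span (e ` {1..n}) = UNIV"
begin

lemma alpha_norm: "j \<in> {1..<n} \<Longrightarrow> \<alpha> j \<bullet> \<alpha> j = 2 * d"
  using alpha_diff[of j] alpha_e[of j j] alpha_e[of "Suc j" j] by (simp add: inner_diff_right)

lemma cv_chain: "j \<in> {1..<n} \<Longrightarrow> cv j = (1 / d) *\<^sub>R \<alpha> j"
  using d_pos by (simp add: cv_def alpha_norm)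

lemma reflection_e:
  assumes "j \<in> {1..<n}" "i \<in> {1..n}"
  shows "hyperplane_reflection (\<alpha> j) 0 (e i) = (if i = j then e (Suc j) else if i = Suc j then e j else e i)"
proof -
  have "hyperplane_reflection (\<alpha> j) 0 (e i) = e i - ((\<alpha> j \<bullet> e i) / d) *\<^sub>R \<alpha> j"
    by (simp add: hyperplane_reflection_def alpha_norm[OF assms(1)])
  also have "\<dots> = e i - (if i = j then 1 else if i = Suc j then - 1 else 0) *\<^sub>R (e j - e (Suc j))"
    unfolding alpha_e[OF assms(2,1)] using d_pos alpha_diff[OF assms(1)] by simp
  finally show ?thesis by auto
qed

lemma S_e:
  assumes "j \<in> {1..<n}" "i \<in> {1..n}"
  shows "S j (e i) = (if i = j then e (Suc j) else if i = Suc j then e j else e i)"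
  using reflection_e[OF assms] S_pos[of j] assms(1) by simp

lemma finite_letters: "ws \<in> lists {1..l} \<Longrightarrow> wd ws \<in> W"
  by (rule finite_weyl_group_word)

lemma chain_letters: "ws \<in> lists {1..<n} \<Longrightarrow> wd ws \<in> W"
  using n_le by (intro finite_weyl_group_word) auto

text \<open>The letter \<open>i\<close> acts first in the reversed list, and each letter carries the
  vector one index further.\<close>

lemma wd_move_down:
  assumes "1 \<le> i" "i \<le> j" "j \<le> n"
  shows "wd (rev [i..<j]) (e i) = e j"
  using assms(2,3)
proof (induction j rule: dec_induct)
  case (step j)
  then show ?case using S_e[of j j] assms(1) by simp
qed simp

lemma wd_move_up:
  assumes "1 \<le> i" "i \<le> j" "j \<le> n"
  shows "wd [i..<j] (e j) = e i"
  using wd_move_down[OF assms] word_rev_right[of \<alpha> \<theta> "[i..<j]" "e i"] by simp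

lemma wd_fix:
  assumes "ws \<in> lists {1..<n}" "k \<in> {1..n}" "k \<notin> set ws" "k \<notin> Suc ` set ws"
  shows "wd ws (e k) = e k"
  using assms by (induction ws) (auto simp: S_e)

lemma point_eqI:
  assumes "\<And>i. i \<in> {1..n} \<Longrightarrow> e i \<bullet> x = e i \<bullet> y"
  shows "x = y"
  using assms by (intro inner_span_eqI[OF span_e]) auto

end

text \<open>Supplies the last coordinate vector of type A, which is specified only by its pairings
  with the roots. The vector representing the functional \<open>g\<close> is its adjoint at
  1.\<close>

lemma linear_functional_exists:
  fixes \<alpha> :: "nat \<Rightarrow> 'a::euclidean_space" and c :: "nat \<Rightarrow> real"
  assumes "inj_on \<alpha> I" "independent (\<alpha> ` I)"
  obtains f where "\<And>i. i \<in> I \<Longrightarrow> \<alpha> i \<bullet> f = c i"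
proof -
  obtain g :: "'a \<Rightarrow> real" where g: "linear g" "\<And>x. x \<in> \<alpha> ` I \<Longrightarrow> g x = c (the_inv_into I \<alpha> x)"
    using linear_independent_extend[OF assms(2), of "\<lambda>x. c (the_inv_into I \<alpha> x)"] by auto
  have "\<alpha> i \<bullet> adjoint g 1 = c i" if "i \<in> I" for i
  proof -
    have "\<alpha> i \<bullet> adjoint g 1 = g (\<alpha> i)" using adjoint_works[OF g(1), of "\<alpha> i" 1] by simp
    then show ?thesis using g(2)[of "\<alpha> i"] that assms(1) by (simp add: the_inv_into_f_f)
  qed
  then show ?thesis using that by blast
qed

text \<open>Types B, C and D. In type A the \<open>n\<close> vectors live in dimension
  \<open>n - 1\<close> and cannot be orthogonal.\<close>

locale orthogonal_chain = chain n \<alpha> \<theta> e n d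
  for \<alpha> :: "nat \<Rightarrow> 'a::euclidean_space" and \<theta> e n d +
  assumes orth: "i \<in> {1..n} \<Longrightarrow> j \<in> {1..n} \<Longrightarrow> e i \<bullet> e j = (if i = j then d else 0)"
begin

text \<open>This set has two roles: its members are the test vectors for stabilizers and
  displacements, and up to the factor \<open>1 / d\<close> it contains the coweight orbit.\<close>

definition "SE = e ` {1..n} \<union> uminus ` e ` {1..n}"

lemma span_SE: "span SE = UNIV"
  using span_e span_mono[of "e ` {1..n}" SE] by (auto simp: SE_def)

lemma reflection_basis:
  assumes "j \<in> {1..n}" "i \<in> {1..n}"
  shows "hyperplane_reflection (e j) 0 (e i) = (if i = j then - e j else e i)"
  using assms d_pos by (auto simp: hyperplane_reflection_def orth scaleR_2)

lemma inner_reflection_basis: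
  assumes "j \<in> {1..n}" "i \<in> {1..n}"
  shows "e i \<bullet> hyperplane_reflection (e j) c x = (if i = j then 2 * c - e j \<bullet> x else e i \<bullet> x)"
  using assms d_pos by (auto simp: hyperplane_reflection_def orth inner_diff_right field_simps)

lemma SE_reflection_chain:
  assumes "j \<in> {1..<n}" "x \<in> SE"
  shows "hyperplane_reflection (\<alpha> j) 0 x \<in> SE"
proof -
  show ?thesis using assms(2) reflection_e[OF assms(1)] assms(1) unfolding SE_def
    by auto
qed

end

text \<open>The value \<open>\<kappa> = 1\<close> is type B with a short last root, and
  \<open>\<kappa> = 2\<close> is type C with a long one. The reflection in the last root is the same
  in both.\<close>

locale signed_chain = orthogonal_chain \<alpha> \<theta> e n d
  for \<alpha> :: "nat \<Rightarrow> 'a::euclidean_space" and \<theta> e n d +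
  fixes \<kappa> :: real
  assumes kappa: "\<kappa> = 1 \<or> \<kappa> = 2" and alpha_n: "\<alpha> n = \<kappa> *\<^sub>R e n"

locale fork_chain = orthogonal_chain \<alpha> \<theta> e n d
  for \<alpha> :: "nat \<Rightarrow> 'a::euclidean_space" and \<theta> e n d +
  assumes n4: "4 \<le> n" and alpha_n: "\<alpha> n = e (n - 1) + e n"

section \<open>Sign changes and the first coweight in types B and C\<close>

context signed_chain
begin

lemma n_mem: "n \<in> {1..n}" using n2 by simp

lemma reflection_n: "hyperplane_reflection (\<alpha> n) 0 = hyperplane_reflection (e n) 0"
  using hyperplane_reflection_scale[of \<kappa> "e n" 0] kappa by (auto simp: alpha_n)

lemma SE_reflection:
  assumes "i \<in> {1..n}" "x \<in> SE"
  shows "hyperplane_reflection (\<alpha> i) 0 x \<in> SE"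
proof (cases "i = n")
  case True
  show ?thesis
    unfolding True reflection_n using assms(2) reflection_basis[OF n_mem] by (auto simp: SE_def)
next
  case False
  then show ?thesis using SE_reflection_chain assms by auto
qed

lemma nu_coweight: "nu (first_coweight n \<alpha>) = (1 / d) *\<^sub>R e 1"
proof (rule nu_first_coweight[OF span_alpha])
  fix i assume "i \<in> {1..n}"
  then show "\<alpha> i \<bullet> ((1 / d) *\<^sub>R e 1) = (if i = 1 then 1 else 0)"
    using alpha_e[of 1 i] n2 d_pos by (cases "i = n") (auto simp: alpha_n orth)
qed

text \<open>The palindrome is the reflection in \<open>e n\<close> conjugated by a word that carries
  \<open>e n\<close> to \<open>e i\<close>.\<close>

lemma wd_palindrome:
  assumes "1 \<le> i" "i \<le> n"
  shows "wd ([i..<n] @ [n] @ rev [i..<n]) x = hyperplane_reflection (e i) 0 x"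
proof -
  have W: "wd [i..<n] \<in> W" using assms by (intro chain_letters) auto
  have "wd ([i..<n] @ [n] @ rev [i..<n]) x
      = wd [i..<n] (hyperplane_reflection (e n) 0 (wd (rev [i..<n]) x))"
    using n2 reflection_n S_pos[of n] by simp
  also have "\<dots> = hyperplane_reflection (e i) 0 x"
    using orthogonal_conj_reflection[OF finite_weyl_group_orthogonal[OF W]] wd_move_up[OF assms]
    by simp
  finally show ?thesis .
qed

end

section \<open>Paired sign changes and the first coweight in type D\<close>

context fork_chain
begin

lemma mem: "1 \<in> {1..n}" "2 \<in> {1..n}" "n \<in> {1..n}" "n - 1 \<in> {1..n}"
  using n4 by auto

lemma alpha_n1: "\<alpha> (n - 1) = e (n - 1) - e n"
  using alpha_diff[of "n - 1"] n4 by simp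

lemma reflection_n_e:
  assumes "i \<in> {1..n}"
  shows "hyperplane_reflection (\<alpha> n) 0 (e i) = (if i = n then - e (n - 1) else if i = n - 1 then - e n else e i)"
proof -
  have "(e (n - 1) + e n) \<bullet> (e (n - 1) + e n) = 2 * d"
    using n4 by (simp add: inner_add_left inner_add_right orth)
  then show ?thesis
    using assms n4 d_pos
    by (auto simp: alpha_n hyperplane_reflection_def inner_add_left orth)
qed

lemma SE_reflection:
  assumes "i \<in> {1..n}" "x \<in> SE"
  shows "hyperplane_reflection (\<alpha> i) 0 x \<in> SE"
proof (cases "i = n")
  case True
  show ?thesis
    unfolding True using assms(2) reflection_n_e mem by (auto simp: SE_def)
next
  case False
  then show ?thesis using SE_reflection_chain assms by auto
qed

lemma nu_coweight: "nu (first_coweight n \<alpha>) = (1 / d) *\<^sub>R e 1"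
proof (rule nu_first_coweight[OF span_alpha])
  fix i assume "i \<in> {1..n}"
  then show "\<alpha> i \<bullet> ((1 / d) *\<^sub>R e 1) = (if i = 1 then 1 else 0)"
    using alpha_e[of 1 i] n4 d_pos
    by (cases "i = n") (auto simp: alpha_n orth inner_add_left)
qed

lemma inner_reflection: "x \<bullet> hyperplane_reflection a 0 y = hyperplane_reflection a 0 x \<bullet> y"
  by (rule hyperplane_reflection_self_adjoint[symmetric])

text \<open>The roots \<open>e (n - 1) - e n\<close> and \<open>e (n - 1) + e n\<close> are
  orthogonal, so the product of their reflections is -1 on the plane that they span, as is the
  product of the reflections in \<open>e (n - 1)\<close> and \<open>e n\<close>.\<close>

lemma S_n_n1: "S n (S (n - 1) x) = hyperplane_reflection (e (n - 1)) 0 (hyperplane_reflection (e n) 0 x)"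
proof (rule point_eqI)
  fix i assume i: "i \<in> {1..n}"
  have 1: "S (n - 1) = hyperplane_reflection (\<alpha> (n - 1)) 0" "S n = hyperplane_reflection (\<alpha> n) 0"
    using n4 by (auto simp: S_pos)
  have 2: "hyperplane_reflection (\<alpha> (n - 1)) 0 (e i) = (if i = n - 1 then e n else if i = n then e (n - 1) else e i)"
    if "i \<in> {1..n}" for i
    using reflection_e[of "n - 1" i] n4 that by simp
  note facts = 1 2 mem inner_reflection
  note facts' = facts[unfolded One_nat_def]
  consider "i = n" | "i = n - 1" | "i \<noteq> n" "i \<noteq> n - 1" by blast
  then show "e i \<bullet> S n (S (n - 1) x)
      = e i \<bullet> hyperplane_reflection (e (n - 1)) 0 (hyperplane_reflection (e n) 0 x)"
  proof cases
    case 3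
    with i show ?thesis
      unfolding 1 inner_reflection using 2 reflection_n_e mem reflection_basis by simp
  qed (use n4 in \<open>simp_all add: facts' reflection_n_e reflection_basis\<close>)
qed

text \<open>The conjugating word carries \<open>e (n - 1)\<close> to \<open>e i\<close> but fixes
  \<open>e n\<close>; the sign change of the last coordinate therefore survives and becomes the
  extra alcove symmetry of type D.\<close>

lemma wd_palindrome:
  assumes "1 \<le> i" "i \<le> n - 1"
  shows "wd ([i..<n - 1] @ [n, n - 1] @ rev [i..<n - 1]) x
    = hyperplane_reflection (e i) 0 (hyperplane_reflection (e n) 0 x)"
proof -
  have W: "wd [i..<n - 1] \<in> W" using assms by (intro chain_letters) auto
  have fix_n: "wd [i..<n - 1] (e n) = e n" using assms n4 by (intro wd_fix) auto
  have "wd ([i..<n - 1] @ [n, n - 1] @ rev [i..<n - 1]) x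
      = wd [i..<n - 1] (hyperplane_reflection (e (n - 1)) 0 (hyperplane_reflection (e n) 0 (wd (rev [i..<n - 1]) x)))"
    using S_n_n1 by simp
  also have "\<dots> = hyperplane_reflection (e i) 0 (hyperplane_reflection (e n) 0 x)"
    using orthogonal_conj_reflection[OF finite_weyl_group_orthogonal[OF W]] wd_move_up[of i "n - 1"]
      fix_n assms by simp
  finally show ?thesis .
qed

end

subsection \<open>The highest roots\<close>

lemma finite_rootI: "w \<in> finite_weyl_group l \<alpha> \<Longrightarrow> i \<in> {1..l} \<Longrightarrow> w (\<alpha> i) \<in> finite_roots l \<alpha>"
  unfolding finite_roots_def by blast

context signed_chain
begin

lemma palindrome_in_W: "i \<in> {1..n} \<Longrightarrow> hyperplane_reflection (e i) 0 \<in> W"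
proof -
  assume i: "i \<in> {1..n}"
  have "wd ([i..<n] @ [n] @ rev [i..<n]) = hyperplane_reflection (e i) 0"
    using wd_palindrome i by (intro ext) auto
  moreover have "wd ([i..<n] @ [n] @ rev [i..<n]) \<in> W"
    using i by (intro finite_letters) auto
  ultimately show ?thesis by simp
qed

text \<open>Changing the sign of \<open>e 2\<close> in \<open>\<alpha> 1 = e 1 - e 2\<close>
  exhibits the candidate as a root. It is dominant and long, hence highest, and the norm condition
  on \<open>\<theta>\<close> then fixes \<open>d\<close>.\<close>

lemma theta_B:
  assumes "highest_root n \<alpha> \<theta>" "\<kappa> = 1"
  shows "\<theta> = e 1 + e 2" "d = 1"
proof -
  have "hyperplane_reflection (e 2) 0 (\<alpha> 1) = e 1 + e 2"
    using n2 alpha_diff[of 1] reflection_basis[of 2 1] reflection_basis[of 2 2]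
    by (simp add: numeral_2_eq_2 hyperplane_reflection_diff)
  moreover have "hyperplane_reflection (e 2) 0 (\<alpha> 1) \<in> finite_roots n \<alpha>"
    using n2 by (intro finite_rootI palindrome_in_W) auto
  ultimately have root: "e 1 + e 2 \<in> finite_roots n \<alpha>" by simp
  have norm: "(e 1 + e 2) \<bullet> (e 1 + e 2) = 2 * d"
    using n2 by (simp add: inner_add_left inner_add_right orth)
  show \<theta>: "\<theta> = e 1 + e 2"
  proof (rule highest_root_unique[OF assms(1) root])
    fix i assume i: "i \<in> {1..n}"
    show "0 \<le> (e 1 + e 2) \<bullet> \<alpha> i"
    proof (cases "i = n")
      case True
      then show ?thesis using n2 d_pos by (auto simp: alpha_n assms(2) inner_add_left orth)
    next
      case False
      then show ?thesis using i n2 d_pos alpha_e[of 1 i] alpha_e[of 2 i]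
        by (auto simp: inner_add_right inner_commute[of _ "\<alpha> i"])
    qed
    show "\<alpha> i \<bullet> \<alpha> i \<le> (e 1 + e 2) \<bullet> (e 1 + e 2)"
    proof (cases "i = n")
      case True
      then show ?thesis unfolding norm using n2 d_pos by (auto simp: alpha_n assms(2) orth)
    next
      case False
      then show ?thesis unfolding norm using i alpha_norm by simp
    qed
  qed
  show "d = 1" using theta_norm norm by (simp add: \<theta>)
qed

text \<open>The long simple root \<open>2 *\<^sub>R e n\<close> is moved to the first coordinate,
  where it is dominant.\<close>

lemma theta_C:
  assumes "highest_root n \<alpha> \<theta>" "\<kappa> = 2"
  shows "\<theta> = 2 *\<^sub>R e 1" "d = 1 / 2"
proof -
  have W: "wd [1..<n] \<in> W" using n2 by (intro chain_letters) auto
  have "wd [1..<n] (\<alpha> n) = 2 *\<^sub>R e 1"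
    using wd_move_up[of 1 n] n2 linear_cmul[OF W_linear[OF W]] by (simp add: alpha_n assms(2))
  moreover have "wd [1..<n] (\<alpha> n) \<in> finite_roots n \<alpha>"
    using n2 by (intro finite_rootI W) auto
  ultimately have root: "2 *\<^sub>R e 1 \<in> finite_roots n \<alpha>" by simp
  have norm: "(2 *\<^sub>R e 1) \<bullet> (2 *\<^sub>R e 1) = 4 * d"
    using n2 by (simp add: orth)
  show \<theta>: "\<theta> = 2 *\<^sub>R e 1"
  proof (rule highest_root_unique[OF assms(1) root])
    fix i assume i: "i \<in> {1..n}"
    show "0 \<le> (2 *\<^sub>R e 1) \<bullet> \<alpha> i"
    proof (cases "i = n")
      case True
      then show ?thesis using n2 d_pos by (auto simp: alpha_n assms(2) orth)
    next
      case False
      then show ?thesis using i n2 d_pos alpha_e[of 1 i] by (auto simp: inner_commute[of _ "\<alpha> i"])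
    qed
    show "\<alpha> i \<bullet> \<alpha> i \<le> (2 *\<^sub>R e 1) \<bullet> (2 *\<^sub>R e 1)"
    proof (cases "i = n")
      case True
      then show ?thesis unfolding norm using n2 d_pos by (auto simp: alpha_n assms(2) orth)
    next
      case False
      then show ?thesis unfolding norm using i alpha_norm[of i] d_pos by simp
    qed
  qed
  show "d = 1 / 2" using theta_norm norm by (simp add: \<theta>)
qed

end

context fork_chain
begin

lemma palindrome_in_W:
  "i \<in> {1..n - 1} \<Longrightarrow> (\<lambda>x. hyperplane_reflection (e i) 0 (hyperplane_reflection (e n) 0 x)) \<in> W"
proof -
  assume i: "i \<in> {1..n - 1}"
  have "wd ([i..<n - 1] @ [n, n - 1] @ rev [i..<n - 1])
      = (\<lambda>x. hyperplane_reflection (e i) 0 (hyperplane_reflection (e n) 0 x))"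
    using wd_palindrome i by (intro ext) auto
  moreover have "wd ([i..<n - 1] @ [n, n - 1] @ rev [i..<n - 1]) \<in> W"
    using i n4 by (intro finite_letters) auto
  ultimately show ?thesis by simp
qed

text \<open>Signs change in pairs here, so \<open>e 2\<close> is negated together with
  \<open>e n\<close>; since \<open>n\<close> is at least 4, the latter does not affect
  \<open>\<alpha> 1\<close>.\<close>

lemma theta_D:
  assumes "highest_root n \<alpha> \<theta>"
  shows "\<theta> = e 1 + e 2" "d = 1"
proof -
  have "hyperplane_reflection (e 2) 0 (hyperplane_reflection (e n) 0 (\<alpha> 1)) = e 1 + e 2"
    using n4 alpha_diff[of 1]
    by (simp add: numeral_2_eq_2 reflection_basis hyperplane_reflection_diff)
  moreover have "hyperplane_reflection (e 2) 0 (hyperplane_reflection (e n) 0 (\<alpha> 1)) \<in> finite_roots n \<alpha>"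
    using n4 finite_rootI[OF palindrome_in_W[of 2], of 1] by simp
  ultimately have root: "e 1 + e 2 \<in> finite_roots n \<alpha>" by simp
  have norm: "(e 1 + e 2) \<bullet> (e 1 + e 2) = 2 * d"
    using n4 by (simp add: inner_add_left inner_add_right orth)
  show \<theta>: "\<theta> = e 1 + e 2"
  proof (rule highest_root_unique[OF assms(1) root])
    fix i assume i: "i \<in> {1..n}"
    show "0 \<le> (e 1 + e 2) \<bullet> \<alpha> i"
    proof (cases "i = n")
      case True
      then show ?thesis using n4 d_pos by (auto simp: alpha_n inner_add_left inner_add_right orth)
    next
      case False
      then show ?thesis using i n2 d_pos alpha_e[of 1 i] alpha_e[of 2 i]
        by (auto simp: inner_add_right inner_commute[of _ "\<alpha> i"])
    qed
    show "\<alpha> i \<bullet> \<alpha> i \<le> (e 1 + e 2) \<bullet> (e 1 + e 2)"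
    proof (cases "i = n")
      case True
      then show ?thesis unfolding norm using n4 d_pos
        by (auto simp: alpha_n inner_add_left inner_add_right orth)
    next
      case False
      then show ?thesis unfolding norm using i alpha_norm by simp
    qed
  qed
  show "d = 1" using theta_norm norm by (simp add: \<theta>)
qed

end

lemma span_chain:
  fixes \<alpha> :: "nat \<Rightarrow> 'a::euclidean_space"
  assumes "span (\<alpha> ` I) = UNIV" "\<And>i. i \<in> I \<Longrightarrow> \<alpha> i \<in> span E"
  shows "span E = UNIV"
  using span_mono[of "\<alpha> ` I" "span E"] assms by (auto simp: span_span)

lemma classical_pairing:
  assumes "classical_root_datum X l \<alpha> \<theta>" "i \<in> {1..l}" "j \<in> {1..l}"
  shows "2 * (\<alpha> i \<bullet> \<alpha> j) = cartan_matrix X l i j * (\<alpha> i \<bullet> \<alpha> i)"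
    "2 * (\<alpha> i \<bullet> \<alpha> j) / (\<alpha> i \<bullet> \<alpha> i) = cartan_matrix X l i j" "\<alpha> i \<noteq> 0"
proof -
  interpret integral_datum l \<alpha> \<theta> using assms(1) by (rule integral_datumI)
  show 1: "2 * (\<alpha> i \<bullet> \<alpha> j) / (\<alpha> i \<bullet> \<alpha> i) = cartan_matrix X l i j"
    using assms unfolding classical_root_datum_def by blast
  show 2: "\<alpha> i \<noteq> 0" using nonzero assms(2) .
  show "2 * (\<alpha> i \<bullet> \<alpha> j) = cartan_matrix X l i j * (\<alpha> i \<bullet> \<alpha> i)"
    using 1 2 by (simp add: field_simps)
qed

lemma classical_gram:
  assumes dat: "classical_root_datum X l \<alpha> \<theta>" and n: "n \<le> Suc l"
    and C: "\<And>i j. i \<in> {1..<n} \<Longrightarrow> j \<in> {1..<n} \<Longrightarrow> cartan_matrix X l i j = path_cartan_entry i j"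
    and d: "d = (\<alpha> 1 \<bullet> \<alpha> 1) / 2" and ij: "i \<in> {1..<n}" "j \<in> {1..<n}"
  shows "\<alpha> i \<bullet> \<alpha> j = (if i = j then 2 * d else if i = Suc j \<or> j = Suc i then - d else 0)"
proof (rule path_gram[where \<alpha> = \<alpha> and n = n])
  fix i assume "i \<in> {1..<n}"
  then show "\<alpha> i \<noteq> 0" using classical_pairing(3)[OF dat, of i i] n by auto
next
  fix i j assume "i \<in> {1..<n}" "j \<in> {1..<n}"
  then show "2 * (\<alpha> i \<bullet> \<alpha> j) / (\<alpha> i \<bullet> \<alpha> i) = path_cartan_entry i j"
    using classical_pairing(2)[OF dat, of i j] C n by auto
qed (use d ij in auto)

lemma orthogonal_chainI:
  fixes \<alpha> :: "nat \<Rightarrow> 'a::euclidean_space"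
  assumes dat: "classical_root_datum X n \<alpha> \<theta>" and n: "2 \<le> n"
    and C: "\<And>i j. i \<in> {1..<n} \<Longrightarrow> j \<in> {1..<n} \<Longrightarrow> cartan_matrix X n i j = path_cartan_entry i j"
    and e: "e = (\<lambda>i. f + (\<Sum>k\<in>{i..<n}. \<alpha> k))" and d: "d = (\<alpha> 1 \<bullet> \<alpha> 1) / 2"
    and f: "\<And>j. j \<in> {1..<n} \<Longrightarrow> \<alpha> j \<bullet> f = (if Suc j = n then - d else 0)" "f \<bullet> f = d"
    and last: "\<alpha> n \<in> span {e (n - 1), e n}"
  shows "orthogonal_chain \<alpha> \<theta> e n d"
proof -
  interpret integral_datum n \<alpha> \<theta> using dat by (rule integral_datumI)
  have gram: "\<alpha> i \<bullet> \<alpha> j = (if i = j then 2 * d else if i = Suc j \<or> j = Suc i then - d else 0)"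
    if "i \<in> {1..<n}" "j \<in> {1..<n}" for i j
    by (rule classical_gram[OF dat _ C d that]) auto
  have c1: "\<alpha> j = e j - e (Suc j)" if "j \<in> {1..<n}" for j
    by (rule chain_coordinates(1)[OF gram _ f(1) that]) (simp_all add: e)
  have c2: "\<alpha> j \<bullet> e i = (if i = j then d else if i = Suc j then - d else 0)"
    if "i \<in> {1..n}" "j \<in> {1..<n}" for i j
    by (rule chain_coordinates(2)[OF gram _ f(1) that]) (simp_all add: e)
  have c3: "e i \<bullet> e j = (if i = j then d else 0)" if "i \<in> {1..n}" "j \<in> {1..n}" for i j
    by (rule chain_coordinates(3)[OF gram _ f(1,2) that]) (simp_all add: e)
  have span: "span (e ` {1..n}) = UNIV"
  proof (rule span_chain[OF span_alpha])
    fix i assume i: "i \<in> {1..n}"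
    show "\<alpha> i \<in> span (e ` {1..n})"
    proof (cases "i = n")
      case True
      have "{e (n - 1), e n} \<subseteq> e ` {1..n}" using n by auto
      then show ?thesis using last True span_mono by blast
    next
      case False
      then have "e i \<in> span (e ` {1..n})" "e (Suc i) \<in> span (e ` {1..n})"
        using i by (auto intro!: span_base)
      then show ?thesis using c1[of i] i False by (simp add: span_diff)
    qed
  qed
  have "0 < d" using nonzero[of 1] n by (simp add: d)
  then show ?thesis using n c1 c2 c3 span by unfold_locales auto
qed

lemma type_B_chain:
  fixes \<alpha> :: "nat \<Rightarrow> 'a::euclidean_space"
  assumes dat: "classical_root_datum TypeB n \<alpha> \<theta>" and n: "3 \<le> n"
  obtains e where "signed_chain \<alpha> \<theta> e n 1 1" "\<theta> = e 1 + e 2"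
proof -
  define d where "d = (\<alpha> 1 \<bullet> \<alpha> 1) / 2"
  define e where "e = (\<lambda>i. \<alpha> n + (\<Sum>k\<in>{i..<n}. \<alpha> k))"
  have C: "cartan_matrix TypeB n i j = path_cartan_entry i j" if "i \<in> {1..<n}" for i j
    using that by simp
  have "\<alpha> i \<bullet> \<alpha> i = 2 * d" if "i \<in> {1..<n}" for i
    using classical_gram[OF dat _ _ d_def that that] C by auto
  then have n1: "\<alpha> (n - 1) \<bullet> \<alpha> (n - 1) = 2 * d" using n by simp
  \<comment> \<open>These two entries and the known length of \<open>\<alpha> (n - 1)\<close>
    determine first the inner product of the last two roots and then the length of
    \<open>\<alpha> n\<close>.\<close>
  have "cartan_matrix TypeB n (n - 1) n = - 1" "cartan_matrix TypeB n n (n - 1) = - 2"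
    using n by (simp_all add: path_cartan_entry_def)
  then have pn: "2 * (\<alpha> (n - 1) \<bullet> \<alpha> n) = - 1 * (2 * d)" "2 * (\<alpha> n \<bullet> \<alpha> (n - 1)) = - 2 * (\<alpha> n \<bullet> \<alpha> n)"
    using classical_pairing(1)[OF dat, of "n - 1" n] classical_pairing(1)[OF dat, of n "n - 1"] n n1
    by simp_all
  have an: "\<alpha> (n - 1) \<bullet> \<alpha> n = - d" "\<alpha> n \<bullet> \<alpha> n = d"
    using pn inner_commute[of "\<alpha> n" "\<alpha> (n - 1)"] by linarith+
  have aj: "\<alpha> j \<bullet> \<alpha> n = (if Suc j = n then - d else 0)" if "j \<in> {1..<n}" for j
  proof (cases "Suc j = n")
    case True
    then show ?thesis using an by auto
  next
    case False
    then show ?thesis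
      using classical_pairing(1)[OF dat, of j n] that by (simp add: path_cartan_entry_def)
  qed
  have en: "e n = \<alpha> n" by (simp add: e_def)
  interpret orthogonal_chain \<alpha> \<theta> e n d
    by (rule orthogonal_chainI[OF dat _ C e_def d_def aj an(2)]) (use n en in \<open>auto intro: span_base\<close>)
  interpret signed_chain \<alpha> \<theta> e n d 1
    by unfold_locales (auto simp: en)
  have "highest_root n \<alpha> \<theta>" using dat by (simp add: classical_root_datum_def)
  from theta_B[OF this refl] show ?thesis
    using that signed_chain_axioms by metis
qed

lemma type_C_chain:
  fixes \<alpha> :: "nat \<Rightarrow> 'a::euclidean_space"
  assumes dat: "classical_root_datum TypeC n \<alpha> \<theta>" and n: "2 \<le> n"
  obtains e where "signed_chain \<alpha> \<theta> e n (1 / 2) 2" "\<theta> = 2 *\<^sub>R e 1"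
proof -
  define d where "d = (\<alpha> 1 \<bullet> \<alpha> 1) / 2"
  define e where "e = (\<lambda>i. (1 / 2) *\<^sub>R \<alpha> n + (\<Sum>k\<in>{i..<n}. \<alpha> k))"
  have C: "cartan_matrix TypeC n i j = path_cartan_entry i j" if "j \<in> {1..<n}" for i j
    using that by simp
  have "\<alpha> i \<bullet> \<alpha> i = 2 * d" if "i \<in> {1..<n}" for i
    using classical_gram[OF dat _ _ d_def that that] C by auto
  then have n1: "\<alpha> (n - 1) \<bullet> \<alpha> (n - 1) = 2 * d" using n by simp
  have "cartan_matrix TypeC n (n - 1) n = - 2" "cartan_matrix TypeC n n (n - 1) = - 1"
    using n by (simp_all add: path_cartan_entry_def)
  then have pn: "2 * (\<alpha> (n - 1) \<bullet> \<alpha> n) = - 2 * (2 * d)" "2 * (\<alpha> n \<bullet> \<alpha> (n - 1)) = - 1 * (\<alpha> n \<bullet> \<alpha> n)"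
    using classical_pairing(1)[OF dat, of "n - 1" n] classical_pairing(1)[OF dat, of n "n - 1"] n n1
    by simp_all
  have an: "\<alpha> (n - 1) \<bullet> \<alpha> n = - 2 * d" "\<alpha> n \<bullet> \<alpha> n = 4 * d"
    using pn inner_commute[of "\<alpha> n" "\<alpha> (n - 1)"] by linarith+
  have aj: "\<alpha> j \<bullet> (1 / 2) *\<^sub>R \<alpha> n = (if Suc j = n then - d else 0)" if "j \<in> {1..<n}" for j
  proof (cases "Suc j = n")
    case True
    then show ?thesis using an by auto
  next
    case False
    then show ?thesis
      using classical_pairing(1)[OF dat, of j n] that by (simp add: path_cartan_entry_def)
  qed
  have en: "e n = (1 / 2) *\<^sub>R \<alpha> n" by (simp add: e_def)
  have nn: "((1 / 2) *\<^sub>R \<alpha> n) \<bullet> ((1 / 2) *\<^sub>R \<alpha> n) = d" using an by simp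
  have "2 *\<^sub>R e n \<in> span {e (n - 1), e n}" by (intro span_scale span_base) simp
  then have last: "\<alpha> n \<in> span {e (n - 1), e n}" by (simp add: en)
  interpret orthogonal_chain \<alpha> \<theta> e n d
    by (rule orthogonal_chainI[OF dat n C e_def d_def aj nn last])
  interpret signed_chain \<alpha> \<theta> e n d 2
    by unfold_locales (auto simp: en)
  have "highest_root n \<alpha> \<theta>" using dat by (simp add: classical_root_datum_def)
  from theta_C[OF this refl] show ?thesis
    using that signed_chain_axioms by metis
qed

lemma type_D_chain:
  fixes \<alpha> :: "nat \<Rightarrow> 'a::euclidean_space"
  assumes dat: "classical_root_datum TypeD n \<alpha> \<theta>" and n: "4 \<le> n"
  obtains e where "fork_chain \<alpha> \<theta> e n 1" "\<theta> = e 1 + e 2"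
proof -
  define d where "d = (\<alpha> 1 \<bullet> \<alpha> 1) / 2"
  \<comment> \<open>The two fork roots are to be \<open>e (n - 1) + e n\<close> and
    \<open>e (n - 1) - e n\<close>, so half their difference is the last coordinate vector.\<close>
  define f where "f = (1 / 2) *\<^sub>R (\<alpha> n - \<alpha> (n - 1))"
  define e where "e = (\<lambda>i. f + (\<Sum>k\<in>{i..<n}. \<alpha> k))"
  have C: "cartan_matrix TypeD n i j = path_cartan_entry i j" if "i \<in> {1..<n}" "j \<in> {1..<n}" for i j
    using that by (auto simp: doubleton_eq_iff)
  have gram: "\<alpha> i \<bullet> \<alpha> j = (if i = j then 2 * d else if i = Suc j \<or> j = Suc i then - d else 0)"
    if "i \<in> {1..<n}" "j \<in> {1..<n}" for i j
    by (rule classical_gram[OF dat _ C d_def that]) auto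
  have Cn: "cartan_matrix TypeD n j n = (if j = n - 2 then - 1 else 0)"
    "cartan_matrix TypeD n n j = (if j = n - 2 then - 1 else 0)" if "j \<in> {1..<n}" for j
    using that n by (auto simp: doubleton_eq_iff path_cartan_entry_def)
  have ajn: "\<alpha> j \<bullet> \<alpha> n = (if j = n - 2 then - d else 0)" if "j \<in> {1..<n}" for j
    using classical_pairing(1)[OF dat, of j n] that Cn[OF that] gram[OF that that] by (auto split: if_splits)
  have nn: "\<alpha> n \<bullet> \<alpha> n = 2 * d"
    using classical_pairing(1)[OF dat, of n "n - 2"] Cn[of "n - 2"] ajn[of "n - 2"] n
    by (simp add: inner_commute)
  have n1: "\<alpha> (n - 1) \<bullet> \<alpha> n = 0" using ajn[of "n - 1"] n by simp
  have aj: "\<alpha> j \<bullet> f = (if Suc j = n then - d else 0)" if "j \<in> {1..<n}" for j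
  proof -
    consider "j = n - 1" | "j = n - 2" | "j \<noteq> n - 1" "j \<noteq> n - 2" by blast
    then show ?thesis
    proof cases
      case 3
      then show ?thesis using ajn[OF that] gram[OF that, of "n - 1"] n that by (auto simp: f_def inner_diff_right)
    qed (use ajn[OF that] gram[OF that, of "n - 1"] n in \<open>auto simp: f_def inner_diff_right\<close>)
  qed
  have ff: "f \<bullet> f = d"
    using nn n1 gram[of "n - 1" "n - 1"] n
    by (simp add: f_def inner_diff_right inner_diff_left inner_commute[of "\<alpha> n" "\<alpha> (n - Suc 0)"])
  have en: "e n = f" by (simp add: e_def)
  have "e (n - 1) = f + \<alpha> (n - 1)"
    using n sum.atLeast_Suc_lessThan[of "n - 1" n \<alpha>] by (simp add: e_def)
  then have "e (n - 1) + e n = 2 *\<^sub>R f + \<alpha> (n - 1)" by (simp add: en scaleR_2)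
  then have an: "\<alpha> n = e (n - 1) + e n" by (simp add: f_def)
  have last: "\<alpha> n \<in> span {e (n - 1), e n}" unfolding an by (intro span_add span_base) auto
  interpret orthogonal_chain \<alpha> \<theta> e n d
    by (rule orthogonal_chainI[OF dat _ C e_def d_def aj ff last]) (use n in auto)
  interpret fork_chain \<alpha> \<theta> e n d
    by unfold_locales (use n an in auto)
  have "highest_root n \<alpha> \<theta>" using dat by (simp add: classical_root_datum_def)
  from theta_D[OF this] show ?thesis
    using that fork_chain_axioms by metis
qed

subsection \<open>Points and alcoves in coordinates\<close>

context orthogonal_chain
begin

text \<open>Division by \<open>d\<close>, the squared length of \<open>e j\<close>, makes
  \<open>c\<close> the list of inner products with the \<open>e j\<close> rather than of
  coefficients.\<close>

definition pt :: "(nat \<Rightarrow> real) \<Rightarrow> 'a" where "pt c = (\<Sum>j=1..n. (c j / d) *\<^sub>R e j)"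

lemma e_pt: "i \<in> {1..n} \<Longrightarrow> e i \<bullet> pt c = c i"
proof -
  assume i: "i \<in> {1..n}"
  have "e i \<bullet> pt c = (\<Sum>j=1..n. if j = i then c i else 0)"
    unfolding pt_def inner_sum_right using i d_pos by (intro sum.cong) (auto simp: orth)
  then show ?thesis using i by simp
qed

lemma alpha_inner: "j \<in> {1..<n} \<Longrightarrow> \<alpha> j \<bullet> x = e j \<bullet> x - e (Suc j) \<bullet> x"
  by (simp add: alpha_diff inner_diff_left)

lemma SE_inner_chain:
  assumes "x \<in> SE" "j \<in> {1..<n}"
  shows "x \<bullet> \<alpha> j \<in> {- d, 0, d}"
  using assms alpha_e by (auto simp: SE_def inner_commute)

lemma SE_cases:
  assumes "x \<in> SE"
  obtains i s where "i \<in> {1..n}" "s = 1 \<or> s = - 1" "x = s *\<^sub>R e i"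
  using assms by (fastforce simp: SE_def)

lemma e_SE: "i \<in> {1..n} \<Longrightarrow> e i \<in> SE" "i \<in> {1..n} \<Longrightarrow> - e i \<in> SE"
  by (auto simp: SE_def)

end

lemma inner_displacement:
  "x \<bullet> (hyperplane_reflection a c p - p) = - (2 * (a \<bullet> p - c) / (a \<bullet> a)) * (x \<bullet> a)"
  by (simp add: hyperplane_reflection_def)

lemma antitone_chain:
  fixes a :: "nat \<Rightarrow> real"
  assumes "\<And>i. i \<in> {1..<n} \<Longrightarrow> a (Suc i) \<le> a i" "1 \<le> i" "i \<le> j" "j \<le> n"
  shows "a j \<le> a i"
  using assms(3,4)
proof (induction j rule: dec_induct)
  case (step j)
  then show ?case using assms(1)[of j] assms(2) by fastforce
qed simp

context signed_chain
begin

lemma cv_n: "cv n = (2 / (\<kappa> * d)) *\<^sub>R e n"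
  using kappa d_pos n_mem by (auto simp: cv_def alpha_n orth)

text \<open>At the last node the pairing of \<open>e n\<close> with its coroot is
  \<open>2 / \<kappa>\<close>, which is 2 in type B and 1 in type C.\<close>

lemma SE_cv:
  assumes "i \<in> {1..n}" "x \<in> SE"
  shows "x \<bullet> cv i \<in> \<int>"
proof (cases "i = n")
  case True
  obtain j s where "j \<in> {1..n}" "s = 1 \<or> s = - 1" "x = s *\<^sub>R e j" using SE_cases assms(2) by blast
  then show ?thesis unfolding True cv_n using kappa d_pos n_mem by (auto simp: orth)
next
  case False
  then have "i \<in> {1..<n}" using assms by auto
  then show ?thesis using SE_inner_chain[OF assms(2)] cv_chain d_pos by fastforce
qed

lemma Orb_subset: "Orb \<subseteq> (*\<^sub>R) (1 / d) ` SE"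
proof (rule coweight_orbit_subset)
  show "nu (first_coweight n \<alpha>) \<in> (*\<^sub>R) (1 / d) ` SE"
    unfolding nu_coweight using n2 by (auto simp: SE_def)
next
  fix i x assume "i \<in> {1..n}" "x \<in> (*\<^sub>R) (1 / d) ` SE"
  then show "hyperplane_reflection (\<alpha> i) 0 x \<in> (*\<^sub>R) (1 / d) ` SE"
    using SE_reflection by (auto simp: hyperplane_reflection_cmul)
qed

end

lemma Ints_small: "x \<in> \<int> \<Longrightarrow> \<bar>x :: real\<bar> < 1 \<Longrightarrow> x = 0"
  using Ints_nonzero_abs_less1 by blast

context integral_datum
begin

lemma special_point_A0:
  assumes h: "h > 0" and p: "\<And>i. i \<in> {1..l} \<Longrightarrow> h * (\<alpha> i \<bullet> p) = 1" and pt: "h * (\<theta> \<bullet> p) = h - 1"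
  shows "p \<in> A0"
proof -
  have "0 < \<alpha> i \<bullet> p" if "i \<in> {1..l}" for i
  proof -
    have "0 < h * (\<alpha> i \<bullet> p)" using p[OF that] by simp
    then show ?thesis using h by (simp add: zero_less_mult_iff)
  qed
  moreover have "h * (\<theta> \<bullet> p) < h * 1" using pt by simp
  then have "\<theta> \<bullet> p < 1" using h by (simp only: mult_less_cancel_left_pos)
  ultimately show ?thesis by (simp add: fundamental_alcove_def)
qed

end

subsection \<open>Type C\<close>

locale type_C = signed_chain \<alpha> \<theta> e n "1 / 2" 2
  for \<alpha> :: "nat \<Rightarrow> 'a::euclidean_space" and \<theta> e n +
  assumes theta: "\<theta> = 2 *\<^sub>R e 1"
begin

text \<open>The Coxeter number is \<open>2 * n\<close>: consecutive coordinates differ by 1/(2n),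
  and the last is 1/(4n) because \<open>\<alpha> n\<close> is twice \<open>e n\<close>.\<close>

definition p :: 'a where "p = pt (\<lambda>i. (2 * (n - i) + 1) / (4 * n))"

lemma e_p: "i \<in> {1..n} \<Longrightarrow> e i \<bullet> p = (2 * (n - i) + 1) / (4 * n)"
  unfolding p_def by (simp add: e_pt)

lemma alpha_p: "i \<in> {1..n} \<Longrightarrow> 2 * real n * (\<alpha> i \<bullet> p) = 1"
proof (cases "i = n")
  case True
  then show ?thesis using e_p[of n] n2 by (simp add: alpha_n)
next
  case False
  assume "i \<in> {1..n}"
  with False have "i \<in> {1..<n}" by simp
  then show ?thesis using e_p[of i] e_p[of "Suc i"]
    by (simp add: alpha_inner field_simps of_nat_diff)
qed

lemma theta_p: "2 * real n * (\<theta> \<bullet> p) = 2 * real n - 1"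
  using e_p[of 1] n2 by (simp add: theta field_simps of_nat_diff)

lemma p_A0: "p \<in> A0"
  using n2 by (intro special_point_A0[OF _ alpha_p theta_p]) auto

lemma free:
  assumes u: "u \<in> W_af" "u p \<in> A0"
  shows "u = id"
proof -
  have n0: "0 < 2 * real n" using n2 by simp
  note le = orbit_in_alcove[OF n0 alpha_p theta_p _ u]
  \<comment> \<open>In these terms \<open>orbit_in_alcove\<close> says that \<open>a\<close> is
    weakly decreasing, nonnegative at \<open>n\<close> and nonpositive at 1, so it vanishes.\<close>
  define a where "a i = e i \<bullet> u p - e i \<bullet> p" for i
  have mono: "a (Suc i) \<le> a i" if "i \<in> {1..<n}" for i
    using le(1)[of i] that by (simp add: alpha_inner a_def)
  have an: "0 \<le> a n" using le(1)[of n] n2 by (simp add: a_def alpha_n)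
  have a1: "a 1 \<le> 0" using le(2) by (simp add: a_def theta)
  have "a i = 0" if "i \<in> {1..n}" for i
    using antitone_chain[of n a 1 i] antitone_chain[of n a i n] mono an a1 that by fastforce
  then have "u p = p" by (intro point_eqI) (simp add: a_def)
  then show ?thesis
  proof (rule stabilizer_trivial[OF u(1) _ SE_reflection SE_cv span_SE])
    fix x y assume "x \<in> SE" "y \<in> SE" and int: "y \<bullet> p - x \<bullet> p \<in> \<int>"
    then obtain i s j t where *: "i \<in> {1..n}" "s = 1 \<or> s = - 1" "x = s *\<^sub>R e i"
      "j \<in> {1..n}" "t = 1 \<or> t = - 1" "y = t *\<^sub>R e j"
      using SE_cases by metis
    \<comment> \<open>Strictness at both ends matters: two signed coordinates then differ by less
      than 1, so congruent ones are equal, and a nonzero value determines its sign.\<close>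
    have pos: "0 < e i \<bullet> p \<and> e i \<bullet> p < 1 / 2" if "i \<in> {1..n}" for i
      unfolding e_p[OF that] using that by (auto simp: field_simps of_nat_diff)
    have eq: "y \<bullet> p - x \<bullet> p = 0"
      using Ints_small[OF int] pos[OF *(1)] pos[OF *(4)] * by auto
    then have "s = t" "e i \<bullet> p = e j \<bullet> p"
      using pos[OF *(1)] pos[OF *(4)] * by auto
    moreover from this(2) have "i = j"
      using e_p *(1,4) by (auto simp: of_nat_diff)
    ultimately show "y = x" using * by simp
  qed auto
qed

text \<open>The palindrome and the linear part of the affine generator are the same reflection, so
  they cancel and leave a translation.\<close>

lemma wordC_eq: "wd (wordC n) x = x - \<theta>"
proof -
  have "hyperplane_reflection \<theta> 0 = hyperplane_reflection (e 1) 0"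
    using hyperplane_reflection_scale[of 2 "e 1" 0] by (simp add: theta)
  moreover have "wordC n = ([1..<n] @ [n] @ rev [1..<n]) @ [0]"
    using n2 by (simp add: wordC_def)
  then have "wd (wordC n) x = wd ([1..<n] @ [n] @ rev [1..<n]) (S 0 x)" by simp
  ultimately show ?thesis
    using wd_palindrome[of 1] S0[of x] n2 reflection_basis[of 1 1]
    by (simp add: hyperplane_reflection_add theta hyperplane_reflection_cmul)
qed

text \<open>The lengths of the roots are compensated by their pairings with \<open>SE\<close>: every
  generator moves \<open>p\<close> by 1/(2n) in this norm. The \<open>2 * n\<close> letters of
  \<open>wordC\<close> can thus just produce the displacement 1 seen by \<open>e 1\<close>.\<close>

lemma SE_step:
  assumes "i \<le> n" "x \<in> SE"
  shows "\<bar>x \<bullet> (S i p - p)\<bar> \<le> 1 / (2 * n)"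
proof -
  obtain j s where x: "j \<in> {1..n}" "s = 1 \<or> s = - 1" "x = s *\<^sub>R e j" using SE_cases assms(2) by blast
  consider "i = 0" | "i = n" | "i \<in> {1..<n}" using assms(1) by force
  then show ?thesis
  proof cases
    case 1
    have "\<theta> \<bullet> p - 1 = - 1 / (2 * n)" using theta_p n2 by (simp add: field_simps)
    then show ?thesis using x n2 theta_norm
      by (auto simp: 1 simple_reflection_def inner_displacement theta orth)
  next
    case 2
    have "\<alpha> n \<bullet> p = 1 / (2 * n)" using alpha_p[of n] n2 by (simp add: field_simps)
    then show ?thesis using x n2
      by (auto simp: 2 simple_reflection_def inner_displacement alpha_n orth)
  next
    case 3
    have "\<alpha> i \<bullet> p = 1 / (2 * n)" using alpha_p[of i] 3 n2 by (simp add: field_simps)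
    then have "\<bar>x \<bullet> (S i p - p)\<bar> = \<bar>x \<bullet> \<alpha> i\<bar> / n"
      using 3 by (simp add: simple_reflection_def inner_displacement alpha_norm abs_mult)
    moreover have "\<bar>x \<bullet> \<alpha> i\<bar> \<le> 1 / 2"
      using SE_inner_chain[OF assms(2) 3] by auto
    ultimately show ?thesis using n2 by (simp add: field_simps)
  qed
qed

lemma reduced: "reduced_word n \<alpha> \<theta> (wordC n)"
proof (rule reduced_wordI[OF SE_reflection SE_step])
  show "e 1 \<in> SE" using n2 by (intro e_SE) simp
  show "wordC n \<in> lists {0..n}" by (auto simp: wordC_def)
  have "length (wordC n) = 2 * n" using n2 by (simp add: wordC_def)
  then show "1 / (2 * n) * length (wordC n) \<le> \<bar>e 1 \<bullet> (wd (wordC n) p - p)\<bar>"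
    using n2 orth[of 1 1] by (simp add: wordC_eq) (simp add: theta)
qed (use n2 in auto)

lemma Z_ideal_C: "Z_ideal n \<alpha> \<theta> = bruhat_ideal n \<alpha> \<theta> (conjugates W_af (wd (wordC n)))"
proof -
  have refl: "hyperplane_reflection (e 1) 0 \<theta> = - \<theta>"
    using reflection_basis[of 1 1] n2 by (simp add: theta hyperplane_reflection_cmul)
  have W1: "hyperplane_reflection (e 1) 0 \<in> W" using n2 by (intro palindrome_in_W) auto
  have nu: "nu (first_coweight n \<alpha>) = \<theta>" by (simp add: nu_coweight theta)
  \<comment> \<open>Conjugating a translation depends only on the linear part of \<open>g\<close>;
    the lattice vector \<open>\<beta>\<close> cancels.\<close>
  have conj: "g \<circ> wd (wordC n) \<circ> inv g = (\<lambda>x. x + w (- \<theta>))"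
    if "w \<in> W" "\<beta> \<in> M" "g = (\<lambda>x. w x + \<beta>)" for g w \<beta>
  proof
    fix x
    have "g \<in> W_af" using W_af_I that by simp
    then have "g (inv g x) = x" by (rule W_af_inv)
    moreover have "g (y - \<theta>) = g y + w (- \<theta>)" for y
      using linear_diff[OF W_linear[OF that(1)]] linear_neg[OF W_linear[OF that(1)]] that(3) by simp
    ultimately show "(g \<circ> wd (wordC n) \<circ> inv g) x = x + w (- \<theta>)" by (simp add: wordC_eq)
  qed
  have t: "wd (wordC n) \<in> W_af" by (rule wd_in_W_af) (auto simp: wordC_def)
  have "{u \<in> W_af. \<exists>\<mu>\<in>Orb. u ` A0 = (\<lambda>x. x + \<mu>) ` A0} = conjugates W_af (wd (wordC n))"
  proof (rule translates_eq[OF p_A0 free])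
    show "conjugates W_af (wd (wordC n)) \<subseteq> W_af"
      unfolding conjugates_def using t W_af_inv(1) by (blast intro!: W_af_comp)
  next
    fix g assume "g \<in> conjugates W_af (wd (wordC n))"
    then obtain h where h: "h \<in> W_af" "g = h \<circ> wd (wordC n) \<circ> inv h" by (auto simp: conjugates_def)
    then obtain w \<beta> where w: "w \<in> W" "\<beta> \<in> M" "h = (\<lambda>x. w x + \<beta>)" using W_af_iff by meson
    have "w (hyperplane_reflection (e 1) 0 \<theta>) \<in> Orb"
      using coweight_orbit_W nu_in_orbit nu w W1 by metis
    then show "\<exists>\<mu>\<in>Orb. g ` A0 = (\<lambda>x. x + \<mu>) ` A0"
      using conj[OF w] h refl by auto
  next
    fix \<mu> assume "\<mu> \<in> Orb"
    then obtain w where w: "w \<in> W" "\<mu> = w \<theta>" unfolding coweight_orbit_def nu by blast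
    \<comment> \<open>The reflection in \<open>e 1\<close> negates \<open>\<theta>\<close> and so
      absorbs the minus sign of \<open>wordC_eq\<close>.\<close>
    define v where "v = w \<circ> hyperplane_reflection (e 1) 0"
    have v: "v \<in> W" using w W1 finite_weyl_group_comp v_def by blast
    have "v (- \<theta>) = \<mu>" by (simp add: v_def refl[unfolded One_nat_def] w)
    then have "v \<circ> wd (wordC n) \<circ> inv v = (\<lambda>x. x + \<mu>)"
      using conj[OF v M_0, of v] by simp
    moreover have "v \<circ> wd (wordC n) \<circ> inv v \<in> conjugates W_af (wd (wordC n))"
      using W_subset_W_af[OF v] by (auto simp: conjugates_def)
    ultimately show "\<exists>g\<in>conjugates W_af (wd (wordC n)). g ` A0 = (\<lambda>x. x + \<mu>) ` A0"
      by (intro bexI[of _ "\<lambda>x. x + \<mu>"]) simp_all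
  qed
  then show ?thesis unfolding Z_ideal_def by simp
qed

end

subsection \<open>Rotations of words\<close>

lemma adjacent_in_commute: "adjacent_in x y ws \<longleftrightarrow> adjacent_in y x ws"
  by (simp add: adjacent_in_def insert_commute)

lemma adjacent_in_middle: "adjacent_in x y (us @ [x, y] @ ws)"
  unfolding adjacent_in_def by (intro exI[of _ "length us"]) (auto simp: nth_append)

lemma not_adjacent_in_ends:
  assumes "x \<notin> set ws" "y \<notin> set ws" "x \<noteq> y" "ws \<noteq> []"
  shows "\<not> adjacent_in x y (y # ws @ [x])"
proof
  assume "adjacent_in x y (y # ws @ [x])"
  then obtain i where i: "Suc i < length (y # ws @ [x])"
    "{(y # ws @ [x]) ! i, (y # ws @ [x]) ! Suc i} = {x, y}"
    unfolding adjacent_in_def by blast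
  show False
  proof (cases "i < length ws")
    case True
    then have "(y # ws @ [x]) ! Suc i \<in> set ws" by (simp add: nth_append)
    then show False using i(2) assms by (metis insertI1 insertI2 empty_iff insertE)
  next
    case False
    then have "i = length ws" using i(1) by simp
    then have "(y # ws @ [x]) ! i \<in> set ws" using assms(4) by (cases ws rule: rev_cases) (auto simp: nth_Cons nth_append split: nat.splits)
    then show False using i(2) assms by (metis insertI1 insertI2 empty_iff insertE)
  qed
qed

text \<open>A rotation is a cut of the cyclic word. A cut at any place of \<open>m\<close>, ends
  included, keeps \<open>x\<close> and \<open>y\<close> together; the only other cut falls between
  them and sends them to opposite ends of the word, which does not count as adjacent.\<close>

lemma rotations_adjacent:
  assumes "x \<notin> set m" "y \<notin> set m" "x \<noteq> y" "m \<noteq> []"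
  shows "{ws \<in> rotations (m @ [x, y]). adjacent_in x y ws} = {b @ [x, y] @ a | a b. m = a @ b}"
proof (intro equalityI subsetI)
  fix ws assume "ws \<in> {ws \<in> rotations (m @ [x, y]). adjacent_in x y ws}"
  then obtain k where k: "ws = rotate k (m @ [x, y])" and adj: "adjacent_in x y ws"
    by (auto simp: rotations_def)
  define j where "j = k mod length (m @ [x, y])"
  have j: "j < length m + 2" and ws: "ws = drop j (m @ [x, y]) @ take j (m @ [x, y])"
    by (simp_all add: j_def k rotate_drop_take)
  show "ws \<in> {b @ [x, y] @ a | a b. m = a @ b}"
  proof (cases "j \<le> length m")
    case True
    then show ?thesis
      by (intro CollectI exI[of _ "take j m"] exI[of _ "drop j m"]) (simp add: ws)
  next
    case False
    then have "j = Suc (length m)" using j by simp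
    then have "ws = y # m @ [x]" by (simp add: ws)
    then show ?thesis using adj not_adjacent_in_ends assms by metis
  qed
next
  fix ws assume "ws \<in> {b @ [x, y] @ a | a b. m = a @ b}"
  then obtain a b where ab: "m = a @ b" "ws = b @ [x, y] @ a" by blast
  then have "ws = rotate (length a) (m @ [x, y])"
    using rotate_append[of a "b @ [x, y]"] by simp
  moreover have "adjacent_in x y ws" unfolding ab(2) by (rule adjacent_in_middle)
  ultimately show "ws \<in> {ws \<in> rotations (m @ [x, y]). adjacent_in x y ws}"
    by (auto simp: rotations_def)
qed

lemma append_split_middle:
  assumes "P @ core @ Q = a @ b"
  obtains P' where "P = a @ P'" "b = P' @ core @ Q"
  | Q' where "Q = Q' @ b" "a = P @ core @ Q'"
  | c c' where "core = c @ c'" "c \<noteq> []" "c' \<noteq> []" "a = P @ c" "b = c' @ Q"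
proof -
  obtain us where "P = a @ us \<and> us @ core @ Q = b \<or> P @ us = a \<and> core @ Q = us @ b"
    using assms append_eq_append_conv2[of P "core @ Q" a b] by blast
  then show ?thesis
  proof (elim disjE conjE)
    assume "P = a @ us" "us @ core @ Q = b"
    then show ?thesis using that(1) by blast
  next
    assume a: "P @ us = a" and "core @ Q = us @ b"
    then obtain vs where "core = us @ vs \<and> vs @ Q = b \<or> core @ vs = us \<and> Q = vs @ b"
      using append_eq_append_conv2[of core Q us b] by blast
    then show ?thesis
    proof (elim disjE conjE)
      assume core: "core = us @ vs" "vs @ Q = b"
      show ?thesis
      proof (cases "us = [] \<or> vs = []")
        case True
        then show ?thesis using that(1)[of "[]"] that(2)[of "[]"] core a by auto
      next
        case False
        then show ?thesis using that(3)[of us vs] core a by auto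
      qed
    next
      assume "core @ vs = us" "Q = vs @ b"
      then show ?thesis using that(2)[of vs] a by auto
    qed
  qed
qed

lemma upt_split: "i \<le> j \<Longrightarrow> j \<le> k \<Longrightarrow> [i..<k] = [i..<j] @ [j..<k]"
  using upt_add_eq_append[of i j "k - j"] by simp

lemma upt_eq_appendD:
  assumes "[i..<j] = xs @ ys" "i \<le> j"
  obtains k where "i \<le> k" "k \<le> j" "xs = [i..<k]" "ys = [k..<j]"
proof
  have len: "length xs \<le> j - i" using arg_cong[OF assms(1), of length] by simp
  then show "i + length xs \<le> j" using assms(2) by simp
  have "xs = take (length xs) [i..<j]" "ys = drop (length xs) [i..<j]" by (simp_all add: assms(1))
  with len show "xs = [i..<i + length xs]" "ys = [i + length xs..<j]"
    using assms(2) by (simp_all add: take_upt drop_upt)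
qed simp

text \<open>The cut lies in the ascending half, in the descending half or strictly inside
  \<open>core\<close>. The first two will give the translations by \<open>- e i\<close> and
  \<open>e i\<close>. The third cannot occur for the one-letter core of type B, and in type D it
  separates \<open>n\<close> from \<open>n - 1\<close>.\<close>

lemma palindrome_split:
  assumes "[k..<N] @ core @ rev [k..<N] = a @ b" "k \<le> N"
  obtains i where "k \<le> i" "i \<le> N" "a = [k..<i]" "b = [i..<N] @ core @ rev [k..<N]"
  | i where "k \<le> i" "i \<le> N" "b = rev [k..<i]" "a = [k..<N] @ core @ rev [i..<N]"
  | c c' where "core = c @ c'" "c \<noteq> []" "c' \<noteq> []" "a = [k..<N] @ c" "b = c' @ rev [k..<N]"
  using assms(1)
proof (rule append_split_middle)
  fix P' assume "[k..<N] = a @ P'" "b = P' @ core @ rev [k..<N]"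
  then show ?thesis using that(1) assms(2) by (metis upt_eq_appendD)
next
  fix Q' assume Q: "rev [k..<N] = Q' @ b" "a = [k..<N] @ core @ Q'"
  then have "[k..<N] = rev b @ rev Q'" by (metis rev_append rev_rev_ident)
  then obtain i where "k \<le> i" "i \<le> N" "rev b = [k..<i]" "rev Q' = [i..<N]"
    using assms(2) by (rule upt_eq_appendD)
  then show ?thesis using that(2)[of i] Q by (metis rev_rev_ident)
qed (use that(3) in blast)

subsection \<open>Diagrams branching at the affine node\<close>

context integral_datum
begin

text \<open>Moving \<open>a\<close> from the front to the back conjugates by its inverse. As
  \<open>t\<close> commutes with \<open>a\<close>, only the translation vector is affected.\<close>

lemma wd_rotate_left:
  assumes x: "\<And>x. wd (a @ b @ c) x = t x + \<mu>" and a: "a \<in> lists {1..l}"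
    and comm: "\<And>x. t (wd a x) = wd a (t x)"
  shows "wd (b @ c @ a) x = t x + wd (rev a) \<mu>"
proof -
  have W: "wd (rev a) \<in> W" using a by (intro finite_weyl_group_word) auto
  have "wd (b @ c @ a) x = wd (rev a) (wd (a @ b @ c) (wd a x))" by simp
  also have "\<dots> = t x + wd (rev a) \<mu>" unfolding x comm using linear_add[OF W_linear[OF W]] by simp
  finally show ?thesis .
qed

lemma wd_rotate_right:
  assumes x: "\<And>x. wd (c @ a @ b) x = t x + \<mu>" and b: "b \<in> lists {1..l}"
    and comm: "\<And>x. t (wd (rev b) x) = wd (rev b) (t x)"
  shows "wd (b @ c @ a) x = t x + wd b \<mu>"
proof -
  have W: "wd b \<in> W" using b by (intro finite_weyl_group_word) auto
  have "wd (b @ c @ a) x = wd b (wd (c @ a @ b) (wd (rev b) x))" by simp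
  also have "\<dots> = t x + wd b \<mu>" unfolding x comm using linear_add[OF W_linear[OF W]] by simp
  finally show ?thesis .
qed

end

text \<open>Common part of types B and D: the word \<open>core\<close> at the far end of the diagram acts, up to
  conjugation, as a sign change times a symmetry \<open>\<rho>\<close> of the alcove; \<open>\<rho>\<close> is the identity in type B
  and changes the sign of the last coordinate in type D.\<close>

locale branched_chain = orthogonal_chain \<alpha> \<theta> e n 1
  for \<alpha> :: "nat \<Rightarrow> 'a::euclidean_space" and \<theta> e n +
  fixes N :: nat and core :: "nat list" and \<rho> :: "'a \<Rightarrow> 'a"
  assumes theta: "\<theta> = e 1 + e 2"
    and N: "2 \<le> N" "N \<le> n"
    and palindrome: "wd ([2..<N] @ core @ rev [2..<N]) x = hyperplane_reflection (e 2) 0 (\<rho> x)"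
    and rho_S: "i < N \<Longrightarrow> \<rho> (S i x) = S i (\<rho> x)"
    and rho_A0: "\<rho> ` A0 = A0"
    and alpha_e1: "i \<in> {2..n} \<Longrightarrow> \<alpha> i \<bullet> e 1 = 0"
    and nu_e1: "nu (first_coweight n \<alpha>) = e 1"
begin

text \<open>Since \<open>e 1\<close> is a unit vector, this replaces the first coordinate by 1 minus
  itself. It exchanges the walls of nodes 0 and 1.\<close>

definition flip :: "'a \<Rightarrow> 'a" where "flip = hyperplane_reflection (e 1) (1 / 2)"

definition tau :: "'a \<Rightarrow> 'a" where "tau x = flip (\<rho> x)"

abbreviation "mid \<equiv> [2..<N] @ core @ rev [2..<N]"

lemma e_flip: "i \<in> {1..n} \<Longrightarrow> e i \<bullet> flip x = (if i = 1 then 1 - e 1 \<bullet> x else e i \<bullet> x)"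
  using inner_reflection_basis[of 1 i "1 / 2"] n2 by (auto simp: flip_def)

lemma e_reflect2: "i \<in> {1..n} \<Longrightarrow>
    e i \<bullet> hyperplane_reflection (e 2) 0 x = (if i = 2 then - (e 2 \<bullet> x) else e i \<bullet> x)"
  using inner_reflection_basis[of 2 i 0] n2 by auto

lemma e_S1: "i \<in> {1..n} \<Longrightarrow> e i \<bullet> S 1 x = (if i = 1 then e 2 \<bullet> x else if i = 2 then e 1 \<bullet> x else e i \<bullet> x)"
  using reflection_e[of 1 i] n2 hyperplane_reflection_self_adjoint[of "\<alpha> 1" "e i" x, symmetric]
  by (simp add: S_pos numeral_2_eq_2)

lemma e_S0: "i \<in> {1..n} \<Longrightarrow> e i \<bullet> S 0 x = (if i = 1 then 1 - e 2 \<bullet> x else if i = 2 then 1 - e 1 \<bullet> x else e i \<bullet> x)"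
  using n2 by (auto simp: simple_reflection_def hyperplane_reflection_def theta inner_diff_right
      inner_add_right inner_add_left orth field_simps)

text \<open>The two generators commute, so either order gives the same map; type B uses
  \<open>[1, 0]\<close> and type D uses \<open>[0, 1]\<close>. Their product subtracts the first two
  coordinates from 1, and the reflection in \<open>e 2\<close> undoes the sign of the
  second.\<close>

lemma wd_mid_left: "c \<in> {[0, 1], [1, 0]} \<Longrightarrow> wd (mid @ c) x = tau x - e 2"
  using palindrome N n2
  by (intro point_eqI) (auto simp: rho_S tau_def e_reflect2 e_S1[unfolded One_nat_def] e_S0 e_flip inner_diff_right orth)

lemma wd_mid_right: "c \<in> {[0, 1], [1, 0]} \<Longrightarrow> wd (c @ mid) x = tau x + e 2"
  using palindrome N n2
  by (intro point_eqI) (auto simp: tau_def e_reflect2 e_S1[unfolded One_nat_def] e_S0 e_flip inner_add_right orth)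

lemma wd_mid_0: "wd ([0] @ mid @ [0]) x = tau x + e 1"
  using palindrome N n2
  by (intro point_eqI) (auto simp: rho_S tau_def e_reflect2 e_S0 e_flip inner_add_right orth)

lemma wd_mid_1: "wd ([1] @ mid @ [1]) x = tau x - e 1"
  using palindrome N n2
  by (intro point_eqI) (auto simp: rho_S tau_def e_reflect2 e_S1[unfolded One_nat_def] e_flip inner_diff_right orth)

text \<open>The nodes from 2 to \<open>N - 1\<close> are orthogonal to \<open>e 1\<close> and
  commute with \<open>\<rho>\<close>. This provides the commutation needed to rotate words.\<close>

lemma tau_wd:
  assumes "ws \<in> lists {2..<N}"
  shows "tau (wd ws x) = wd ws (tau x)"
  using assms
proof (induction ws arbitrary: x)
  case (Cons i ws)
  then have i: "2 \<le> i" "i < N" by auto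
  have "hyperplane_reflection (\<alpha> i) 0 (e 1) = e 1"
    using alpha_e1[of i] i N by (simp add: hyperplane_reflection_def)
  then have "flip (S i y) = S i (flip y)" for y
    using orthogonal_conj_reflection[OF orthogonal_hyperplane_reflection, of "\<alpha> i" "e 1" "1 / 2" y] i
    by (simp add: flip_def S_pos)
  then show ?case using Cons i by (simp add: tau_def rho_S)
qed simp

text \<open>The letters carried to the back move \<open>e 2\<close> to \<open>e i\<close>, so the
  place of the cut can be read off from the translation vector.\<close>

lemma wd_rotation_left:
  assumes "2 \<le> i" "i \<le> N" "c \<in> {[0, 1], [1, 0]}"
  shows "wd (([i..<N] @ core @ rev [2..<N]) @ c @ [2..<i]) x = tau x - e i"
proof -
  have "[2..<N] = [2..<i] @ [i..<N]" using assms by (intro upt_split)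
  then have "wd ([2..<i] @ ([i..<N] @ core @ rev [2..<N]) @ c) x = tau x + (- e 2)" for x
    using wd_mid_left[OF assms(3), of x] by simp
  then have "wd (([i..<N] @ core @ rev [2..<N]) @ c @ [2..<i]) x = tau x + wd (rev [2..<i]) (- e 2)"
    by (rule wd_rotate_left) (use assms N in \<open>auto intro!: tau_wd\<close>)
  also have "wd (rev [2..<i]) (- e 2) = - e i"
  proof -
    have "wd (rev [2..<i]) \<in> W" using assms N by (intro finite_letters) auto
    then show ?thesis using wd_move_down[of 2 i] assms N by (simp add: linear_neg[OF W_linear])
  qed
  finally show ?thesis by simp
qed

lemma wd_rotation_right:
  assumes "2 \<le> i" "i \<le> N" "c \<in> {[0, 1], [1, 0]}"
  shows "wd (rev [2..<i] @ c @ ([2..<N] @ core @ rev [i..<N])) x = tau x + e i"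
proof -
  have "[2..<N] = [2..<i] @ [i..<N]" using assms by (intro upt_split)
  then have "rev [2..<N] = rev [i..<N] @ rev [2..<i]" by simp
  then have "wd (c @ ([2..<N] @ core @ rev [i..<N]) @ rev [2..<i]) x = tau x + e 2" for x
    using wd_mid_right[OF assms(3), of x] by simp
  then have "wd (rev [2..<i] @ c @ ([2..<N] @ core @ rev [i..<N])) x = tau x + wd (rev [2..<i]) (e 2)"
    by (rule wd_rotate_right) (use assms N in \<open>auto intro!: tau_wd\<close>)
  also have "wd (rev [2..<i]) (e 2) = e i"
    using wd_move_down[of 2 i] assms N by simp
  finally show ?thesis .
qed

lemma flip_A0: "flip ` A0 = A0"
proof -
  have flip_flip: "flip (flip x) = x" for x by (simp add: flip_def)
  have inner: "\<alpha> i \<bullet> flip x = \<alpha> i \<bullet> x" if "i \<in> {2..n}" for i x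
    using alpha_e1[OF that] by (simp add: flip_def hyperplane_reflection_def inner_diff_right)
  \<comment> \<open>The two inequalities at the forked affine end are exchanged, and all others are
    unchanged.\<close>
  have inner1: "\<alpha> 1 \<bullet> flip x = 1 - \<theta> \<bullet> x" and innert: "\<theta> \<bullet> flip x = 1 - \<alpha> 1 \<bullet> x" for x
    using alpha_inner[of 1] e_flip[of 1] e_flip[of 2] n2
    by (simp_all add: theta inner_add_left numeral_2_eq_2)
  have "flip x \<in> A0" if "x \<in> A0" for x
  proof -
    have "0 < \<alpha> i \<bullet> flip x" if "i \<in> {1..n}" for i
      using \<open>x \<in> A0\<close> inner[of i x] inner1[of x] that
      by (cases "i = 1") (auto simp: fundamental_alcove_def)
    moreover have "\<theta> \<bullet> flip x < 1"
      using \<open>x \<in> A0\<close> n2 by (auto simp: innert fundamental_alcove_def)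
    ultimately show ?thesis by (simp add: fundamental_alcove_def)
  qed
  then show ?thesis using flip_flip by (metis image_subsetI subset_antisym subsetI image_eqI)
qed

lemma tau_A0: "(\<lambda>x. tau x + \<mu>) ` A0 = (\<lambda>x. x + \<mu>) ` A0"
proof -
  have "(\<lambda>x. tau x + \<mu>) ` A0 = (\<lambda>x. x + \<mu>) ` flip ` \<rho> ` A0"
    by (simp add: image_image tau_def)
  then show ?thesis by (simp add: rho_A0 flip_A0)
qed

end

context branched_chain
begin

lemma e_in_Orb: "i \<in> {1..n} \<Longrightarrow> e i \<in> Orb"
proof -
  assume i: "i \<in> {1..n}"
  then have "wd (rev [1..<i]) (e 1) = e i" by (intro wd_move_down) auto
  moreover have "wd (rev [1..<i]) \<in> W" using i by (intro finite_letters) auto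
  ultimately show ?thesis using coweight_orbit_W nu_in_orbit nu_e1 by metis
qed

text \<open>For two numbers in [0, 1/2] an integral difference means equality, and an integral sum
  means that both are 0 or both are 1/2. With distinct coordinates at \<open>p\<close>, a
  stabilizing element can therefore only change signs, and only at such coordinates.\<close>

lemma sign_changes:
  assumes w: "w \<in> W" "\<beta> \<in> M" "w p + \<beta> = p"
    and refl: "\<And>i x. i \<in> {1..n} \<Longrightarrow> x \<in> SE \<Longrightarrow> hyperplane_reflection (\<alpha> i) 0 x \<in> SE"
    and cv: "\<And>i x. i \<in> {1..n} \<Longrightarrow> x \<in> SE \<Longrightarrow> x \<bullet> cv i \<in> \<int>"
    and val: "\<And>i. i \<in> {1..n} \<Longrightarrow> 0 \<le> e i \<bullet> p \<and> e i \<bullet> p \<le> 1 / 2"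
    and inj: "\<And>i j. i \<in> {1..n} \<Longrightarrow> j \<in> {1..n} \<Longrightarrow> e i \<bullet> p = e j \<bullet> p \<Longrightarrow> i = j"
    and i: "i \<in> {1..n}"
  shows "w (e i) = e i \<or> (e i \<bullet> p = 0 \<or> e i \<bullet> p = 1 / 2) \<and> w (e i) = - e i"
proof -
  have *: "w (e i) \<in> SE" "w (e i) \<bullet> p - e i \<bullet> p \<in> \<int>"
    using stabilizer_shift[OF w refl cv e_SE(1)[OF i]] by auto
  obtain j s where j: "j \<in> {1..n}" "s = 1 \<or> s = - 1" "w (e i) = s *\<^sub>R e j"
    using SE_cases *(1) by blast
  from j(2) show ?thesis
  proof
    assume s: "s = 1"
    then have "e j \<bullet> p - e i \<bullet> p \<in> \<int>" using * j by simp
    then have "e j \<bullet> p - e i \<bullet> p = 0" using val[OF i] val[OF j(1)] by (intro Ints_small) auto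
    then show ?thesis using inj[OF j(1) i] j s by simp
  next
    assume s: "s = - 1"
    then have "- (w (e i) \<bullet> p - e i \<bullet> p) \<in> \<int>" using * by (intro Ints_minus) auto
    then have "e j \<bullet> p + e i \<bullet> p \<in> \<int>" using j s by (simp add: algebra_simps)
    then obtain m where m: "e j \<bullet> p + e i \<bullet> p = of_int m" by (rule Ints_cases)
    then have "of_int m \<le> (1 :: real)" "(0 :: real) \<le> of_int m" using val[OF i] val[OF j(1)] by linarith+
    then have "m = 0 \<or> m = 1" by auto
    then have "e j \<bullet> p = 0 \<and> e i \<bullet> p = 0 \<or> e j \<bullet> p = 1 / 2 \<and> e i \<bullet> p = 1 / 2"
      using m val[OF i] val[OF j(1)] by auto
    moreover from this have "j = i" using inj[OF j(1) i] by auto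
    ultimately show ?thesis using j(3) s by auto
  qed
qed

text \<open>Reads the coordinates of the translation part off the fixed point equation; applied with
  \<open>s\<close> equal to 1 or -1.\<close>

lemma orbit_values:
  assumes "w \<in> W" "\<beta> \<in> M" "w q + \<beta> = q" "e i = s *\<^sub>R w (e i)"
  shows "e i \<bullet> \<beta> = (1 - s) * (e i \<bullet> q)"
proof -
  have "e i \<bullet> q = e i \<bullet> w q + e i \<bullet> \<beta>" by (subst assms(3)[symmetric]) (rule inner_add_right)
  also have "e i \<bullet> w q = s * (e i \<bullet> q)"
    by (subst assms(4)) (simp add: W_inner[OF assms(1)])
  finally show ?thesis by (simp add: algebra_simps)
qed

end

context chain
begin

text \<open>In type A this makes the sum of the coordinate vectors zero. In types B and D it is the
  part of the parity computation that concerns the path.\<close>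

lemma sum_e_alpha:
  assumes "j \<in> {1..<n}"
  shows "(\<Sum>i=1..n. e i) \<bullet> \<alpha> j = 0"
proof -
  have "(\<Sum>i=1..n. e i) \<bullet> \<alpha> j = (\<Sum>i=1..n. (if i = j then d else 0) - (if i = Suc j then d else 0))"
    unfolding inner_sum_left using assms alpha_e by (intro sum.cong) (auto simp: inner_commute)
  also have "\<dots> = 0" using assms by (simp add: sum_subtractf)
  finally show ?thesis .
qed

end

subsection \<open>Type B\<close>

locale type_B = signed_chain \<alpha> \<theta> e n 1 1
  for \<alpha> :: "nat \<Rightarrow> 'a::euclidean_space" and \<theta> e n +
  assumes n3: "3 \<le> n" and theta_B_eq: "\<theta> = e 1 + e 2"
begin

lemma alpha_n_e: "\<alpha> n = e n" using alpha_n by simp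

sublocale branched_chain \<alpha> \<theta> e n n "[n]" id
proof
  show "wd ([2..<n] @ [n] @ rev [2..<n]) x = hyperplane_reflection (e 2) 0 (id x)" for x
    using wd_palindrome[of 2 x] n3 by simp
  show "\<alpha> i \<bullet> e 1 = 0" if "i \<in> {2..n}" for i
    using that alpha_e[of 1 i] n3 by (cases "i = n") (auto simp: alpha_n_e orth)
qed (use n3 theta_B_eq nu_coweight in auto)

text \<open>The Coxeter number is \<open>2 * n\<close>, and the last coordinate is 1/(2n) because
  \<open>\<alpha> n\<close> is \<open>e n\<close>. The first coordinate is then 1/2, which leaves
  the sign of \<open>e 1\<close> open.\<close>

definition p :: 'a where "p = pt (\<lambda>i. (n + 1 - i) / (2 * n))"

lemma e_p: "i \<in> {1..n} \<Longrightarrow> e i \<bullet> p = (n + 1 - i) / (2 * n)"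
  unfolding p_def by (simp add: e_pt)

lemma alpha_p: "i \<in> {1..n} \<Longrightarrow> 2 * real n * (\<alpha> i \<bullet> p) = 1"
proof (cases "i = n")
  case True
  then show ?thesis using e_p[of n] n3 by (simp add: alpha_n_e)
next
  case False
  assume "i \<in> {1..n}"
  with False have "i \<in> {1..<n}" by simp
  then show ?thesis using e_p[of i] e_p[of "Suc i"]
    by (simp add: alpha_inner field_simps of_nat_diff)
qed

lemma theta_p: "2 * real n * (\<theta> \<bullet> p) = 2 * real n - 1"
  using e_p[of 1] e_p[of 2] n3 by (simp add: theta inner_add_left field_simps of_nat_diff)

lemma p_A0: "p \<in> A0"
  using n3 by (intro special_point_A0[OF _ alpha_p theta_p]) auto

lemma free:
  assumes u: "u \<in> W_af" "u p \<in> A0"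
  shows "u = id"
proof -
  have n0: "0 < 2 * real n" using n3 by simp
  note le = orbit_in_alcove[OF n0 alpha_p theta_p _ u]
  define a where "a i = e i \<bullet> u p - e i \<bullet> p" for i
  have mono: "a (Suc i) \<le> a i" if "i \<in> {1..<n}" for i
    using le(1)[of i] that by (simp add: alpha_inner a_def)
  have an: "0 \<le> a n" using le(1)[of n] n3 by (simp add: a_def alpha_n_e)
  have a12: "a 1 + a 2 \<le> 0" using le(2) by (simp add: a_def theta inner_add_left)
  have pos: "0 \<le> a i" if "i \<in> {1..n}" for i
    using antitone_chain[of n a i n] mono an that by fastforce
  have "a 1 \<le> 0" using a12 pos[of 2] n3 by simp
  then have "a i = 0" if "i \<in> {1..n}" for i
    using antitone_chain[of n a 1 i] mono pos[OF that] that by fastforce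
  then have up: "u p = p" by (intro point_eqI) (simp add: a_def)
  obtain w \<beta> where w: "w \<in> W" "\<beta> \<in> M" "u = (\<lambda>x. w x + \<beta>)" using u W_af_iff by meson
  have wp: "w p + \<beta> = p" using up w by simp
  have val: "0 < e i \<bullet> p \<and> e i \<bullet> p \<le> 1 / 2" if "i \<in> {1..n}" for i
    unfolding e_p[OF that] using that by (auto simp: field_simps of_nat_diff)
  have inj: "i = j" if "i \<in> {1..n}" "j \<in> {1..n}" "e i \<bullet> p = e j \<bullet> p" for i j
    using that e_p by (auto simp: of_nat_diff)
  have half: "i = 1" if "i \<in> {1..n}" "e i \<bullet> p = 1 / 2" for i
    using inj[of i 1] e_p[of 1] that n3 by simp
  have we: "w (e i) = e i \<or> i = 1 \<and> w (e i) = - e i" if i: "i \<in> {1..n}" for i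
    using sign_changes[OF w(1,2) wp SE_reflection SE_cv _ inj i] val half[OF i] i by fastforce
  have "w (e 1) = e 1"
  proof (rule ccontr)
    assume "w (e 1) \<noteq> e 1"
    then have neg: "w (e 1) = - e 1" using we[of 1] n3 by auto
    \<comment> \<open>A sign change at \<open>e 1\<close> would force \<open>\<beta>\<close> to have
      coordinates (1, 0, ..., 0), whereas every element of the coroot lattice of type B has an even
      coordinate sum: its last generator is twice \<open>e n\<close>.\<close>
    define s where "s = (\<Sum>i=1..n. e i)"
    have "e i \<bullet> \<beta> = (if i = 1 then 1 else 0)" if "i \<in> {1..n}" for i
      using orbit_values[OF w(1,2) wp, of i 1] orbit_values[OF w(1,2) wp, of i "- 1"] neg we[OF that]
        e_p[of 1] n3 by (auto simp: field_simps)
    then have "s \<bullet> \<beta> = (\<Sum>i=1..n. if i = 1 then 1 else 0)"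
      unfolding s_def inner_sum_left by (intro sum.cong) auto
    then have s: "s \<bullet> \<beta> = 1" using n3 by simp
    have "1 / 2 * (s \<bullet> cv i) \<in> \<int>" if "i \<in> {1..n}" for i
    proof (cases "i = n")
      case True
      have "s \<bullet> e n = (\<Sum>i=1..n. if i = n then 1 else 0)"
        unfolding s_def inner_sum_left using n_mem by (intro sum.cong) (auto simp: orth)
      then show ?thesis using n3 by (simp add: True cv_n)
    next
      case False
      then have "i \<in> {1..<n}" using that by simp
      then show ?thesis using sum_e_alpha by (simp add: cv_chain s_def)
    qed
    then have "1 / 2 * (s \<bullet> \<beta>) \<in> \<int>" by (rule M_inner_Ints[OF w(2)])
    then show False using Ints_small[of "1 / 2"] s by simp
  qed
  then have "w (e i) = e i" if "i \<in> {1..n}" for i using we[OF that] by auto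
  then have "w x = x" for x using linear_span_idI[OF span_e W_linear[OF w(1)]] by blast
  then show ?thesis using wp w by auto
qed

text \<open>The point \<open>p\<close> is too coarse for lengths, since the last generator moves it
  by 1/n and the others by half as much. The point \<open>q\<close> halves the last coordinate
  relative to the gaps, so that every generator moves it by 1/(2n-1), and its first coordinate 1/2
  makes it fixed by \<open>tau\<close>.\<close>

definition q :: 'a where "q = pt (\<lambda>i. (2 * (n - i) + 1) / (2 * (2 * real n - 1)))"

lemma e_q: "i \<in> {1..n} \<Longrightarrow> e i \<bullet> q = (2 * (n - i) + 1) / (2 * (2 * real n - 1))"
  unfolding q_def by (simp add: e_pt)

lemma tau_q: "tau q = q"
proof -
  have "real (2 * (n - 1) + 1) = 2 * real n - 1" using n3 by (simp add: of_nat_diff)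
  then have "e 1 \<bullet> q = (2 * real n - 1) / (2 * (2 * real n - 1))" using e_q[of 1] n3 by simp
  then have "e 1 \<bullet> q = 1 / 2" using n3 by simp
  then show ?thesis by (intro point_eqI) (auto simp: tau_def e_flip)
qed

lemma SE_step:
  assumes "i \<le> n" "x \<in> SE"
  shows "\<bar>x \<bullet> (S i q - q)\<bar> \<le> 1 / (2 * real n - 1)"
proof -
  define D where "D = 2 * real n - 1"
  have D: "D > 0" using n3 by (simp add: D_def)
  obtain j s where x: "j \<in> {1..n}" "s = 1 \<or> s = - 1" "x = s *\<^sub>R e j" using SE_cases assms(2) by blast
  consider "i = 0" | "i = n" | "i \<in> {1..<n}" using assms(1) by force
  then have "\<bar>x \<bullet> (S i q - q)\<bar> \<le> 1 / D"
  proof cases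
    case 1
    have "\<theta> \<bullet> q - 1 = - 1 / D" using e_q[of 1] e_q[of 2] n3 D
      by (simp add: theta inner_add_left field_simps of_nat_diff D_def)
    then have "\<bar>x \<bullet> (S i q - q)\<bar> = \<bar>x \<bullet> \<theta>\<bar> / D"
      using D theta_norm by (simp add: 1 simple_reflection_def inner_displacement abs_mult)
    moreover have "\<bar>x \<bullet> \<theta>\<bar> \<le> 1" using x n3 by (auto simp: theta inner_add_right orth)
    ultimately show ?thesis using D by (simp add: divide_right_mono)
  next
    case 2
    have "\<alpha> n \<bullet> q = 1 / (2 * D)" using e_q[of n] n3 D by (simp add: alpha_n_e D_def)
    then have "\<bar>x \<bullet> (S i q - q)\<bar> = \<bar>x \<bullet> e n\<bar> / D"
      using D n3 by (simp add: 2 simple_reflection_def inner_displacement abs_mult alpha_n_e orth)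
    moreover have "\<bar>x \<bullet> e n\<bar> \<le> 1" using x n3 by (auto simp: orth)
    ultimately show ?thesis using D by (simp add: divide_right_mono)
  next
    case 3
    have "\<alpha> i \<bullet> q = 1 / D" using e_q[of i] e_q[of "Suc i"] 3 D
      by (simp add: alpha_inner field_simps of_nat_diff D_def)
    then have "\<bar>x \<bullet> (S i q - q)\<bar> = \<bar>x \<bullet> \<alpha> i\<bar> / D"
      using D 3 by (simp add: simple_reflection_def inner_displacement abs_mult alpha_norm)
    moreover have "\<bar>x \<bullet> \<alpha> i\<bar> \<le> 1" using SE_inner_chain[OF assms(2) 3] by auto
    ultimately show ?thesis using D by (simp add: divide_right_mono)
  qed
  then show ?thesis by (simp add: D_def)
qed

section \<open>The words of type B and their alcoves\<close>

lemma wordsB_eq: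
  "wordsB n = {[0] @ mid @ [0], [1] @ mid @ [1]} \<union> {b @ [1, 0] @ a | a b. mid = a @ b}"
proof -
  have m: "[2..<Suc n] @ rev [2..<n] = mid" using n3 by simp
  have "{ws \<in> rotations (mid @ [1, 0]). adjacent_in 0 1 ws} = {b @ [1, 0] @ a | a b. mid = a @ b}"
    using rotations_adjacent[of 1 mid 0] n3 by (simp add: adjacent_in_commute[of 0])
  then show ?thesis unfolding wordsB_def Let_def m by simp
qed

lemma wordsB_element:
  assumes "ws \<in> wordsB n"
  obtains \<mu> where "\<mu> \<in> SE" "\<And>x. wd ws x = tau x + \<mu>" "length ws = 2 * n - 1" "ws \<in> lists {0..n}"
proof -
  have mid: "length mid = 2 * n - 3" "set mid \<subseteq> {0..n}" using n3 by auto
  have c: "[1, 0] \<in> {[0, 1], [1, 0::nat]}" by simp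
  from assms consider "ws = [0] @ mid @ [0]" | "ws = [1] @ mid @ [1]"
    | a b where "mid = a @ b" "ws = b @ [1, 0] @ a"
    unfolding wordsB_eq by blast
  then show ?thesis
  proof cases
    case 1
    show ?thesis by (rule that[of "e 1"]) (use 1 n3 wd_mid_0 e_SE in auto)
  next
    case 2
    show ?thesis by (rule that[of "- e 1"]) (use 2 n3 wd_mid_1 e_SE in auto)
  next
    case 3
    have "length ws = length mid + 2" "set ws = set mid \<union> {0, 1}" using 3 by auto
    then have ws: "length ws = 2 * n - 1" "ws \<in> lists {0..n}" using mid n3 by auto
    from 3(1) show ?thesis
    proof (rule palindrome_split)
      fix i assume i: "2 \<le> i" "i \<le> n" "a = [2..<i]" "b = [i..<n] @ [n] @ rev [2..<n]"
      show ?thesis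
        by (rule that[of "- e i"])
          (use wd_rotation_left[OF i(1,2) c] i 3(2) ws e_SE(2)[of i] in auto)
    next
      fix i assume i: "2 \<le> i" "i \<le> n" "b = rev [2..<i]" "a = [2..<n] @ [n] @ rev [i..<n]"
      show ?thesis
        by (rule that[of "e i"])
          (use wd_rotation_right[OF i(1,2) c] i 3(2) ws e_SE(1)[of i] in auto)
    next
      fix c c' :: "nat list" assume "[n] = c @ c'" "c \<noteq> []" "c' \<noteq> []"
      then show ?thesis by (cases c) auto
    qed (use n3 in auto)
  qed
qed

text \<open>As \<open>tau\<close> fixes \<open>q\<close>, the word displaces \<open>q\<close> by the
  unit vector \<open>\<mu>\<close>, and steps of size 1/(2n-1) need all \<open>2 * n - 1\<close>
  letters for that.\<close>

lemma reduced: "ws \<in> wordsB n \<Longrightarrow> reduced_word n \<alpha> \<theta> ws"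
proof -
  assume "ws \<in> wordsB n"
  then obtain \<mu> where \<mu>: "\<mu> \<in> SE" "\<And>x. wd ws x = tau x + \<mu>" "length ws = 2 * n - 1" "ws \<in> lists {0..n}"
    using wordsB_element by blast
  obtain i s where i: "i \<in> {1..n}" "s = 1 \<or> s = - 1" "\<mu> = s *\<^sub>R e i" using SE_cases \<mu>(1) by blast
  show ?thesis
  proof (rule reduced_wordI[OF SE_reflection SE_step \<mu>(4,1)])
    have "real (2 * n - 1) = 2 * real n - 1" using n3 by (simp add: of_nat_diff)
    moreover have "\<bar>\<mu> \<bullet> (wd ws q - q)\<bar> = 1" using i by (auto simp: \<mu>(2) tau_q orth)
    ultimately show "1 / (2 * real n - 1) * real (length ws) \<le> \<bar>\<mu> \<bullet> (wd ws q - q)\<bar>"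
      using n3 by (simp add: \<mu>(3))
  qed (use n3 in auto)
qed

lemma Orb_eq: "Orb = SE"
proof
  show "Orb \<subseteq> SE" using Orb_subset by simp
  have "- e i \<in> Orb" if "i \<in> {1..n}" for i
    using coweight_orbit_W[OF e_in_Orb[OF that] palindrome_in_W[OF that]] reflection_basis[OF that that] by simp
  then show "SE \<subseteq> Orb" using e_in_Orb by (auto simp: SE_def)
qed

lemma Z_ideal_B: "Z_ideal n \<alpha> \<theta> = bruhat_ideal n \<alpha> \<theta> (wd ` wordsB n)"
proof -
  have c: "[1, 0] \<in> {[0, 1], [1, 0::nat]}" by simp
  have "{u \<in> W_af. \<exists>\<mu>\<in>Orb. u ` A0 = (\<lambda>x. x + \<mu>) ` A0} = wd ` wordsB n"
  proof (rule translates_eq[OF p_A0 free])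
    show "wd ` wordsB n \<subseteq> W_af" using wordsB_element wd_in_W_af by blast
  next
    fix g assume "g \<in> wd ` wordsB n"
    then obtain ws where ws: "ws \<in> wordsB n" "g = wd ws" by blast
    from ws(1) obtain \<mu> where \<mu>: "\<mu> \<in> SE" "\<And>x. wd ws x = tau x + \<mu>" using wordsB_element by blast
    then have "g = (\<lambda>x. tau x + \<mu>)" using ws by auto
    then show "\<exists>\<mu>\<in>Orb. g ` A0 = (\<lambda>x. x + \<mu>) ` A0" using tau_A0 \<mu> Orb_eq by blast
  next
    fix \<mu> assume "\<mu> \<in> Orb"
    then obtain i s where i: "i \<in> {1..n}" "s = 1 \<or> s = - 1" "\<mu> = s *\<^sub>R e i" using SE_cases Orb_eq by blast
    \<comment> \<open>The two unrotated words give \<open>e 1\<close> and \<open>- e 1\<close>. For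
      larger \<open>i\<close>, the two cuts at \<open>i\<close> in the descending and the ascending
      half give \<open>e i\<close> and \<open>- e i\<close>.\<close>
    have "\<exists>ws\<in>wordsB n. \<forall>x. wd ws x = tau x + \<mu>"
    proof (cases "i = 1")
      case True
      then show ?thesis using i wd_mid_0 wd_mid_1 by (auto simp: wordsB_eq)
    next
      case False
      then have i2: "2 \<le> i" "i \<le> n" using i by auto
      have *: "[2..<n] = [2..<i] @ [i..<n]" using i2 by (intro upt_split)
      have "([i..<n] @ [n] @ rev [2..<n]) @ [1, 0] @ [2..<i] \<in> wordsB n"
        "rev [2..<i] @ [1, 0] @ ([2..<n] @ [n] @ rev [i..<n]) \<in> wordsB n"
      proof -
        have "mid = [2..<i] @ ([i..<n] @ [n] @ rev [2..<n])"
          by (metis * append_assoc)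
        then show "([i..<n] @ [n] @ rev [2..<n]) @ [1, 0] @ [2..<i] \<in> wordsB n"
          unfolding wordsB_eq by blast
        have "rev [2..<n] = rev [i..<n] @ rev [2..<i]" by (metis * rev_append)
        then have "mid = ([2..<n] @ [n] @ rev [i..<n]) @ rev [2..<i]" by simp
        then show "rev [2..<i] @ [1, 0] @ ([2..<n] @ [n] @ rev [i..<n]) \<in> wordsB n"
          unfolding wordsB_eq by blast
      qed
      then show ?thesis
        using i(2,3) wd_rotation_left[OF i2 c] wd_rotation_right[OF i2 c]
        by (metis add_uminus_conv_diff scaleR_minus1_left scaleR_one)
    qed
    then obtain ws where ws: "ws \<in> wordsB n" "wd ws = (\<lambda>x. tau x + \<mu>)" by auto
    have "wd ws ` A0 = (\<lambda>x. x + \<mu>) ` A0" unfolding ws(2) by (rule tau_A0)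
    then show "\<exists>g\<in>wd ` wordsB n. g ` A0 = (\<lambda>x. x + \<mu>) ` A0" using ws(1) by blast
  qed
  then show ?thesis unfolding Z_ideal_def by simp
qed

end

subsection \<open>Automorphisms of the affine diagram of type D\<close>

definition adjD :: "nat \<Rightarrow> nat \<Rightarrow> nat \<Rightarrow> bool" where
  "adjD n i j \<longleftrightarrow> {i, j} \<in> affine_edgesD n"

lemma adjD_iff:
  "adjD n i j \<longleftrightarrow>
    i \<le> 1 \<and> j = 2 \<or> j \<le> 1 \<and> i = 2 \<or> i = n - 2 \<and> (j = n - 1 \<or> j = n) \<or> j = n - 2 \<and> (i = n - 1 \<or> i = n) \<or>
    2 \<le> i \<and> i < n - 2 \<and> j = Suc i \<or> 2 \<le> j \<and> j < n - 2 \<and> i = Suc j"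
proof -
  have path: "(\<exists>k. {i, j} = {k, Suc k} \<and> 2 \<le> k \<and> k < n - 2) \<longleftrightarrow>
    2 \<le> i \<and> i < n - 2 \<and> j = Suc i \<or> 2 \<le> j \<and> j < n - 2 \<and> i = Suc j"
    by (auto simp: doubleton_eq_iff)
  have fork: "{i, j} = {a, b} \<or> {i, j} = {a, c} \<longleftrightarrow> i = a \<and> (j = b \<or> j = c) \<or> j = a \<and> (i = b \<or> i = c)" for a b c
    unfolding doubleton_eq_iff by blast
  have leaf: "{i, j} = {0, 2} \<or> {i, j} = {1, 2} \<longleftrightarrow> i \<le> 1 \<and> j = 2 \<or> j \<le> 1 \<and> i = 2"
    unfolding insert_commute[of _ 2] fork by auto
  have "adjD n i j \<longleftrightarrow> ({i, j} = {0, 2} \<or> {i, j} = {1, 2}) \<or>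
      ({i, j} = {n - 2, n - 1} \<or> {i, j} = {n - 2, n}) \<or>
      (\<exists>k. {i, j} = {k, Suc k} \<and> 2 \<le> k \<and> k < n - 2)"
    unfolding adjD_def affine_edgesD_def Un_iff mem_Collect_eq insert_iff empty_iff
    by (simp only: disj_assoc simp_thms)
  then show ?thesis
    unfolding path leaf fork by (simp only: disj_assoc)
qed
definition edge_preserving :: "nat \<Rightarrow> (nat \<Rightarrow> nat) \<Rightarrow> bool" where
  "edge_preserving n \<sigma> \<longleftrightarrow> \<sigma> permutes {0..n} \<and>
     (\<forall>i\<in>{0..n}. \<forall>j\<in>{0..n}. adjD n (\<sigma> i) (\<sigma> j) \<longleftrightarrow> adjD n i j)"

definition revD :: "nat \<Rightarrow> nat \<Rightarrow> nat" where "revD n i = (if i \<le> n then n - i else i)"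

definition swap0 :: "nat \<Rightarrow> nat" where "swap0 i = (if i = 0 then 1 else if i = 1 then 0 else i)"

definition swapn :: "nat \<Rightarrow> nat \<Rightarrow> nat" where
  "swapn n i = (if i = n then n - 1 else if i = n - 1 then n else i)"

text \<open>For an involution, preserving edges already implies reflecting them.\<close>

lemma edge_preserving_involution:
  assumes "\<And>i. \<sigma> (\<sigma> i) = i" "\<And>i. i \<le> n \<Longrightarrow> \<sigma> i \<le> n" "\<And>i. i > n \<Longrightarrow> \<sigma> i = i"
    and "\<And>i j. i \<le> n \<Longrightarrow> j \<le> n \<Longrightarrow> adjD n i j \<Longrightarrow> adjD n (\<sigma> i) (\<sigma> j)"
  shows "edge_preserving n \<sigma>"
  unfolding edge_preserving_def
proof (intro conjI ballI)
  show "\<sigma> permutes {0..n}"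
    using assms(1-3) by (intro bij_imp_permutes) (auto intro!: bij_betw_byWitness[where f' = \<sigma>])
  show "adjD n (\<sigma> i) (\<sigma> j) \<longleftrightarrow> adjD n i j" if "i \<in> {0..n}" "j \<in> {0..n}" for i j
    using assms(4)[of i j] assms(4)[of "\<sigma> i" "\<sigma> j"] assms(1,2) that by auto
qed

lemma edge_preserving_revD: "4 \<le> n \<Longrightarrow> edge_preserving n (revD n)"
proof (rule edge_preserving_involution)
  fix i j assume n: "4 \<le> n" and ij: "i \<le> n" "j \<le> n" and adj: "adjD n i j"
  have r: "revD n i = n - i" "revD n j = n - j" using ij by (auto simp: revD_def)
  \<comment> \<open>The edges oriented from the end with node 0 to the other end. The reversal turns
    every oriented edge around, so half of the cases suffice.\<close>
  define A where "A i j \<longleftrightarrow> i \<le> 1 \<and> j = 2 \<or> i = n - 2 \<and> (j = n - 1 \<or> j = n) \<or>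
    2 \<le> i \<and> i < n - 2 \<and> j = Suc i" for i j
  have A: "adjD n i j \<longleftrightarrow> A i j \<or> A j i" for i j
    unfolding adjD_iff A_def by blast
  have "A (n - j) (n - i)" if "A i j" for i j
    using that unfolding A_def
  proof (elim disjE conjE)
    assume "i \<le> 1" "j = 2"
    then have "n - j = n - 2" "n - i = n - 1 \<or> n - i = n" by auto
    then show "n - j \<le> 1 \<and> n - i = 2 \<or> n - j = n - 2 \<and> (n - i = n - 1 \<or> n - i = n) \<or>
      2 \<le> n - j \<and> n - j < n - 2 \<and> n - i = Suc (n - j)" by blast
  qed (use n in auto)
  with adj show "adjD n (revD n i) (revD n j)" unfolding r A by blast
qed (auto simp: revD_def)

lemma edge_preserving_swap0: "4 \<le> n \<Longrightarrow> edge_preserving n swap0"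
proof (rule edge_preserving_involution)
  fix i j assume n: "4 \<le> n" and adj: "adjD n i j"
  then show "adjD n (swap0 i) (swap0 j)" unfolding adjD_iff swap0_def by auto
qed (auto simp: swap0_def)

lemma edge_preserving_comp:
  assumes "edge_preserving n \<sigma>" "edge_preserving n \<tau>"
  shows "edge_preserving n (\<sigma> \<circ> \<tau>)"
  using assms permutes_in_image[of \<tau> "{0..n}"]
  unfolding edge_preserving_def by (auto intro: permutes_compose)

text \<open>Every other node has at most two neighbours. For \<open>n = 4\<close> the two branch
  nodes coincide.\<close>

lemma adjD_branch:
  assumes "4 \<le> n" "adjD n x y" "adjD n x z" "adjD n x w" "y \<noteq> z" "z \<noteq> w" "y \<noteq> w"
  shows "x = 2 \<or> x = n - 2"
proof (rule ccontr)
  assume x: "\<not> (x = 2 \<or> x = n - 2)"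
  have nbr: "x \<le> 1 \<and> y = 2 \<or> (x = n - 1 \<or> x = n) \<and> y = n - 2 \<or>
      2 \<le> x \<and> x < n - 2 \<and> (y = Suc x \<or> y = x - 1)" if "adjD n x y" for y
    using that x unfolding adjD_iff by (elim disjE conjE) simp_all
  have "\<exists>a b. \<forall>y. adjD n x y \<longrightarrow> y = a \<or> y = b"
  proof (cases "x \<le> 1 \<or> x = n - 1 \<or> x = n")
    case True
    then have "\<not> (2 \<le> x \<and> x < n - 2)" by auto
    then show ?thesis using nbr by blast
  next
    case False
    then show ?thesis using nbr by blast
  qed
  then show False using assms(2-7) by metis
qed

text \<open>With node 2 and its pair of leaves under control, each next node of the path is the only
  neighbour not yet taken, so the path is fixed pointwise. The freedom left is one exchange at
  either end.\<close>

lemma edge_preserving_fix: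
  assumes n: "4 \<le> n" and \<sigma>: "edge_preserving n \<sigma>" "\<sigma> 2 = 2" "\<sigma> ` {0, 1} = {0, 1}"
  shows "\<exists>\<tau>\<in>{id, swap0, swapn n, swap0 \<circ> swapn n}. \<forall>i\<le>n. \<sigma> i = \<tau> i"
proof -
  have perm: "\<sigma> permutes {0..n}"
    and adj: "\<And>i j. i \<le> n \<Longrightarrow> j \<le> n \<Longrightarrow> adjD n i j \<Longrightarrow> adjD n (\<sigma> i) (\<sigma> j)"
    using \<sigma>(1) by (auto simp: edge_preserving_def)
  have inj: "\<sigma> i = \<sigma> j \<longleftrightarrow> i = j" for i j using permutes_inj[OF perm] by (auto simp: inj_def)
  have low: "\<sigma> i \<le> 1 \<longleftrightarrow> i \<le> 1" for i
  proof
    have s: "{0, 1 :: nat} = {..1}" by auto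
    show "i \<le> 1 \<Longrightarrow> \<sigma> i \<le> 1" using \<sigma>(3) unfolding s by auto
    assume "\<sigma> i \<le> 1"
    then have "\<sigma> i \<in> \<sigma> ` {..1}" using \<sigma>(3) unfolding s by auto
    then show "i \<le> 1" using inj by auto
  qed
  have mid: "\<sigma> i = i" if "2 \<le> i" "i \<le> n - 2" for i
    using that
  proof (induction i rule: less_induct)
    case (less i)
    show ?case
    proof (cases "i = 2")
      case False
      define k where "k = i - 1"
      have k: "i = Suc k" "2 \<le> k" "k < n - 2" using less.prems False by (auto simp: k_def)
      have fk: "\<sigma> k = k" using less.IH[of k] k by simp
      have "adjD n k (Suc k)" using k by (simp add: adjD_iff)
      then have "adjD n k (\<sigma> i)" using adj[of k "Suc k"] k fk n by simp
      moreover have "\<not> \<sigma> i \<le> 1" using low[of i] k by simp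
      moreover have "\<sigma> i \<noteq> k - 1" if "3 \<le> k"
        using less.IH[of "k - 1"] inj[of i "k - 1"] that k by simp
      ultimately show ?thesis unfolding adjD_iff using k n by (cases "k = 2") auto
    qed (use \<sigma> in simp)
  qed
  have high: "\<sigma> i = n - 1 \<or> \<sigma> i = n" if "i = n - 1 \<or> i = n" for i
  proof -
    have "\<sigma> i \<le> n" using permutes_in_image[OF perm, of i] that by auto
    moreover have "\<not> \<sigma> i \<le> 1" using low[of i] that n by auto
    moreover have "\<not> (2 \<le> \<sigma> i \<and> \<sigma> i \<le> n - 2)"
    proof
      assume "2 \<le> \<sigma> i \<and> \<sigma> i \<le> n - 2"
      then have "\<sigma> (\<sigma> i) = \<sigma> i" using mid by blast
      then show False using inj[of "\<sigma> i" i] \<open>2 \<le> \<sigma> i \<and> \<sigma> i \<le> n - 2\<close> that n by auto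
    qed
    ultimately show ?thesis by linarith
  qed
  have 0: "\<sigma> 0 = 0 \<and> \<sigma> 1 = 1 \<or> \<sigma> 0 = 1 \<and> \<sigma> 1 = 0"
    using low[of 0] low[of 1] inj[of 0 1] by (auto simp: le_Suc_eq)
  have 1: "\<sigma> n = n \<and> \<sigma> (n - 1) = n - 1 \<or> \<sigma> n = n - 1 \<and> \<sigma> (n - 1) = n"
  proof -
    have "\<sigma> n \<noteq> \<sigma> (n - 1)" using inj n by simp
    moreover have "\<sigma> n = n - 1 \<or> \<sigma> n = n" "\<sigma> (n - 1) = n - 1 \<or> \<sigma> (n - 1) = n"
      by (rule high; simp)+
    ultimately show ?thesis by metis
  qed
  have cases: "i = 0 \<or> i = 1 \<or> (2 \<le> i \<and> i \<le> n - 2) \<or> i = n - 1 \<or> i = n" if "i \<le> n" for i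
    using that by linarith
  have ne: "i \<noteq> 0 \<and> i \<noteq> 1 \<and> i \<noteq> n - 1 \<and> i \<noteq> n" if "2 \<le> i \<and> i \<le> n - 2" for i
    using that n by linarith
  from 0 1 show ?thesis
  proof (elim disjE conjE)
    assume "\<sigma> 0 = 0" "\<sigma> 1 = 1" "\<sigma> n = n" "\<sigma> (n - 1) = n - 1"
    then have "\<forall>i\<le>n. \<sigma> i = i" using cases mid by metis
    then show ?thesis by (intro bexI[of _ id]) simp_all
  next
    assume *: "\<sigma> 0 = 0" "\<sigma> 1 = 1" "\<sigma> n = n - 1" "\<sigma> (n - 1) = n"
    have "\<sigma> i = swapn n i" if "i \<le> n" for i
      using cases[OF that] mid[of i] ne[of i] * n by (elim disjE) (simp_all add: swapn_def)
    then show ?thesis by (intro bexI[of _ "swapn n"]) simp_all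
  next
    assume *: "\<sigma> 0 = 1" "\<sigma> 1 = 0" "\<sigma> n = n" "\<sigma> (n - 1) = n - 1"
    have "\<sigma> i = swap0 i" if "i \<le> n" for i
      using cases[OF that] mid[of i] ne[of i] * n by (elim disjE) (simp_all add: swap0_def)
    then show ?thesis by (intro bexI[of _ "swap0"]) simp_all
  next
    assume *: "\<sigma> 0 = 1" "\<sigma> 1 = 0" "\<sigma> n = n - 1" "\<sigma> (n - 1) = n"
    have "\<sigma> i = (swap0 \<circ> swapn n) i" if "i \<le> n" for i
      using cases[OF that] mid[of i] ne[of i] * n by (elim disjE) (simp_all add: swap0_def swapn_def)
    then show ?thesis by (intro bexI[of _ "swap0 \<circ> swapn n"]) simp_all
  qed
qed

text \<open>A leaf at node 2 cannot go to node 3, because node 3 has the further neighbour 4 while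
  the leaf has none besides 2.\<close>

lemma edge_preserving_leaves:
  assumes n: "5 \<le> n" and \<sigma>: "edge_preserving n \<sigma>" "\<sigma> 2 = 2"
  shows "\<sigma> ` {0, 1} = {0, 1}"
proof -
  have n4: "4 \<le> n" using n by simp
  have perm: "\<sigma> permutes {0..n}"
    and adj: "\<And>i j. i \<le> n \<Longrightarrow> j \<le> n \<Longrightarrow> adjD n i j \<longleftrightarrow> adjD n (\<sigma> i) (\<sigma> j)"
    using \<sigma>(1) by (auto simp: edge_preserving_def)
  have inj: "\<sigma> i = \<sigma> j \<longleftrightarrow> i = j" for i j using permutes_inj[OF perm] by (auto simp: inj_def)
  have "\<sigma> i \<le> 1" if i: "i \<le> 1" for i
  proof -
    have "adjD n 2 i" using i by (simp add: adjD_iff)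
    then have "adjD n 2 (\<sigma> i)" using adj[of 2 i] \<sigma>(2) i n by simp
    then have "\<sigma> i \<le> 1 \<or> \<sigma> i = 3" unfolding adjD_iff using n by auto
    moreover have "\<sigma> i \<noteq> 3"
    proof
      assume 3: "\<sigma> i = 3"
      obtain z where z: "\<sigma> z = 4" "z \<le> n"
        using permutes_image[OF perm] n by (metis atLeastAtMost_iff imageE n4 zero_le)
      have "adjD n 3 4" using n by (auto simp: adjD_iff)
      then have "adjD n i z" using adj[of i z] 3 z i n by simp
      then have "z = 2" using i n unfolding adjD_iff by auto
      then show False using z \<sigma>(2) by simp
    qed
    ultimately show ?thesis by blast
  qed
  then have "\<sigma> 0 \<le> 1" "\<sigma> 1 \<le> 1" "\<sigma> 0 \<noteq> \<sigma> 1" using inj by auto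
  then show ?thesis by (auto simp: le_Suc_eq)
qed

lemma diagram_automorphismsD_iff:
  "\<sigma> \<in> diagram_automorphismsD n \<longleftrightarrow>
    edge_preserving n \<sigma> \<and> (n = 4 \<longrightarrow> \<sigma> ` {0, 1} \<in> {{0, 1}, {n - 1, n}})"
  by (simp add: diagram_automorphismsD_def edge_preserving_def adjD_def)

text \<open>The image of node 2 is again a branch node, and composing with the reversal brings it
  back to 2. For \<open>n = 4\<close> there is a single branch node, and the condition on the leaves
  in the definition decides whether to reverse.\<close>

lemma diagram_automorphismD_cases:
  assumes n: "4 \<le> n" and \<sigma>: "\<sigma> \<in> diagram_automorphismsD n"
  obtains \<tau> where "\<tau> \<in> {id, swap0, swapn n, swap0 \<circ> swapn n}"
    "(\<forall>i\<le>n. \<sigma> i = \<tau> i) \<or> (\<forall>i\<le>n. \<sigma> i = (revD n \<circ> \<tau>) i)"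
proof -
  have ep: "edge_preserving n \<sigma>" using \<sigma> by (simp add: diagram_automorphismsD_iff)
  have perm: "\<sigma> permutes {0..n}"
    and adj: "\<And>i j. i \<le> n \<Longrightarrow> j \<le> n \<Longrightarrow> adjD n i j \<Longrightarrow> adjD n (\<sigma> i) (\<sigma> j)"
    using ep by (auto simp: edge_preserving_def)
  have inj: "\<sigma> i = \<sigma> j \<longleftrightarrow> i = j" for i j using permutes_inj[OF perm] by (auto simp: inj_def)
  have "adjD n 2 0" "adjD n 2 1" "adjD n 2 3" using n by (auto simp: adjD_iff)
  then have "adjD n (\<sigma> 2) (\<sigma> 0)" "adjD n (\<sigma> 2) (\<sigma> 1)" "adjD n (\<sigma> 2) (\<sigma> 3)" using adj n by auto
  then have two: "\<sigma> 2 = 2 \<or> \<sigma> 2 = n - 2" by (rule adjD_branch[OF n]) (simp_all add: inj)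
  have epr: "edge_preserving n (revD n \<circ> \<sigma>)"
    using edge_preserving_comp edge_preserving_revD[OF n] ep by blast
  have "\<sigma> 2 = 2 \<and> \<sigma> ` {0, 1} = {0, 1} \<or> (revD n \<circ> \<sigma>) 2 = 2 \<and> (revD n \<circ> \<sigma>) ` {0, 1} = {0, 1}"
  proof (cases "n = 4")
    case True
    have "revD n ` {3, 4} = {0, 1}" using True by (auto simp: revD_def)
    moreover have "\<sigma> ` {0, 1} = {0, 1} \<or> \<sigma> ` {0, 1} = {3, 4}"
      using \<sigma> True by (auto simp: diagram_automorphismsD_iff)
    moreover have "\<sigma> 2 = 2" "revD n 2 = 2" using two True by (auto simp: revD_def)
    ultimately show ?thesis by (metis comp_apply image_comp)
  next
    case False
    then have n5: "5 \<le> n" using n by simp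
    have rev2: "revD n (n - 2) = 2" using n by (simp add: revD_def)
    show ?thesis
    proof (rule disjE[OF two])
      assume 2: "\<sigma> 2 = 2"
      show ?thesis by (rule disjI1[OF conjI[OF 2 edge_preserving_leaves[OF n5 ep 2]]])
    next
      assume "\<sigma> 2 = n - 2"
      then have 2: "(revD n \<circ> \<sigma>) 2 = 2" using rev2 by simp
      show ?thesis by (rule disjI2[OF conjI[OF 2 edge_preserving_leaves[OF n5 epr 2]]])
    qed
  qed
  then show ?thesis
  proof
    assume *: "\<sigma> 2 = 2 \<and> \<sigma> ` {0, 1} = {0, 1}"
    obtain \<tau> where \<tau>: "\<tau> \<in> {id, swap0, swapn n, swap0 \<circ> swapn n}" "\<forall>i\<le>n. \<sigma> i = \<tau> i"
      using edge_preserving_fix[OF n ep conjunct1[OF *] conjunct2[OF *]] by (rule bexE)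
    show ?thesis by (rule that[OF \<tau>(1) disjI1[OF \<tau>(2)]])
  next
    assume *: "(revD n \<circ> \<sigma>) 2 = 2 \<and> (revD n \<circ> \<sigma>) ` {0, 1} = {0, 1}"
    have rr: "revD n (revD n i) = i" for i by (simp add: revD_def)
    obtain \<tau> where \<tau>: "\<tau> \<in> {id, swap0, swapn n, swap0 \<circ> swapn n}" "\<forall>i\<le>n. (revD n \<circ> \<sigma>) i = \<tau> i"
      using edge_preserving_fix[OF n epr conjunct1[OF *] conjunct2[OF *]] by (rule bexE)
    have "\<sigma> i = (revD n \<circ> \<tau>) i" if "i \<le> n" for i
    proof -
      have "\<tau> i = revD n (\<sigma> i)" using \<tau>(2) that by simp
      then show ?thesis using rr by simp
    qed
    then have "\<forall>i\<le>n. \<sigma> i = (revD n \<circ> \<tau>) i" by blast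
    then show ?thesis by (rule that[OF \<tau>(1) disjI2])
  qed
qed

lemma automorphisms_memD:
  assumes n: "4 \<le> n"
  shows "id \<in> diagram_automorphismsD n" "swap0 \<in> diagram_automorphismsD n"
    "revD n \<in> diagram_automorphismsD n" "revD n \<circ> swap0 \<in> diagram_automorphismsD n"
proof -
  have im: "swap0 ` {0, 1} = {0, 1}" "revD n ` {0, 1} = {n - 1, n}"
    using n by (auto simp: swap0_def revD_def)
  have "edge_preserving n id" by (rule edge_preserving_involution) auto
  then show "id \<in> diagram_automorphismsD n" by (simp add: diagram_automorphismsD_iff)
  show "swap0 \<in> diagram_automorphismsD n" "revD n \<in> diagram_automorphismsD n"
    unfolding diagram_automorphismsD_iff im
    using edge_preserving_swap0[OF n] edge_preserving_revD[OF n] by blast+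
  have "edge_preserving n (revD n \<circ> swap0)"
    using edge_preserving_comp edge_preserving_swap0[OF n] edge_preserving_revD[OF n] by blast
  moreover have "(revD n \<circ> swap0) ` {0, 1} = {n - 1, n}" using im by (metis image_comp)
  ultimately show "revD n \<circ> swap0 \<in> diagram_automorphismsD n"
    unfolding diagram_automorphismsD_iff by blast
qed

lemma rotations_append: "rotations (a @ b) = rotations (b @ a)"
proof -
  have "rotations (a @ b) \<subseteq> rotations (b @ a)" for a b :: "'b list"
  proof
    fix ws assume "ws \<in> rotations (a @ b)"
    then obtain k where "ws = rotate k (a @ b)" by (auto simp: rotations_def)
    then have "ws = rotate (k + length b) (b @ a)"
      using rotate_rotate[of k "length b" "b @ a"] rotate_append[of b a] by simp
    then show "ws \<in> rotations (b @ a)" by (auto simp: rotations_def)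
  qed
  then show ?thesis by blast
qed

subsection \<open>Type D\<close>

locale type_D = fork_chain \<alpha> \<theta> e n 1
  for \<alpha> :: "nat \<Rightarrow> 'a::euclidean_space" and \<theta> e n +
  assumes theta_D_eq: "\<theta> = e 1 + e 2"
begin

abbreviation "neg_n \<equiv> hyperplane_reflection (e n) 0"

lemma neg_n_alpha: "i \<in> {1..n} \<Longrightarrow> neg_n (\<alpha> i) = \<alpha> (swapn n i)"
proof -
  assume i: "i \<in> {1..n}"
  have nn: "n - Suc 0 \<noteq> n" using n4 by simp
  consider "i = n" | "i = n - 1" | "i \<noteq> n" "i \<noteq> n - 1" by blast
  then show ?thesis
  proof cases
    case 1
    then show ?thesis using nn alpha_n1 reflection_basis[OF mem(3,3)] reflection_basis[OF mem(3,4)]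
      by (simp add: alpha_n hyperplane_reflection_add swapn_def)
  next
    case 2
    then show ?thesis
      using nn alpha_n1[unfolded One_nat_def] reflection_basis[OF mem(3,3)] reflection_basis[OF mem(3,4)]
      by (simp add: alpha_n hyperplane_reflection_diff swapn_def)
  next
    case 3
    then have "Suc i \<noteq> n" "i \<noteq> n - Suc 0" by auto
    then show ?thesis using 3 i reflection_basis[OF mem(3), of i] reflection_basis[OF mem(3), of "Suc i"]
      by (simp add: alpha_diff hyperplane_reflection_diff swapn_def)
  qed
qed

lemma neg_n_theta: "neg_n \<theta> = \<theta>"
  using reflection_basis[OF mem(3,1)] reflection_basis[OF mem(3,2)] n4
  by (simp add: theta_D_eq hyperplane_reflection_add)

lemma neg_n_S: "i \<le> n \<Longrightarrow> neg_n (S i x) = S (swapn n i) (neg_n x)"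
proof (cases "i = 0")
  case True
  then show ?thesis
    using orthogonal_conj_reflection[OF orthogonal_hyperplane_reflection, of "e n" \<theta> 1 x] neg_n_theta n4
    by (simp add: simple_reflection_def swapn_def)
next
  case False
  assume "i \<le> n"
  moreover have "swapn n i \<noteq> 0" using False n4 by (simp add: swapn_def)
  ultimately show ?thesis
    using orthogonal_conj_reflection[OF orthogonal_hyperplane_reflection, of "e n" "\<alpha> i" 0 x] neg_n_alpha[of i] False
    by (simp add: S_pos)
qed

lemma swapn_mem: "i \<in> {1..n} \<Longrightarrow> swapn n i \<in> {1..n}"
  using n4 by (auto simp: swapn_def)

lemma neg_n_A0: "neg_n ` A0 = A0"
proof -
  have "neg_n x \<in> A0" if "x \<in> A0" for x
  proof -
    have "\<alpha> i \<bullet> neg_n x = \<alpha> (swapn n i) \<bullet> x" if "i \<in> {1..n}" for i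
      using neg_n_alpha[OF that] hyperplane_reflection_self_adjoint[of "e n" "\<alpha> i" x] by simp
    moreover have "\<theta> \<bullet> neg_n x = \<theta> \<bullet> x"
      using neg_n_theta hyperplane_reflection_self_adjoint[of "e n" \<theta> x] by simp
    ultimately show ?thesis
      using that swapn_mem by (simp only: fundamental_alcove_def mem_Collect_eq) simp
  qed
  then show ?thesis
    by (metis hyperplane_reflection_invol image_subsetI subset_antisym subsetI image_eqI)
qed

sublocale branched_chain \<alpha> \<theta> e n "n - 1" "[n, n - 1]" neg_n
proof
  show "wd ([2..<n - 1] @ [n, n - 1] @ rev [2..<n - 1]) x = hyperplane_reflection (e 2) 0 (neg_n x)" for x
    using wd_palindrome[of 2 x] n4 by simp
  show "\<alpha> i \<bullet> e 1 = 0" if "i \<in> {2..n}" for i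
    using that alpha_e[of 1 i] n4 by (cases "i = n") (auto simp: alpha_n orth inner_add_left)
  show "neg_n (S i x) = S i (neg_n x)" if "i < n - 1" for i x
  proof -
    have "swapn n i = i" "i \<le> n" using that by (auto simp: swapn_def)
    then show ?thesis using neg_n_S[of i x] by simp
  qed
qed (use n4 theta_D_eq nu_coweight neg_n_A0 in auto)

text \<open>The Coxeter number is \<open>2 * n - 2\<close>. The first coordinate is 1/2 and the last
  is 0, so two signs remain open.\<close>

definition p :: 'a where "p = pt (\<lambda>i. real (n - i) / (2 * real n - 2))"

lemma e_p: "i \<in> {1..n} \<Longrightarrow> e i \<bullet> p = (real n - real i) / (2 * real n - 2)"
  unfolding p_def by (simp add: e_pt of_nat_diff)

lemma alpha_p: "i \<in> {1..n} \<Longrightarrow> (2 * real n - 2) * (\<alpha> i \<bullet> p) = 1"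
proof (cases "i = n")
  case True
  have n1: "real (n - 1) = real n - 1" using n4 by (simp add: of_nat_diff)
  show ?thesis unfolding True alpha_n inner_add_left e_p[OF mem(3)] e_p[OF mem(4)] n1 using n4 by simp
next
  case False
  assume "i \<in> {1..n}"
  with False have i: "i \<in> {1..<n}" by simp
  then show ?thesis unfolding alpha_inner[OF i] using e_p[of i] e_p[of "Suc i"] n4
    by (simp add: field_simps)
qed

lemma theta_p: "(2 * real n - 2) * (\<theta> \<bullet> p) = (2 * real n - 2) - 1"
  using e_p[of 1] e_p[of 2] n4 by (simp add: theta inner_add_left field_simps)

lemma p_A0: "p \<in> A0"
  using n4 by (intro special_point_A0[OF _ alpha_p theta_p]) auto

lemma alpha_n_norm: "\<alpha> n \<bullet> \<alpha> n = 2"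
  using n4 mem by (simp add: alpha_n inner_add_left inner_add_right orth)

lemma cv_eq: "i \<in> {1..n} \<Longrightarrow> cv i = \<alpha> i"
  using alpha_n_norm cv_chain[of i] by (cases "i = n") (auto simp: cv_def)

lemma SE_cv:
  assumes "i \<in> {1..n}" "x \<in> SE"
  shows "x \<bullet> cv i \<in> \<int>"
proof (cases "i = n")
  case True
  obtain j s where "j \<in> {1..n}" "s = 1 \<or> s = - 1" "x = s *\<^sub>R e j" using SE_cases assms(2) by blast
  then show ?thesis unfolding cv_eq[OF assms(1)] unfolding True alpha_n using mem by (auto simp: inner_add_right orth)
next
  case False
  then have "i \<in> {1..<n}" using assms by auto
  then show ?thesis unfolding cv_eq[OF assms(1)] using SE_inner_chain[OF assms(2)] by fastforce
qed

definition esum :: 'a where "esum = (\<Sum>i=1..n. e i)"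

lemma esum_e: "i \<in> {1..n} \<Longrightarrow> esum \<bullet> e i = 1"
proof -
  assume i: "i \<in> {1..n}"
  have "esum \<bullet> e i = (\<Sum>j=1..n. if j = i then 1 else 0)"
    unfolding esum_def inner_sum_left using i by (intro sum.cong) (auto simp: orth)
  then show ?thesis using i by simp
qed

lemma esum_alpha: "i \<in> {1..n} \<Longrightarrow> esum \<bullet> \<alpha> i = (if i = n then 2 else 0)"
  using sum_e_alpha[of i] esum_e[OF mem(3)] esum_e[OF mem(4)] n4
  by (cases "i = n") (auto simp: alpha_n inner_add_right esum_def)

lemma M_even: "\<beta> \<in> M \<Longrightarrow> 1 / 2 * (esum \<bullet> \<beta>) \<in> \<int>"
  by (erule M_inner_Ints) (simp add: cv_eq esum_alpha)

text \<open>For an element \<open>w\<close> that only changes signs, \<open>w esum - esum\<close> is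
  minus twice the sum of the negated \<open>e i\<close>. Together with \<open>M_even\<close> the
  lemma says that their number is even.\<close>

lemma W_esum:
  assumes "w \<in> W"
  obtains \<beta> where "\<beta> \<in> M" "w esum = esum + 2 *\<^sub>R \<beta>"
proof -
  have "w esum \<in> {esum + 2 *\<^sub>R \<beta> | \<beta>. \<beta> \<in> M}"
    using assms
  proof (rule finite_weyl_group_invariant)
    show "esum \<in> {esum + 2 *\<^sub>R \<beta> | \<beta>. \<beta> \<in> M}" using M_0 by force
  next
    fix i x assume i: "i \<in> {1..n}" and "x \<in> {esum + 2 *\<^sub>R \<beta> | \<beta>. \<beta> \<in> M}"
    then obtain \<beta> where \<beta>: "\<beta> \<in> M" "x = esum + 2 *\<^sub>R \<beta>" by blast
    define k where "k = (if i = n then 1 else 0 :: real)"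
    have k: "k \<in> \<int>" "\<alpha> i \<bullet> esum = 2 * k"
      using esum_alpha[OF i] by (auto simp: k_def inner_commute)
    define \<gamma> where "\<gamma> = hyperplane_reflection (\<alpha> i) 0 \<beta> - k *\<^sub>R cv i"
    have "\<gamma> \<in> M" unfolding \<gamma>_def
      by (intro M_diff M_scale[OF M_cv[OF i] k(1)] M_W[OF finite_weyl_group_reflection[OF i] \<beta>(1)])
    moreover have "hyperplane_reflection (\<alpha> i) 0 x = esum + 2 *\<^sub>R \<gamma>"
      unfolding \<beta>(2) \<gamma>_def hyperplane_reflection_add hyperplane_reflection_cmul
      by (simp add: reflection_cv[of i esum] k(2) scaleR_right_diff_distrib)
    ultimately show "hyperplane_reflection (\<alpha> i) 0 x \<in> {esum + 2 *\<^sub>R \<beta> | \<beta>. \<beta> \<in> M}" by blast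
  qed
  then show ?thesis using that by blast
qed

lemma free:
  assumes u: "u \<in> W_af" "u p \<in> A0"
  shows "u = id"
proof -
  have n0: "0 < 2 * real n - 2" and nZ: "2 * real n - 2 \<in> \<int>" using n4 by auto
  note le = orbit_in_alcove[OF n0 alpha_p theta_p nZ u]
  define a where "a i = e i \<bullet> u p - e i \<bullet> p" for i
  have mono: "a (Suc i) \<le> a i" if "i \<in> {1..<n}" for i
    using le(1)[of i] that by (simp add: alpha_inner a_def)
  have an: "0 \<le> a (n - 1) + a n" using le(1)[of n] mem(3) by (simp add: a_def alpha_n inner_add_left)
  have a12: "a 1 + a 2 \<le> 0" using le(2) by (simp add: a_def theta inner_add_left)
  have an1: "a n \<le> a (n - 1)" using mono[of "n - 1"] n4 by simp
  have pos: "0 \<le> a i" if "i \<in> {1..n - 1}" for i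
    using antitone_chain[of n a i "n - 1"] mono an an1 that by fastforce
  have "0 \<le> a 2" using n4 by (intro pos) auto
  then have "a 1 \<le> 0" using a12 by simp
  then have zero: "a i = 0" if "i \<in> {1..n - 1}" for i
    using antitone_chain[of n a 1 i] mono pos[OF that] that by fastforce
  then have "a (n - 1) = 0" using n4 by simp
  then have "a n = 0" using an an1 by simp
  then have "a i = 0" if "i \<in> {1..n}" for i using zero[of i] that by (cases "i = n") auto
  then have up: "u p = p" by (intro point_eqI) (simp add: a_def)
  obtain w \<beta> where w: "w \<in> W" "\<beta> \<in> M" "u = (\<lambda>x. w x + \<beta>)" using u W_af_iff by meson
  have wp: "w p + \<beta> = p" using up w by simp
  have val: "0 \<le> e i \<bullet> p \<and> e i \<bullet> p \<le> 1 / 2" if "i \<in> {1..n}" for i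
    unfolding e_p[OF that] using that n4 by (auto simp: field_simps)
  have inj: "i = j" if "i \<in> {1..n}" "j \<in> {1..n}" "e i \<bullet> p = e j \<bullet> p" for i j
    using that e_p n4 by auto
  have "e 1 \<bullet> p = (real n - 1) / (2 * (real n - 1))" using e_p[OF mem(1)] by (simp add: algebra_simps)
  then have p1: "e 1 \<bullet> p = 1 / 2" using n4 by simp
  have half: "i = 1" if "i \<in> {1..n}" "e i \<bullet> p = 1 / 2" for i
    using inj[OF that(1) mem(1)] that(2) p1 by simp
  have null: "i = n" if "i \<in> {1..n}" "e i \<bullet> p = 0" for i
    using inj[of i n] e_p[of n] that n4 by simp
  have we: "w (e i) = e i \<or> (i = 1 \<or> i = n) \<and> w (e i) = - e i" if i: "i \<in> {1..n}" for i
    using sign_changes[OF w(1,2) wp SE_reflection SE_cv val inj i] half[OF i] null[OF i] by blast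
  have half_not: "(1 / 2 :: real) \<notin> \<int>" using Ints_small[of "1 / 2"] by auto
  \<comment> \<open>A sign change at \<open>e 1\<close> makes \<open>\<beta>\<close> the vector
    \<open>e 1\<close>, of odd coordinate sum; the coordinate of \<open>\<beta>\<close> at
    \<open>n\<close> is 0 whatever the sign there, because \<open>p\<close> vanishes at
    \<open>e n\<close>.\<close>
  have w1: "w (e 1) = e 1"
  proof (rule ccontr)
    assume "w (e 1) \<noteq> e 1"
    then have neg: "w (e 1) = - e 1" using we[OF mem(1)] by blast
    have "e i \<bullet> \<beta> = (if i = 1 then 1 else 0)" if i: "i \<in> {1..n}" for i
    proof (cases "i = 1")
      case True
      then show ?thesis using orbit_values[OF w(1,2) wp, of 1 "- 1"] neg p1 by simp
    next
      case False
      then consider "w (e i) = e i" | "i = n" "w (e i) = - e i" using we[OF i] by blast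
      then show ?thesis
      proof cases
        case 1
        then show ?thesis using orbit_values[OF w(1,2) wp, of i 1] False by simp
      next
        case 2
        then show ?thesis using orbit_values[OF w(1,2) wp, of n "- 1"] e_p[OF mem(3)] False by simp
      qed
    qed
    then have "esum \<bullet> \<beta> = (\<Sum>i=1..n. if i = 1 then 1 else 0)"
      unfolding esum_def inner_sum_left by (intro sum.cong) auto
    then have "esum \<bullet> \<beta> = 1" using n4 by simp
    then show False using M_even[OF w(2)] half_not by simp
  qed
  \<comment> \<open>A sign change at \<open>e n\<close> is invisible in \<open>\<beta>\<close>, so
    the parity is taken from \<open>w\<close> itself: it would now negate exactly one
    vector.\<close>
  have wn: "w (e n) = e n"
  proof (rule ccontr)
    assume "w (e n) \<noteq> e n"
    then have neg: "w (e n) = - e n" using we[OF mem(3)] by blast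
    obtain \<gamma> where \<gamma>: "\<gamma> \<in> M" "w esum = esum + 2 *\<^sub>R \<gamma>" using W_esum[OF w(1)] by blast
    have "w esum = (\<Sum>i=1..n. w (e i))" unfolding esum_def by (rule linear_sum[OF W_linear[OF w(1)]])
    also have "\<dots> = (\<Sum>i=1..n. e i - (if i = n then 2 *\<^sub>R e i else 0))"
      using we w1 neg by (intro sum.cong) (auto simp: scaleR_2)
    also have "\<dots> = esum - 2 *\<^sub>R e n" using n4 by (simp add: sum_subtractf esum_def)
    finally have "2 *\<^sub>R \<gamma> = 2 *\<^sub>R (- e n)" using \<gamma>(2) by simp
    then have "\<gamma> = - e n" by (simp only: scaleR_cancel_left) simp
    then have "esum \<bullet> \<gamma> = - 1" using esum_e[OF mem(3)] by simp
    then show False using M_even[OF \<gamma>(1)] half_not Ints_minus[of "- 1 / 2 :: real"] by simp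
  qed
  have "w (e i) = e i" if "i \<in> {1..n}" for i using we[OF that] w1 wn by auto
  then have "w x = x" for x using linear_span_idI[OF span_e W_linear[OF w(1)]] by blast
  then show ?thesis using wp w by auto
qed

lemma Orb_eq: "Orb = SE"
proof
  show "Orb \<subseteq> SE"
    by (rule coweight_orbit_subset) (use nu_e1 mem SE_reflection in \<open>auto simp: SE_def\<close>)
  have "- e i \<in> Orb" if i: "i \<in> {1..n}" for i
  proof (cases "i = n")
    case True
    have "hyperplane_reflection (\<alpha> n) 0 (e (n - 1)) = - e n"
      using reflection_n_e[OF mem(4)] n4 by simp
    then show ?thesis
      using True coweight_orbit_W[OF e_in_Orb[OF mem(4)] finite_weyl_group_reflection[OF mem(3)]] by simp
  next
    case False
    then have "i \<in> {1..n - 1}" using i by auto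
    then show ?thesis
      using coweight_orbit_W[OF e_in_Orb[OF i] palindrome_in_W[of i]] False reflection_basis[OF i i] reflection_basis[OF mem(3) i] by simp
  qed
  then show "SE \<subseteq> Orb" using e_in_Orb by (auto simp: SE_def)
qed

text \<open>A diagram automorphism is represented by an affine map that preserves the alcove and
  permutes its walls; it need not lie in the affine Weyl group. Preservation of \<open>SE\<close> by
  the linear part keeps translation vectors in the orbit.\<close>

definition realizes :: "('a \<Rightarrow> 'a) \<Rightarrow> 'a \<Rightarrow> (nat \<Rightarrow> nat) \<Rightarrow> bool" where
  "realizes g b \<sigma> \<longleftrightarrow> linear g \<and> g ` SE \<subseteq> SE \<and> (\<lambda>x. g x + b) ` A0 = A0 \<and>
     (\<forall>i\<le>n. \<sigma> i \<le> n \<and> (\<forall>x. g (S i x) + b = S (\<sigma> i) (g x + b)))"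

lemma realizes_id: "realizes id 0 id"
  by (simp add: realizes_def linear_id)

lemma realizes_comp:
  assumes "realizes g b \<sigma>" "realizes g' b' \<sigma>'"
  shows "realizes (g \<circ> g') (g b' + b) (\<sigma> \<circ> \<sigma>')"
proof -
  have lin: "linear g" "linear g'" using assms by (auto simp: realizes_def)
  have "(\<lambda>x. g (g' x) + (g b' + b)) ` A0 = (\<lambda>x. g x + b) ` (\<lambda>x. g' x + b') ` A0"
    by (simp add: image_image linear_add[OF lin(1)] add.assoc)
  then have "(\<lambda>x. (g \<circ> g') x + (g b' + b)) ` A0 = A0" using assms by (simp add: realizes_def)
  moreover have "g (g' (S i x)) + (g b' + b) = S (\<sigma> (\<sigma>' i)) (g (g' x) + (g b' + b))" if "i \<le> n" for i x
  proof -
    have "g (g' (S i x)) + (g b' + b) = g (g' (S i x) + b') + b"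
      by (simp add: linear_add[OF lin(1)])
    also have "\<dots> = S (\<sigma> (\<sigma>' i)) (g (g' x + b') + b)"
      using assms that by (simp add: realizes_def)
    finally show ?thesis by (simp add: linear_add[OF lin(1)] add.assoc)
  qed
  moreover have "(g \<circ> g') ` SE \<subseteq> SE" using assms by (fastforce simp: realizes_def)
  moreover have "(\<sigma> \<circ> \<sigma>') i \<le> n" if "i \<le> n" for i using assms that by (simp add: realizes_def)
  ultimately show ?thesis
    using linear_compose[OF lin(2,1)] by (simp add: realizes_def)
qed

lemma realizes_cong: "realizes g b \<sigma> \<Longrightarrow> (\<And>i. i \<le> n \<Longrightarrow> \<sigma>' i = \<sigma> i) \<Longrightarrow> realizes g b \<sigma>'"
  by (simp add: realizes_def)

lemma realizes_word:
  assumes "realizes g b \<sigma>" "ws \<in> lists {0..n}"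
  shows "g (wd ws x) + b = wd (map \<sigma> ws) (g x + b)" "map \<sigma> ws \<in> lists {0..n}"
proof -
  show "g (wd ws x) + b = wd (map \<sigma> ws) (g x + b)"
    using assms(2)
  proof (induction ws)
    case (Cons i ws)
    then show ?case using assms(1) by (simp add: realizes_def)
  qed simp
  show "map \<sigma> ws \<in> lists {0..n}" using assms by (auto simp: realizes_def)
qed

text \<open>The affine map conjugates \<open>wd ws\<close> to \<open>wd (map \<sigma> ws)\<close>
  and preserves \<open>A0\<close>, so only its linear part acts on the translation vector.\<close>

lemma realizes_translate:
  assumes r: "realizes g b \<sigma>" and ws: "ws \<in> lists {0..n}" and \<mu>: "wd ws ` A0 = (\<lambda>x. x + \<mu>) ` A0"
  shows "wd (map \<sigma> ws) ` A0 = (\<lambda>x. x + g \<mu>) ` A0"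
proof -
  have A: "(\<lambda>x. g x + b) ` A0 = A0" and lin: "linear g" using r by (auto simp: realizes_def)
  have "wd (map \<sigma> ws) ` A0 = wd (map \<sigma> ws) ` (\<lambda>x. g x + b) ` A0" by (simp only: A)
  also have "\<dots> = (\<lambda>x. g x + b) ` wd ws ` A0"
    by (simp add: image_image realizes_word(1)[OF r ws])
  also have "\<dots> = (\<lambda>x. x + g \<mu>) ` (\<lambda>x. g x + b) ` A0"
    unfolding \<mu> by (simp add: image_image linear_add[OF lin] add_ac)
  finally show ?thesis by (simp only: A)
qed

lemma SE_reflection_basis:
  assumes "j \<in> {1..n}" "x \<in> SE"
  shows "hyperplane_reflection (e j) 0 x \<in> SE"
proof -
  obtain i s where i: "i \<in> {1..n}" "s = 1 \<or> s = - 1" "x = s *\<^sub>R e i" using SE_cases assms(2) by blast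
  then show ?thesis
    using reflection_basis[OF assms(1) i(1)] e_SE[OF i(1)] by (auto simp: hyperplane_reflection_cmul)
qed

lemma realizes_swapn: "realizes neg_n 0 (swapn n)"
proof -
  have "neg_n x \<in> SE" if "x \<in> SE" for x
    using that by (rule SE_reflection_basis[OF mem(3)])
  moreover have "swapn n i \<le> n" if "i \<le> n" for i using that by (simp add: swapn_def)
  ultimately show ?thesis
    using neg_n_A0 neg_n_S linear_hyperplane_reflection by (auto simp: realizes_def)
qed

lemma realizes_swap0: "realizes (hyperplane_reflection (e 1) 0) (e 1) swap0"
proof -
  let ?g = "hyperplane_reflection (e 1) 0"
  have flip_eq: "?g x + e 1 = flip x" for x
    using hyperplane_reflection_shift[of "e 1" "1 / 2" x] orth[OF mem(1,1)] by (simp add: flip_def)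
  have SE: "?g x \<in> SE" if "x \<in> SE" for x
    using that by (rule SE_reflection_basis[OF mem(1)])
  have a1: "\<alpha> 1 = e 1 - e 2" using alpha_diff[of 1] n4 by (simp add: numeral_2_eq_2)
  \<comment> \<open>The linear part exchanges the two roots up to sign, and the shift by
    \<open>e 1\<close> adjusts the constants 0 and 1 of their walls.\<close>
  have gt: "?g \<theta> = - \<alpha> 1" and g1: "?g (\<alpha> 1) = - \<theta>"
    unfolding a1 theta hyperplane_reflection_add hyperplane_reflection_diff
    using reflection_basis[OF mem(1,1)] reflection_basis[OF mem(1,2)] by simp_all
  have S: "?g (S i x) + e 1 = S (swap0 i) (?g x + e 1)" if "i \<le> n" for i x
  proof -
    note conj = isometry_conj_reflection[OF orthogonal_hyperplane_reflection, of "e 1"]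
    have "i = 0 \<or> i = 1 \<or> i \<in> {2..n}" using that by auto
    then consider "i = 0" | "i = 1" | "i \<in> {2..n}" by blast
    then show ?thesis
    proof cases
      case 1
      have "1 + (- \<alpha> 1) \<bullet> e 1 = 0" using a1 orth[OF mem(1,1)] orth[OF mem(2,1)] by (simp add: inner_diff_left)
      then have "?g (S 0 x) + e 1 = hyperplane_reflection (- \<alpha> 1) (- 0) (?g x + e 1)"
        using conj[of \<theta> 1 x "e 1"] gt by (simp add: simple_reflection_def)
      then show ?thesis unfolding hyperplane_reflection_minus 1 by (simp add: simple_reflection_def swap0_def)
    next
      case 2
      have "(- \<theta>) \<bullet> e 1 = - 1" using orth[OF mem(1,1)] orth[OF mem(2,1)] by (simp add: theta inner_add_left inner_diff_left)
      then have "?g (S 1 x) + e 1 = hyperplane_reflection (- \<theta>) (- 1) (?g x + e 1)"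
        using conj[of "\<alpha> 1" 0 x "e 1"] g1 by (simp add: simple_reflection_def)
      then show ?thesis unfolding hyperplane_reflection_minus 2 by (simp add: simple_reflection_def swap0_def)
    next
      case 3
      have "?g (\<alpha> i) = \<alpha> i" using alpha_e1[OF 3] by (simp add: hyperplane_reflection_def inner_commute)
      then show ?thesis
        using conj[of "\<alpha> i" 0 x "e 1"] alpha_e1[OF 3] 3 by (simp add: simple_reflection_def swap0_def)
    qed
  qed
  have "swap0 i \<le> n" if "i \<le> n" for i using that n4 by (simp add: swap0_def)
  moreover have "(\<lambda>x. ?g x + e 1) ` A0 = A0" using flip_A0 by (simp only: flip_eq)
  ultimately show ?thesis
    unfolding realizes_def using S SE linear_hyperplane_reflection by blast
qed

text \<open>The linear part of the map that replaces coordinate \<open>i\<close> by 1/2 minus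
  coordinate \<open>n + 1 - i\<close>. The constant 1/2 exchanges the wall of
  \<open>\<theta>\<close> at height 1 with the wall of \<open>\<alpha> n\<close> at height
  0.\<close>

definition revg :: "'a \<Rightarrow> 'a" where "revg x = pt (\<lambda>i. - (e (Suc n - i) \<bullet> x))"

lemma e_revg: "i \<in> {1..n} \<Longrightarrow> e i \<bullet> revg x = - (e (Suc n - i) \<bullet> x)"
  by (simp add: revg_def e_pt)

lemma inner_expand: "x \<bullet> y = (\<Sum>i=1..n. (e i \<bullet> x) * (e i \<bullet> y))"
proof -
  have "x = pt (\<lambda>i. e i \<bullet> x)" by (rule point_eqI) (simp add: e_pt)
  then have "x \<bullet> y = pt (\<lambda>i. e i \<bullet> x) \<bullet> y" by simp
  then show ?thesis by (simp add: pt_def inner_sum_left)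
qed

lemma revg_self_adjoint: "revg x \<bullet> y = x \<bullet> revg y"
proof -
  have "revg x \<bullet> y = (\<Sum>i=1..n. - (e (Suc n - i) \<bullet> x) * (e i \<bullet> y))"
    unfolding inner_expand[of "revg x"] by (intro sum.cong) (auto simp: e_revg)
  also have "\<dots> = (\<Sum>i=1..n. - (e i \<bullet> x) * (e (Suc n - i) \<bullet> y))"
    by (rule sum.reindex_bij_witness[where i = "\<lambda>i. Suc n - i" and j = "\<lambda>i. Suc n - i"]) auto
  also have "\<dots> = x \<bullet> revg y"
    unfolding inner_expand[of x] by (intro sum.cong) (auto simp: e_revg)
  finally show ?thesis .
qed

lemma revg_revg: "revg (revg x) = x"
proof (rule point_eqI)
  fix i assume i: "i \<in> {1..n}"
  then have "Suc n - i \<in> {1..n}" "Suc n - (Suc n - i) = i" by auto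
  then show "e i \<bullet> revg (revg x) = e i \<bullet> x" by (simp only: e_revg[OF i] e_revg minus_minus)
qed

lemma linear_revg: "linear revg"
  by (rule linearI; rule point_eqI) (simp_all add: e_revg inner_add_right)

lemma orthogonal_revg: "orthogonal_transformation revg"
  unfolding orthogonal_transformation_def using linear_revg revg_self_adjoint revg_revg by metis

lemma revg_e: "i \<in> {1..n} \<Longrightarrow> revg (e i) = - e (Suc n - i)"
proof (rule point_eqI)
  fix j assume ij: "i \<in> {1..n}" "j \<in> {1..n}"
  then have "Suc n - j = i \<longleftrightarrow> j = Suc n - i" "Suc n - i \<in> {1..n}" "Suc n - j \<in> {1..n}" by auto
  with ij show "e j \<bullet> revg (e i) = e j \<bullet> - e (Suc n - i)"
    by (simp only: e_revg orth inner_minus_right)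
qed

lemma realizes_revD: "realizes revg (pt (\<lambda>_. 1 / 2)) (revD n)"
proof -
  define b where "b = pt (\<lambda>_. 1 / 2)"
  have eb: "e i \<bullet> b = 1 / 2" if "i \<in> {1..n}" for i using that by (simp add: b_def e_pt)
  have SE: "revg x \<in> SE" if "x \<in> SE" for x
  proof -
    obtain i s where i: "i \<in> {1..n}" "s = 1 \<or> s = - 1" "x = s *\<^sub>R e i" using SE_cases \<open>x \<in> SE\<close> by blast
    then have "Suc n - i \<in> {1..n}" by auto
    then show ?thesis
      using i(2) unfolding i(3) linear_cmul[OF linear_revg] revg_e[OF i(1)] using e_SE by auto
  qed
  have mid: "revg (\<alpha> i) = \<alpha> (n - i)" "\<alpha> i \<bullet> b = 0" if i: "i \<in> {1..<n}" for i
  proof -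
    have "Suc n - i = Suc (n - i)" "Suc n - Suc i = n - i" "n - i \<in> {1..<n}" "Suc i \<in> {1..n}" "i \<in> {1..n}"
      using i by auto
    then show "revg (\<alpha> i) = \<alpha> (n - i)"
      by (simp add: alpha_diff[OF i] alpha_diff[of "n - i"] linear_diff[OF linear_revg] revg_e)
    show "\<alpha> i \<bullet> b = 0" using eb[of i] eb[of "Suc i"] i by (simp add: alpha_inner)
  qed
  have idx: "Suc n - (n - 1) = 2" "Suc n - n = 1" "Suc n - 1 = n" "Suc n - 2 = n - 1" using n4 by auto
  have rn: "revg (\<alpha> n) = - \<theta>" and rt: "revg \<theta> = - \<alpha> n"
    unfolding alpha_n theta linear_add[OF linear_revg] revg_e[OF mem(1)] revg_e[OF mem(2)]
      revg_e[OF mem(3)] revg_e[OF mem(4)] idx by simp_all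
  have tb: "\<theta> \<bullet> b = 1" and nb: "\<alpha> n \<bullet> b = 1"
    unfolding theta alpha_n inner_add_left eb[OF mem(1)] eb[OF mem(2)] eb[OF mem(3)] eb[OF mem(4)]
    by simp_all
  have S: "revg (S i x) + b = S (revD n i) (revg x + b)" if "i \<le> n" for i x
  proof -
    note conj = isometry_conj_reflection[OF orthogonal_revg]
    have "i = 0 \<or> i = n \<or> i \<in> {1..<n}" using that by auto
    then consider "i = 0" | "i = n" | "i \<in> {1..<n}" by blast
    then show ?thesis
    proof cases
      case 1
      have "revg (S 0 x) + b = hyperplane_reflection (- \<alpha> n) (- 0) (revg x + b)"
        using conj[of \<theta> 1 x b] rt nb by (simp add: simple_reflection_def)
      then show ?thesis unfolding hyperplane_reflection_minus 1 using n4 by (simp add: simple_reflection_def revD_def)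
    next
      case 2
      have "revg (S n x) + b = hyperplane_reflection (- \<theta>) (- 1) (revg x + b)"
        using conj[of "\<alpha> n" 0 x b] rn tb n4 by (simp add: simple_reflection_def)
      then show ?thesis unfolding hyperplane_reflection_minus 2 by (simp add: simple_reflection_def revD_def)
    next
      case 3
      then have "n - i \<in> {1..<n}" by auto
      then show ?thesis
        using conj[of "\<alpha> i" 0 x b] mid[OF 3] mid(2)[of "n - i"] 3 by (simp add: simple_reflection_def revD_def)
    qed
  qed
  have A: "revg x + b \<in> A0" if "x \<in> A0" for x
  proof -
    have x: "0 < \<alpha> i \<bullet> x" if "i \<in> {1..n}" for i using \<open>x \<in> A0\<close> that by (simp add: fundamental_alcove_def)
    have xt: "\<theta> \<bullet> x < 1" using \<open>x \<in> A0\<close> by (simp add: fundamental_alcove_def)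
    have "0 < \<alpha> i \<bullet> (revg x + b)" if i: "i \<in> {1..n}" for i
    proof (cases "i = n")
      case True
      then show ?thesis using xt nb rn by (simp add: inner_add_right revg_self_adjoint[symmetric])
    next
      case False
      then have "i \<in> {1..<n}" "n - i \<in> {1..n}" using i by auto
      then show ?thesis using mid[of i] x[of "n - i"] by (simp add: inner_add_right revg_self_adjoint[symmetric])
    qed
    moreover have "\<theta> \<bullet> (revg x + b) < 1"
      using x[OF mem(3)] tb rt by (simp add: inner_add_right revg_self_adjoint[symmetric])
    ultimately show ?thesis by (simp add: fundamental_alcove_def)
  qed
  have "revg b = - b"
  proof (rule point_eqI)
    fix i assume "i \<in> {1..n}"
    moreover from this have "Suc n - i \<in> {1..n}" by auto
    ultimately show "e i \<bullet> revg b = e i \<bullet> - b" by (simp only: e_revg eb inner_minus_right)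
  qed
  then have invol: "revg (revg x + b) + b = x" for x
    by (simp add: linear_add[OF linear_revg] revg_revg)
  have "(\<lambda>x. revg x + b) ` A0 = A0"
  proof
    show "A0 \<subseteq> (\<lambda>x. revg x + b) ` A0"
    proof
      fix x assume "x \<in> A0"
      then show "x \<in> (\<lambda>x. revg x + b) ` A0"
        by (intro image_eqI[of _ _ "revg x + b"]) (simp_all add: invol A)
    qed
  qed (use A in blast)
  moreover have "revD n i \<le> n" if "i \<le> n" for i using that by (simp add: revD_def)
  ultimately show ?thesis unfolding b_def[symmetric] realizes_def using linear_revg SE S by blast
qed

lemma automorphism_realized:
  assumes "\<sigma> \<in> diagram_automorphismsD n"
  obtains g b where "realizes g b \<sigma>"
proof -
  obtain \<tau> where \<tau>: "\<tau> \<in> {id, swap0, swapn n, swap0 \<circ> swapn n}"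
    "(\<forall>i\<le>n. \<sigma> i = \<tau> i) \<or> (\<forall>i\<le>n. \<sigma> i = (revD n \<circ> \<tau>) i)"
    using diagram_automorphismD_cases[OF n4 assms] by blast
  have "\<exists>g b. realizes g b \<tau>"
    using \<tau>(1) realizes_id realizes_swap0 realizes_swapn realizes_comp[OF realizes_swap0 realizes_swapn] by blast
  then obtain g b where "realizes g b \<tau>" by blast
  moreover from this have "realizes (revg \<circ> g) (revg b + pt (\<lambda>_. 1 / 2)) (revD n \<circ> \<tau>)"
    by (rule realizes_comp[OF realizes_revD])
  ultimately show ?thesis using \<tau>(2) that realizes_cong by blast
qed

section \<open>The words of type D and their alcoves\<close>

abbreviation "baseD \<equiv> {[0] @ mid @ [0]} \<union>
  {vs \<in> rotations ([0, 1] @ mid). adjacent_in 0 1 vs \<and> adjacent_in (n - 1) n vs}"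

lemma wordsD_eq: "wordsD n = {map \<sigma> ws | \<sigma> ws. \<sigma> \<in> diagram_automorphismsD n \<and> ws \<in> baseD}"
  by (simp add: wordsD_def Let_def)

lemma rotations_mid:
  "{vs \<in> rotations ([0, 1] @ mid). adjacent_in 0 1 vs} = {b @ [0, 1] @ a | a b. mid = a @ b}"
  unfolding rotations_append[of "[0, 1]"] using n4 by (intro rotations_adjacent) auto

lemma baseD_element:
  assumes "ws \<in> baseD"
  obtains \<mu> where "\<mu> \<in> SE" "\<And>x. wd ws x = tau x + \<mu>" "ws \<in> lists {0..n}"
proof -
  have mid: "set mid \<subseteq> {0..n}" using n4 by auto
  have c: "[0, 1] \<in> {[0, 1], [1, 0::nat]}" by simp
  from assms consider "ws = [0] @ mid @ [0]"
    | "ws \<in> {vs \<in> rotations ([0, 1] @ mid). adjacent_in 0 1 vs}" "adjacent_in (n - 1) n ws"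
    by blast
  then show ?thesis
  proof cases
    case 1
    show ?thesis by (rule that[of "e 1"]) (use 1 n4 mid wd_mid_0 e_SE in auto)
  next
    case 2
    then obtain a b where ab: "mid = a @ b" "ws = b @ [0, 1] @ a" unfolding rotations_mid by blast
    have "set ws = set mid \<union> {0, 1}" using ab by auto
    then have ws: "ws \<in> lists {0..n}" using mid n4 by auto
    from ab(1) show ?thesis
    proof (rule palindrome_split)
      fix i assume i: "2 \<le> i" "i \<le> n - 1" "a = [2..<i]" "b = [i..<n - 1] @ [n, n - 1] @ rev [2..<n - 1]"
      show ?thesis
        by (rule that[of "- e i"])
          (use wd_rotation_left[OF i(1,2) c] i ab(2) ws e_SE(2)[of i] in auto)
    next
      fix i assume i: "2 \<le> i" "i \<le> n - 1" "b = rev [2..<i]" "a = [2..<n - 1] @ [n, n - 1] @ rev [i..<n - 1]"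
      show ?thesis
        by (rule that[of "e i"])
          (use wd_rotation_right[OF i(1,2) c] i ab(2) ws e_SE(1)[of i] in auto)
    next
      \<comment> \<open>The cut between \<open>n\<close> and \<open>n - 1\<close> puts them at
        opposite ends of the word, which the adjacency condition rules out.\<close>
      fix c c' assume cc: "[n, n - 1] = c @ c'" "c \<noteq> []" "c' \<noteq> []" "a = [2..<n - 1] @ c" "b = c' @ rev [2..<n - 1]"
      then have "c = [n]" "c' = [n - 1]" by (auto simp: Cons_eq_append_conv)
      then have "ws = (n - 1) # (rev [2..<n - 1] @ [0, 1] @ [2..<n - 1]) @ [n]" using ab cc by simp
      then have "\<not> adjacent_in n (n - 1) ws"
        using n4 not_adjacent_in_ends[of n "rev [2..<n - 1] @ [0, 1] @ [2..<n - 1]" "n - 1"] by simp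
      then show ?thesis using 2(2) adjacent_in_commute[of n "n - 1"] by blast
    qed (use n4 in auto)
  qed
qed

lemma baseD_memI:
  assumes "mid = a @ b" "adjacent_in n (n - 1) (b @ [0, 1] @ a)"
  shows "b @ [0, 1] @ a \<in> baseD"
proof -
  let ?w = "b @ [0, 1] @ a"
  have "?w \<in> {vs \<in> rotations ([0, 1] @ mid). adjacent_in 0 1 vs}"
    unfolding rotations_mid using assms(1) by blast
  moreover have "adjacent_in (n - 1) n ?w"
    using assms(2) by (subst adjacent_in_commute)
  ultimately show ?thesis by blast
qed

lemma baseD_rotations:
  assumes "2 \<le> i" "i \<le> n - 1"
  shows "([i..<n - 1] @ [n, n - 1] @ rev [2..<n - 1]) @ [0, 1] @ [2..<i] \<in> baseD"
    and "rev [2..<i] @ [0, 1] @ ([2..<n - 1] @ [n, n - 1] @ rev [i..<n - 1]) \<in> baseD"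
proof -
  have *: "[2..<n - 1] = [2..<i] @ [i..<n - 1]" using assms by (intro upt_split)
  show "([i..<n - 1] @ [n, n - 1] @ rev [2..<n - 1]) @ [0, 1] @ [2..<i] \<in> baseD"
  proof (rule baseD_memI)
    show "mid = [2..<i] @ ([i..<n - 1] @ [n, n - 1] @ rev [2..<n - 1])" by (metis * append_assoc)
    show "adjacent_in n (n - 1) (([i..<n - 1] @ [n, n - 1] @ rev [2..<n - 1]) @ [0, 1] @ [2..<i])"
      using adjacent_in_middle[of n "n - 1" "[i..<n - 1]" "rev [2..<n - 1] @ [0, 1] @ [2..<i]"] by simp
  qed
  show "rev [2..<i] @ [0, 1] @ ([2..<n - 1] @ [n, n - 1] @ rev [i..<n - 1]) \<in> baseD"
  proof (rule baseD_memI)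
    have "rev [2..<n - 1] = rev [i..<n - 1] @ rev [2..<i]" by (metis * rev_append)
    then show "mid = ([2..<n - 1] @ [n, n - 1] @ rev [i..<n - 1]) @ rev [2..<i]" by simp
    show "adjacent_in n (n - 1) (rev [2..<i] @ [0, 1] @ ([2..<n - 1] @ [n, n - 1] @ rev [i..<n - 1]))"
      using adjacent_in_middle[of n "n - 1" "rev [2..<i] @ [0, 1] @ [2..<n - 1]" "rev [i..<n - 1]"] by simp
  qed
qed

lemma Z_ideal_D: "Z_ideal n \<alpha> \<theta> = bruhat_ideal n \<alpha> \<theta> (wd ` wordsD n)"
proof -
  have wdA: "wd ws ` A0 = (\<lambda>x. x + \<mu>) ` A0" if "\<And>x. wd ws x = tau x + \<mu>" for ws \<mu>
  proof -
    have "wd ws = (\<lambda>x. tau x + \<mu>)" using that by blast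
    then show ?thesis using tau_A0 by metis
  qed
  have words: "map \<sigma> ws \<in> wordsD n" if "\<sigma> \<in> diagram_automorphismsD n" "ws \<in> baseD" for \<sigma> ws
    using that unfolding wordsD_eq by blast
  have words_id: "ws \<in> wordsD n" if "ws \<in> baseD" for ws
    using words[OF automorphisms_memD(1)[OF n4] that] by simp
  have c: "[0, 1] \<in> {[0, 1], [1, 0::nat]}" by simp
  have end0: "[0] @ mid @ [0] \<in> baseD" by simp
  have swap_mid: "map swap0 ([0] @ mid @ [0]) = [1] @ mid @ [1]"
    using n4 by (auto simp: swap0_def intro!: map_idI)
  have end_lists: "[0] @ mid @ [0] \<in> lists {0..n}" "[1] @ mid @ [1] \<in> lists {0..n}" using n4 by auto
  have "{u \<in> W_af. \<exists>\<mu>\<in>Orb. u ` A0 = (\<lambda>x. x + \<mu>) ` A0} = wd ` wordsD n"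
  proof (rule translates_eq[OF p_A0 free])
    show "wd ` wordsD n \<subseteq> W_af"
    proof
      fix g assume "g \<in> wd ` wordsD n"
      then obtain \<sigma> ws where *: "\<sigma> \<in> diagram_automorphismsD n" "ws \<in> baseD" "g = wd (map \<sigma> ws)"
        unfolding wordsD_eq by blast
      obtain h b where "realizes h b \<sigma>" using automorphism_realized[OF *(1)] by blast
      moreover have "ws \<in> lists {0..n}" using baseD_element[OF *(2)] by blast
      ultimately show "g \<in> W_af" unfolding *(3) by (intro wd_in_W_af realizes_word(2))
    qed
  next
    fix g assume "g \<in> wd ` wordsD n"
    then obtain \<sigma> ws where *: "\<sigma> \<in> diagram_automorphismsD n" "ws \<in> baseD" "g = wd (map \<sigma> ws)"
      unfolding wordsD_eq by blast
    obtain h b where h: "realizes h b \<sigma>" using automorphism_realized[OF *(1)] by blast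
    obtain \<mu> where \<mu>: "\<mu> \<in> SE" "\<And>x. wd ws x = tau x + \<mu>" "ws \<in> lists {0..n}"
      using baseD_element[OF *(2)] by blast
    have "g ` A0 = (\<lambda>x. x + h \<mu>) ` A0" unfolding *(3) by (rule realizes_translate[OF h \<mu>(3) wdA[OF \<mu>(2)]])
    moreover have "h \<mu> \<in> Orb" using h \<mu>(1) Orb_eq by (auto simp: realizes_def)
    ultimately show "\<exists>\<mu>\<in>Orb. g ` A0 = (\<lambda>x. x + \<mu>) ` A0" by blast
  next
    fix \<mu> assume "\<mu> \<in> Orb"
    then obtain i s where i: "i \<in> {1..n}" "s = 1 \<or> s = - 1" "\<mu> = s *\<^sub>R e i" using SE_cases Orb_eq by blast
    \<comment> \<open>The rotations reach only indices from 2 to \<open>n - 1\<close>. Index 1 comes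
      from the palindrome around 0 and its image under \<open>swap0\<close>, and index
      \<open>n\<close> from the reversals of both, because \<open>revg\<close> sends
      \<open>e 1\<close> to \<open>- e n\<close>.\<close>
    have A1: "wd ([0] @ mid @ [0]) ` A0 = (\<lambda>x. x + e 1) ` A0" by (rule wdA[OF wd_mid_0])
    have A2: "wd ([1] @ mid @ [1]) ` A0 = (\<lambda>x. x + - e 1) ` A0" by (rule wdA) (simp only: wd_mid_1 diff_conv_add_uminus)
    have m0: "[0] @ mid @ [0] \<in> wordsD n" by (rule words_id[OF end0])
    have m1: "[1] @ mid @ [1] \<in> wordsD n"
      using words[OF automorphisms_memD(2)[OF n4] end0] unfolding swap_mid .
    have m2: "map (revD n) ([0] @ mid @ [0]) \<in> wordsD n"
      by (rule words[OF automorphisms_memD(3)[OF n4] end0])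
    have m3: "map (revD n) ([1] @ mid @ [1]) \<in> wordsD n"
      using words[OF automorphisms_memD(4)[OF n4] end0] unfolding map_map[symmetric] swap_mid .
    have r1: "revg (e 1) = - e n" using revg_e[OF mem(1)] by simp
    have r2: "revg (- e 1) = e n" using r1 linear_neg[OF linear_revg, of "e 1"] by simp
    have A3: "wd (map (revD n) ([0] @ mid @ [0])) ` A0 = (\<lambda>x. x + - e n) ` A0"
      using realizes_translate[OF realizes_revD end_lists(1) A1] unfolding r1 .
    have A4: "wd (map (revD n) ([1] @ mid @ [1])) ` A0 = (\<lambda>x. x + e n) ` A0"
      using realizes_translate[OF realizes_revD end_lists(2) A2] unfolding r2 .
    have plus: "\<exists>ws\<in>wordsD n. wd ws ` A0 = (\<lambda>x. x + e i) ` A0"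
      and minus: "\<exists>ws\<in>wordsD n. wd ws ` A0 = (\<lambda>x. x + - e i) ` A0"
    proof -
      consider "i = 1" | "i = n" | "2 \<le> i" "i \<le> n - 1" using i(1) by force
      then have "(\<exists>ws\<in>wordsD n. wd ws ` A0 = (\<lambda>x. x + e i) ` A0) \<and>
        (\<exists>ws\<in>wordsD n. wd ws ` A0 = (\<lambda>x. x + - e i) ` A0)"
      proof cases
        case 1
        show ?thesis unfolding 1 using A1 A2 m0 m1 by blast
      next
        case 2
        show ?thesis unfolding 2 using A3 A4 m2 m3 by blast
      next
        case 3
        show ?thesis
        proof (intro conjI bexI)
          show "wd (rev [2..<i] @ [0, 1] @ ([2..<n - 1] @ [n, n - 1] @ rev [i..<n - 1])) ` A0
              = (\<lambda>x. x + e i) ` A0"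
            by (rule wdA[OF wd_rotation_right[OF 3 c]])
          show "wd (([i..<n - 1] @ [n, n - 1] @ rev [2..<n - 1]) @ [0, 1] @ [2..<i]) ` A0
              = (\<lambda>x. x + - e i) ` A0"
            by (rule wdA) (simp only: wd_rotation_left[OF 3 c] diff_conv_add_uminus)
        qed (rule words_id[OF baseD_rotations(2)[OF 3]], rule words_id[OF baseD_rotations(1)[OF 3]])
      qed
      then show "\<exists>ws\<in>wordsD n. wd ws ` A0 = (\<lambda>x. x + e i) ` A0"
        "\<exists>ws\<in>wordsD n. wd ws ` A0 = (\<lambda>x. x + - e i) ` A0" by blast+
    qed
    have "\<mu> = e i \<or> \<mu> = - e i" using i(2,3) by auto
    then have "\<exists>ws\<in>wordsD n. wd ws ` A0 = (\<lambda>x. x + \<mu>) ` A0" using plus minus by blast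
    then show "\<exists>g\<in>wd ` wordsD n. g ` A0 = (\<lambda>x. x + \<mu>) ` A0" by blast
  qed
  then show ?thesis unfolding Z_ideal_def by simp
qed

end

subsection \<open>Cyclically decreasing words\<close>

lemma wordA_nth: "k < n - 1 \<Longrightarrow> wordA n r ! k = (r + n - k) mod n"
  by (simp add: wordA_def)

lemma length_wordA [simp]: "length (wordA n r) = n - 1"
  by (simp add: wordA_def)

lemma wordA_last: "2 \<le> n \<Longrightarrow> wordA n (n - 1) = rev [1..<n]"
proof (rule nth_equalityI)
  fix k assume n: "2 \<le> n" and "k < length (wordA n (n - 1))"
  then have k: "k < n - 1" by simp
  then have "n - 1 + n - k = (n - 1 - k) + n" by simp
  then have "(n - 1 + n - k) mod n = n - 1 - k" using k by (simp only: mod_add_self2) simp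
  then show "wordA n (n - 1) ! k = rev [1..<n] ! k"
    using k by (simp add: wordA_nth rev_nth)
qed simp

lemma mod_eq_close:
  fixes a b n :: nat
  assumes "a mod n = b mod n" "a \<le> b" "b < a + n"
  shows "a = b"
proof -
  have "n dvd b - a" using assms(1,2) by (metis mod_eq_dvd_iff_nat)
  moreover have "b - a < n" using assms(2,3) by linarith
  ultimately have "b - a = 0" using nat_dvd_not_less by blast
  then show ?thesis using assms(2) by simp
qed

text \<open>In the group this says that the element for \<open>r\<close> is the element for
  \<open>r - 1\<close> multiplied by generator \<open>r\<close> on the left and generator
  \<open>r + 1\<close> on the right, a recursion in \<open>r\<close>.\<close>

lemma wordA_rotate:
  assumes "2 \<le> n" "r < n"
  shows "r # wordA n ((r + n - 1) mod n) = wordA n r @ [Suc r mod n]"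
proof (rule nth_equalityI)
  show "length (r # wordA n ((r + n - 1) mod n)) = length (wordA n r @ [Suc r mod n])" by simp
  fix k assume "k < length (r # wordA n ((r + n - 1) mod n))"
  then have k: "k \<le> n - 1" by simp
  show "(r # wordA n ((r + n - 1) mod n)) ! k = (wordA n r @ [Suc r mod n]) ! k"
  proof (cases k)
    case 0
    then show ?thesis using assms by (simp add: nth_append wordA_nth)
  next
    case (Suc j)
    then have j: "j < n - 1" using k by simp
    have "((r + n - 1) mod n + n - j) mod n = ((r + n - 1) mod n + (n - j)) mod n" using j by simp
    also have "\<dots> = (r + n - 1 + (n - j)) mod n" by (rule mod_add_left_eq)
    also have "r + n - 1 + (n - j) = (r + n - k) + n" using j Suc by simp
    also have "(r + n - k + n) mod n = (r + n - k) mod n" by (rule mod_add_self2)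
    finally have "(r # wordA n ((r + n - 1) mod n)) ! k = (r + n - k) mod n"
      using j Suc by (simp add: wordA_nth)
    moreover have "(wordA n r @ [Suc r mod n]) ! k = (r + n - k) mod n"
    proof (cases "k = n - 1")
      case True
      then have "r + n - k = Suc r" using assms by simp
      then show ?thesis using True by (simp add: nth_append)
    next
      case False
      then show ?thesis using k by (simp add: nth_append wordA_nth)
    qed
    ultimately show ?thesis by simp
  qed
qed

lemma wordA_cyclically_decreasing:
  assumes "2 \<le> n"
  shows "cyclically_decreasing_word n (wordA n r)"
  unfolding cyclically_decreasing_word_def
proof (intro conjI allI impI)
  show "wordA n r \<in> lists {..<n}" using assms by (auto simp: wordA_def)
  have neq: "(r + n - p) mod n \<noteq> (r + n - q) mod n" if "p < q" "q < n - 1" for p q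
    using mod_eq_close[of "r + n - q" n "r + n - p"] that by force
  show "distinct (wordA n r)"
    unfolding distinct_conv_nth
  proof (intro allI impI)
    fix p q assume "p < length (wordA n r)" "q < length (wordA n r)" "p \<noteq> q"
    then show "wordA n r ! p \<noteq> wordA n r ! q"
      using neq[of p q] neq[of q p] by (simp add: wordA_nth) (metis linorder_neqE_nat)
  qed
  fix p q assume p: "p < length (wordA n r)" and q: "q < length (wordA n r)"
    and eq: "wordA n r ! q = Suc (wordA n r ! p) mod n"
  show "q < p"
  proof (rule ccontr)
    assume "\<not> q < p"
    have pq: "p \<le> q" "p < n - 1" "q < n - 1" using \<open>\<not> q < p\<close> p q by simp_all
    have "(r + n - q) mod n = Suc (r + n - p) mod n"
      using eq pq by (simp add: wordA_nth mod_Suc_eq)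
    then have "r + n - q = Suc (r + n - p)"
      by (rule mod_eq_close) (use pq in linarith)+
    then show False using pq by linarith
  qed
qed

text \<open>If all residues occurred, the successor of the first letter would have to stand before
  it.\<close>

lemma cyclically_decreasing_length:
  assumes "2 \<le> n" "cyclically_decreasing_word n ws"
  shows "length ws \<le> n - 1"
proof (rule ccontr)
  assume "\<not> length ws \<le> n - 1"
  have ws: "set ws \<subseteq> {..<n}" "distinct ws"
    and dec: "\<And>p q. p < length ws \<Longrightarrow> q < length ws \<Longrightarrow> ws ! q = Suc (ws ! p) mod n \<Longrightarrow> q < p"
    using assms(2) by (auto simp: cyclically_decreasing_word_def)
  have "card (set ws) = length ws" using ws(2) by (rule distinct_card)
  moreover have "card (set ws) \<le> n" using card_mono[OF _ ws(1)] by simp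
  ultimately have "card (set ws) = card {..<n}" "0 < length ws"
    using \<open>\<not> length ws \<le> n - 1\<close> by auto
  then have "set ws = {..<n}" using card_subset_eq[OF _ ws(1)] by simp
  then have "Suc (ws ! 0) mod n \<in> set ws" using assms(1) by simp
  then obtain q where "q < length ws" "ws ! q = Suc (ws ! 0) mod n" by (auto simp: in_set_conv_nth)
  then show False using dec[of 0 q] \<open>0 < length ws\<close> by simp
qed

lemma increasing_self_map:
  fixes f :: "nat \<Rightarrow> nat"
  assumes inc: "\<And>k. Suc k < N \<Longrightarrow> f k < f (Suc k)" and bound: "\<And>k. k < N \<Longrightarrow> f k < N"
    and k: "k < N"
  shows "f k = k"
proof -
  have lower: "j < N \<Longrightarrow> j \<le> f j" for j
  proof (induction j)
    case (Suc j)
    then show ?case using inc[of j] by simp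
  qed simp
  have "f j \<le> j" if "j \<le> N - 1" for j
    using that
  proof (induction j rule: inc_induct)
    case base
    then show ?case using bound[of "N - 1"] k by simp
  next
    case (step j)
    then have "Suc j < N" by linarith
    then show ?case using inc[of j] step.IH by linarith
  qed
  then have "f k \<le> k" using k by simp
  then show ?thesis using lower[OF k] by simp
qed

text \<open>Exactly one residue \<open>m\<close> is missing. Starting from \<open>r = m - 1\<close>,
  the remaining residues must occur in descending order, so the map from expected to actual
  positions is strictly increasing on \<open>n - 1\<close> places and hence the identity.\<close>

lemma cyclically_decreasing_maximal:
  assumes n: "2 \<le> n" and cd: "cyclically_decreasing_word n ws" and len: "length ws = n - 1"
  obtains r where "r < n" "ws = wordA n r"
proof -
  have ws: "set ws \<subseteq> {..<n}" "distinct ws"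
    and dec: "\<And>p q. p < length ws \<Longrightarrow> q < length ws \<Longrightarrow> ws ! q = Suc (ws ! p) mod n \<Longrightarrow> q < p"
    using cd by (auto simp: cyclically_decreasing_word_def)
  have "card ({..<n} - set ws) = 1"
    using card_Diff_subset[OF _ ws(1)] distinct_card[OF ws(2)] len n by simp
  then obtain m where m: "{..<n} - set ws = {m}" by (auto simp: card_1_singleton_iff)
  then have mn: "m < n" by blast
  define r where "r = (m + n - 1) mod n"
  have r: "r < n" using n by (simp add: r_def)
  define a where "a k = (r + n - k) mod n" for k
  have "a k \<in> set ws" if k: "k < n - 1" for k
  proof -
    have "a k \<noteq> m"
    proof
      assume "a k = m"
      have "a k = (r + (n - k)) mod n" using k by (simp add: a_def)
      also have "\<dots> = (m + n - 1 + (n - k)) mod n" unfolding r_def by (rule mod_add_left_eq)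
      finally have "(m + n) mod n = (m + n - 1 + (n - k)) mod n"
        using \<open>a k = m\<close> mn by simp
      then have "m + n = m + n - 1 + (n - k)" by (rule mod_eq_close) (use k in linarith)+
      then show False using k by linarith
    qed
    moreover have "a k < n" using n by (simp add: a_def)
    ultimately show ?thesis using m by blast
  qed
  then have "\<exists>i. i < length ws \<and> ws ! i = a k" if "k < n - 1" for k
    using that by (metis in_set_conv_nth)
  then obtain f where f: "\<And>k. k < n - 1 \<Longrightarrow> f k < length ws \<and> ws ! f k = a k" by metis
  have "f k = k" if "k < n - 1" for k
  proof (rule increasing_self_map[OF _ _ that])
    fix j assume j: "Suc j < n - 1"
    have "Suc (a (Suc j)) mod n = Suc (r + n - Suc j) mod n" by (simp add: a_def mod_Suc_eq)
    also have "Suc (r + n - Suc j) = r + n - j" using j by simp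
    finally have "ws ! f j = Suc (ws ! f (Suc j)) mod n" using f[of j] f[of "Suc j"] j by (simp add: a_def)
    then show "f j < f (Suc j)" using dec f[of j] f[of "Suc j"] j by simp
  qed (use f len in auto)
  then have "ws ! k = a k" if "k < n - 1" for k using f that by metis
  then have "ws = wordA n r" by (intro nth_equalityI) (simp_all add: len wordA_nth a_def)
  then show ?thesis using that r by blast
qed

subsection \<open>Type A\<close>

locale type_A = chain "n - 1" \<alpha> \<theta> e n 1
  for \<alpha> :: "nat \<Rightarrow> 'a::euclidean_space" and \<theta> e n +
  assumes theta: "\<theta> = e 1 - e n"
begin

lemma nodes: "{1..n - 1} = {1..<n}"
  using n2 by auto

lemma sum_e: "(\<Sum>i=1..n. e i) = 0"
proof (rule inner_span_eqI[OF span_alpha])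
  fix x assume "x \<in> \<alpha> ` {1..n - 1}"
  then obtain j where "j \<in> {1..<n}" "x = \<alpha> j" unfolding nodes by blast
  then show "x \<bullet> (\<Sum>i=1..n. e i) = x \<bullet> 0" using sum_e_alpha by (simp add: inner_commute)
qed

text \<open>These are the inner products of an orthonormal basis projected to the hyperplane of
  coordinate sum zero. The roots determine them up to a constant \<open>t\<close>, and the vanishing
  sum of the \<open>e j\<close> fixes it.\<close>

lemma e_inner:
  assumes "i \<in> {1..n}" "j \<in> {1..n}"
  shows "e i \<bullet> e j = (if i = j then 1 else 0) - 1 / n"
proof -
  define t where "t = e i \<bullet> e 1 - (if i = 1 then 1 else 0)"
  have step: "e i \<bullet> e j = t + (if i = j then 1 else 0)" if "1 \<le> j" "j \<le> n" for j
    using that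
  proof (induction j rule: dec_induct)
    case base
    then show ?case by (simp add: t_def)
  next
    case (step j)
    have "e i \<bullet> e (Suc j) = e i \<bullet> e j - \<alpha> j \<bullet> e i"
      using alpha_diff[of j] step.hyps step.prems
      by (simp add: inner_commute[of _ "e i"] inner_diff_right)
    then show ?case using alpha_e[OF assms(1), of j] step by auto
  qed
  have "0 = e i \<bullet> (\<Sum>j=1..n. e j)" by (simp only: sum_e inner_zero_right)
  also have "\<dots> = (\<Sum>j=1..n. t + (if j = i then 1 else 0))"
    unfolding inner_sum_right using step by (intro sum.cong) auto
  also have "\<dots> = n * t + 1" using assms(1) by (simp add: sum.distrib)
  finally have "t = - 1 / n" using n2 by (simp add: field_simps)
  then show ?thesis using step[of j] assms(2) by simp
qed

lemma E_reflection: "i \<in> {1..n - 1} \<Longrightarrow> x \<in> e ` {1..n} \<Longrightarrow> hyperplane_reflection (\<alpha> i) 0 x \<in> e ` {1..n}"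
  using n2 by (auto simp: reflection_e)

lemma E_cv: "i \<in> {1..n - 1} \<Longrightarrow> x \<in> e ` {1..n} \<Longrightarrow> x \<bullet> cv i \<in> \<int>"
  using n2 alpha_e by (auto simp: cv_chain inner_commute)

text \<open>The Coxeter number is \<open>n\<close>. The coordinates descend in steps of 1/n up to a
  common constant, which cancels in all differences.\<close>

definition p :: 'a where "p = (\<Sum>j=1..n. (- real j / n) *\<^sub>R e j)"

lemma e_p: obtains k where "\<And>i. i \<in> {1..n} \<Longrightarrow> e i \<bullet> p = k - real i / n"
proof
  fix i assume i: "i \<in> {1..n}"
  have "e i \<bullet> p = (\<Sum>j=1..n. (if j = i then - real i / n else 0) + real j / n / n)"
    unfolding p_def inner_sum_right using i by (intro sum.cong) (auto simp: e_inner algebra_simps)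
  also have "\<dots> = (\<Sum>j=1..n. real j / n / n) - real i / n" using i by (simp add: sum.distrib)
  finally show "e i \<bullet> p = (\<Sum>j=1..n. real j / n / n) - real i / n" .
qed

lemma e_p_diff: "i \<in> {1..n} \<Longrightarrow> j \<in> {1..n} \<Longrightarrow> e i \<bullet> p - e j \<bullet> p = (real j - real i) / n"
  by (rule e_p) (simp add: diff_divide_distrib)

lemma alpha_inner: "j \<in> {1..<n} \<Longrightarrow> \<alpha> j \<bullet> x = e j \<bullet> x - e (Suc j) \<bullet> x"
  using alpha_diff[of j] by (simp add: inner_diff_left)

lemma alpha_p: "i \<in> {1..n - 1} \<Longrightarrow> real n * (\<alpha> i \<bullet> p) = 1"
  unfolding nodes using e_p_diff[of i "Suc i"] n2 by (simp add: alpha_inner)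

lemma theta_p: "real n * (\<theta> \<bullet> p) = real n - 1"
  using e_p_diff[of 1 n] n2 by (simp add: theta inner_diff_left)

lemma p_A0: "p \<in> A0"
  using n2 by (intro special_point_A0[OF _ alpha_p theta_p]) auto

lemma free:
  assumes u: "u \<in> W_af" "u p \<in> A0"
  shows "u = id"
proof -
  have n0: "0 < real n" using n2 by simp
  note le = orbit_in_alcove[OF n0 alpha_p theta_p _ u]
  define a where "a i = e i \<bullet> u p - e i \<bullet> p" for i
  have mono: "a (Suc i) \<le> a i" if "i \<in> {1..<n}" for i
  proof -
    have "\<alpha> i \<bullet> p \<le> \<alpha> i \<bullet> u p" by (rule le(1)) (use that nodes in auto)
    then show ?thesis unfolding alpha_inner[OF that] a_def by simp
  qed
  \<comment> \<open>The inequality for \<open>\<theta>\<close> closes the decreasing chain to a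
    cycle, so \<open>a\<close> is constant; its sum is zero, so it vanishes.\<close>
  have ends: "a 1 \<le> a n" using le(2) by (simp add: a_def theta inner_diff_left)
  have const: "a i = a 1" if "i \<in> {1..n}" for i
    using antitone_chain[of n a 1 i] antitone_chain[of n a i n] mono ends that by fastforce
  have "(\<Sum>i=1..n. a i) = (\<Sum>i=1..n. e i) \<bullet> (u p - p)"
    unfolding inner_sum_left by (simp only: a_def inner_diff_right)
  also have "\<dots> = 0" by (simp only: sum_e inner_zero_left)
  finally have "(\<Sum>i=1..n. a i) = 0" .
  moreover have "(\<Sum>i=1..n. a i) = (\<Sum>i=1..n. a 1)" by (rule sum.cong[OF refl const])
  ultimately have "a 1 = 0" using n2 by simp
  then have zero: "a i = 0" if "i \<in> {1..n}" for i using const[OF that] by simp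
  have "u p = p"
  proof (rule point_eqI)
    fix i assume "i \<in> {1..n}"
    then show "e i \<bullet> u p = e i \<bullet> p" using zero[of i] by (simp add: a_def)
  qed
  then show ?thesis
  proof (rule stabilizer_trivial[OF u(1) _ E_reflection E_cv span_e])
    fix x y assume "x \<in> e ` {1..n}" "y \<in> e ` {1..n}" and int: "y \<bullet> p - x \<bullet> p \<in> \<int>"
    then obtain i j where ij: "i \<in> {1..n}" "x = e i" "j \<in> {1..n}" "y = e j" by blast
    have diff: "y \<bullet> p - x \<bullet> p = (real i - real j) / n" using e_p_diff ij by simp
    have "\<bar>real i - real j\<bar> < real n" using ij by auto
    then have "(real i - real j) / n = 0"
      using Ints_small[OF int] n2 unfolding diff by simp
    then show "y = x" using ij n2 by simp
  qed auto
qed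

text \<open>The Coxeter element that shifts the \<open>e i\<close> cyclically; it is the linear part
  of every \<open>wordA n r\<close>.\<close>

definition c :: "'a \<Rightarrow> 'a" where "c = wd (rev [1..<n])"

lemma c_W: "c \<in> W"
  unfolding c_def using n2 by (intro finite_letters) auto

lemma c_e1: "c (e 1) = e n"
  unfolding c_def using n2 by (intro wd_move_down) auto

lemma c_e: "i \<in> {1..<n} \<Longrightarrow> c (e (Suc i)) = e i"
proof -
  assume i: "i \<in> {1..<n}"
  have "[1..<n] = [1..<i] @ [i] @ [Suc i..<n]"
    using i upt_split[of 1 i n] by (simp add: upt_conv_Cons)
  then have "rev [1..<n] = rev [Suc i..<n] @ [i] @ rev [1..<i]" by simp
  then have "c (e (Suc i)) = wd (rev [Suc i..<n]) (S i (wd (rev [1..<i]) (e (Suc i))))"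
    by (simp add: c_def)
  also have "wd (rev [1..<i]) (e (Suc i)) = e (Suc i)" using i by (intro wd_fix) auto
  also have "S i (e (Suc i)) = e i" using i S_e[of i "Suc i"] by simp
  also have "wd (rev [Suc i..<n]) (e i) = e i" using i by (intro wd_fix) auto
  finally show ?thesis .
qed

lemma e_c: "i \<in> {1..<n} \<Longrightarrow> e i \<bullet> c x = e (Suc i) \<bullet> x" "e n \<bullet> c x = e 1 \<bullet> x"
  using W_inner[OF c_W] c_e[of i] c_e1 by metis+

lemma wordA_step:
  assumes "r < n"
  shows "wd (wordA n r) x = S r (wd (wordA n ((r + n - 1) mod n)) (S (Suc r mod n) x))"
proof -
  have "wd (r # wordA n ((r + n - 1) mod n)) (S (Suc r mod n) x)
      = wd (wordA n r @ [Suc r mod n]) (S (Suc r mod n) x)"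
    using wordA_rotate[OF n2 assms] by simp
  then show ?thesis by simp
qed

lemma S_c: "S i (c (S j x)) = c x" if "c (\<alpha> j) = \<alpha> i" "i \<in> {1..<n}" "j \<in> {1..<n}" for i j x
  using orthogonal_conj_reflection[OF finite_weyl_group_orthogonal[OF c_W], of "\<alpha> j" 0 x] that
  by (simp add: S_pos)

text \<open>As \<open>c\<close> sends \<open>\<alpha> 1\<close> to \<open>- \<theta>\<close>, moving
  generator 1 to the left past \<open>c\<close> turns it into the linear part of generator 0; the
  two cancel up to the translation by \<open>\<theta>\<close>.\<close>

lemma wordA_0: "wd (wordA n 0) x = c x + (e 1 - e n)"
proof -
  have c\<alpha>: "c (\<alpha> 1) = - \<theta>"
  proof -
    have "c (\<alpha> 1) = e n - e 1"
      using alpha_diff[of 1] c_e[of 1] c_e1 n2 by (simp add: linear_diff[OF W_linear[OF c_W]])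
    also have "\<dots> = - \<theta>" by (subst theta) simp
    finally show ?thesis .
  qed
  have "wd (wordA n 0) x = S 0 (c (S 1 x))"
    using wordA_step[of 0 x] wordA_last[OF n2] n2 by (simp add: c_def)
  also have "c (S 1 x) = hyperplane_reflection (- \<theta>) (- 0) (c x)"
    using orthogonal_conj_reflection[OF finite_weyl_group_orthogonal[OF c_W], of "\<alpha> 1" 0 x] c\<alpha>
    by (simp add: S_pos)
  also have "\<dots> = hyperplane_reflection \<theta> 0 (c x)" unfolding hyperplane_reflection_minus ..
  finally have "wd (wordA n 0) x = c x + \<theta>" by (simp add: S0)
  also have "\<dots> = c x + (e 1 - e n)" by (rule arg_cong[OF theta])
  finally show ?thesis .
qed

text \<open>In the recursion the two new generators cancel around \<open>c\<close>, which carries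
  one root to the other, while the left one moves the translation vector to the next index. The case
  \<open>r = n - 1\<close> is \<open>c\<close> itself and is kept apart because its successor wraps
  around to 0.\<close>

lemma wordA_eq:
  assumes "r < n"
  shows "wd (wordA n r) x = c x + (e (Suc r) - e n)"
proof (cases "r = n - 1")
  case True
  then show ?thesis using wordA_last[OF n2] n2 by (simp add: c_def)
next
  case False
  have "wd (wordA n r) x = c x + (e (Suc r) - e n)" if "r < n - 1" for r x
    using that
  proof (induction r arbitrary: x)
    case 0
    then show ?case using wordA_0 by simp
  next
    case (Suc r)
    have i: "Suc r \<in> {1..<n}" "Suc (Suc r) \<in> {1..<n}" using Suc.prems by auto
    have "Suc r + n - 1 = r + n" by simp
    then have m: "(Suc r + n - 1) mod n = r" "Suc (Suc r) mod n = Suc (Suc r)" using Suc.prems by simp_all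
    have "c (\<alpha> (Suc (Suc r))) = \<alpha> (Suc r)"
      using alpha_diff[OF i(1)] alpha_diff[OF i(2)] c_e[of "Suc r"] c_e[of "Suc (Suc r)"] i
      by (simp add: linear_diff[OF W_linear[OF c_W]])
    then have Sc: "S (Suc r) (c (S (Suc (Suc r)) x)) = c x" using i by (rule S_c)
    have lin: "S (Suc r) (y + (z - v)) = S (Suc r) y + (S (Suc r) z - S (Suc r) v)" for y z v
      by (simp add: S_pos hyperplane_reflection_add hyperplane_reflection_diff)
    have "wd (wordA n (Suc r)) x = S (Suc r) (wd (wordA n r) (S (Suc (Suc r)) x))"
      using wordA_step[of "Suc r" x] m i by simp
    also have "\<dots> = S (Suc r) (c (S (Suc (Suc r)) x) + (e (Suc r) - e n))"
      using Suc.IH Suc.prems by simp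
    also have "\<dots> = c x + (e (Suc (Suc r)) - e n)"
      unfolding lin Sc using S_e[OF i(1), of "Suc r"] S_e[OF i(1), of n] i Suc.prems by simp
    finally show ?case .
  qed
  then show ?thesis using False assms by simp
qed

text \<open>Absorbing \<open>- e n\<close> leaves the orbit vector \<open>e (Suc r)\<close> as
  translation part, and \<open>tau\<close> is then the rotation of the alcove.\<close>

definition tau :: "'a \<Rightarrow> 'a" where "tau x = c x - e n"

lemma wordA_tau: "r < n \<Longrightarrow> wd (wordA n r) x = tau x + e (Suc r)"
  by (simp add: wordA_eq tau_def)

lemma e_tau: "i \<in> {1..<n} \<Longrightarrow> e i \<bullet> tau x = e (Suc i) \<bullet> x + 1 / n"
  "e n \<bullet> tau x = e 1 \<bullet> x - 1 + 1 / n"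
  using n2 by (simp_all add: tau_def inner_diff_right e_c e_inner)

lemma tau_p: "tau p = p"
proof (rule point_eqI)
  fix i assume i: "i \<in> {1..n}"
  show "e i \<bullet> tau p = e i \<bullet> p"
  proof (cases "i = n")
    case True
    have "e 1 \<bullet> p - e n \<bullet> p = (real n - 1) / n" using e_p_diff[of 1 n] n2 by simp
    then show ?thesis using n2 by (simp add: True e_tau field_simps)
  next
    case False
    then have "e (Suc i) \<bullet> p - e i \<bullet> p = - (1 / n)" using e_p_diff[of "Suc i" i] i by simp
    moreover have "e i \<bullet> tau p = e (Suc i) \<bullet> p + 1 / n" using i False by (intro e_tau(1)) auto
    ultimately show ?thesis by linarith
  qed
qed

lemma tau_A0: "tau ` A0 = A0"
proof -
  \<comment> \<open>The \<open>n\<close> affine functions that define the alcove, the simple roots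
    and \<open>1 - \<theta>\<close>, are permuted cyclically.\<close>
  have inner: "\<alpha> i \<bullet> tau x = \<alpha> (Suc i) \<bullet> x" if "i \<in> {1..<n - 1}" for i x
  proof -
    have "i \<in> {1..<n}" "Suc i \<in> {1..<n}" using that by auto
    then show ?thesis by (simp add: alpha_inner e_tau(1))
  qed
  have last: "\<alpha> (n - 1) \<bullet> tau x = 1 - \<theta> \<bullet> x" and high: "\<theta> \<bullet> tau x = 1 - \<alpha> 1 \<bullet> x" for x
    using e_tau(1)[of "n - 1"] e_tau(1)[of 1] e_tau(2) n2 alpha_inner[of "n - 1"] alpha_inner[of 1]
    by (simp_all add: theta inner_diff_left)
  have iff: "tau x \<in> A0 \<longleftrightarrow> x \<in> A0" for x
  proof
    assume "tau x \<in> A0"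
    then have t: "\<And>i. i \<in> {1..n - 1} \<Longrightarrow> 0 < \<alpha> i \<bullet> tau x" "\<theta> \<bullet> tau x < 1"
      by (auto simp: fundamental_alcove_def)
    have "0 < \<alpha> i \<bullet> x" if i: "i \<in> {1..n - 1}" for i
    proof (cases "i = 1")
      case True
      then show ?thesis using t(2) high by simp
    next
      case False
      then have "i - 1 \<in> {1..<n - 1}" "i - 1 \<in> {1..n - 1}" "Suc (i - 1) = i" using i by auto
      then show ?thesis using t(1)[of "i - 1"] inner[of "i - 1" x] by simp
    qed
    moreover have "n - 1 \<in> {1..n - 1}" using n2 by simp
    then have "\<theta> \<bullet> x < 1" using t(1)[of "n - 1"] last[of x] by simp
    ultimately show "x \<in> A0" by (simp add: fundamental_alcove_def)
  next
    assume "x \<in> A0"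
    then have t: "\<And>i. i \<in> {1..n - 1} \<Longrightarrow> 0 < \<alpha> i \<bullet> x" "\<theta> \<bullet> x < 1"
      by (auto simp: fundamental_alcove_def)
    have "0 < \<alpha> i \<bullet> tau x" if i: "i \<in> {1..n - 1}" for i
    proof (cases "i = n - 1")
      case True
      then show ?thesis using t(2) last by simp
    next
      case False
      then have "i \<in> {1..<n - 1}" "Suc i \<in> {1..n - 1}" using i by auto
      then show ?thesis using t(1)[of "Suc i"] inner[of i x] by simp
    qed
    moreover have "1 \<in> {1..n - 1}" using n2 by simp
    then have "\<theta> \<bullet> tau x < 1" using t(1)[of 1] high[of x] by simp
    ultimately show "tau x \<in> A0" by (simp add: fundamental_alcove_def)
  qed
  have "tau (wd [1..<n] (y + e n)) = y" for y
    using word_rev_left[of \<alpha> \<theta> "[1..<n]" "y + e n"] by (simp add: tau_def c_def)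
  then show ?thesis using iff by (metis image_subsetI subset_antisym subsetI image_eqI)
qed

section \<open>Reducedness and the maximal cyclically decreasing elements\<close>

lemma E_step:
  assumes "i \<le> n - 1" "x \<in> e ` {1..n}"
  shows "\<bar>x \<bullet> (S i p - p)\<bar> \<le> 1 / n"
proof (cases "i = 0")
  case True
  have "\<theta> \<bullet> p - 1 = - 1 / n" using theta_p n2 by (simp add: field_simps)
  then have "\<bar>x \<bullet> (S i p - p)\<bar> = \<bar>x \<bullet> \<theta>\<bar> / n"
    using n2 by (simp add: True simple_reflection_def inner_displacement theta_norm abs_mult)
  moreover have "\<bar>x \<bullet> \<theta>\<bar> \<le> 1" using assms(2) n2 by (auto simp: theta inner_diff_right e_inner)
  ultimately show ?thesis by (simp add: divide_right_mono)
next
  case False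
  then have i: "i \<in> {1..n - 1}" "i \<in> {1..<n}" using assms(1) n2 by auto
  have "\<alpha> i \<bullet> p = 1 / n" using alpha_p[OF i(1)] n2 by (simp add: field_simps)
  then have "\<bar>x \<bullet> (S i p - p)\<bar> = \<bar>x \<bullet> \<alpha> i\<bar> / n"
    using n2 False alpha_norm[OF i(2)] by (simp add: simple_reflection_def inner_displacement abs_mult)
  moreover have "\<bar>x \<bullet> \<alpha> i\<bar> \<le> 1" using assms(2) alpha_e[OF _ i(2)] by (auto simp: inner_commute)
  ultimately show ?thesis by (simp add: divide_right_mono)
qed

lemma wordA_lists: "wordA n r \<in> lists {0..n - 1}"
  using n2 by (auto simp: wordA_def less_Suc_eq_le[symmetric])

text \<open>The displacement of \<open>p\<close> is \<open>e (Suc r)\<close>, whose squared length 1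
  - 1/n equals \<open>n - 1\<close> steps of size 1/n.\<close>

lemma reduced: "r < n \<Longrightarrow> reduced_word (n - 1) \<alpha> \<theta> (wordA n r)"
proof -
  assume r: "r < n"
  then have mem: "Suc r \<in> {1..n}" by simp
  show ?thesis
  proof (rule reduced_wordI[OF E_reflection E_step wordA_lists])
    show "e (Suc r) \<in> e ` {1..n}" using mem by (rule imageI)
    have "e (Suc r) \<bullet> (wd (wordA n r) p - p) = 1 - 1 / n"
      using r by (simp add: wordA_tau tau_p e_inner)
    moreover have "1 / real n * real (n - 1) = 1 - 1 / n" using n2 by (simp add: of_nat_diff field_simps)
    ultimately show "1 / n * length (wordA n r) \<le> \<bar>e (Suc r) \<bullet> (wd (wordA n r) p - p)\<bar>"
      by simp
  qed (use n2 in auto)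
qed

lemma length_maximal_eq:
  "(\<lambda>r. wd (wordA n r)) ` {..<n}
    = length_maximal (n - 1) \<alpha> \<theta> (cyclically_decreasing_elements n \<alpha> \<theta>)"
proof -
  let ?l = "weyl_length (n - 1) \<alpha> \<theta>"
  let ?C = "cyclically_decreasing_elements n \<alpha> \<theta>"
  have word: "wd (wordA n r) \<in> ?C" "?l (wd (wordA n r)) = n - 1" if "r < n" for r
    using reduced[OF that] wordA_cyclically_decreasing[OF n2, of r]
    by (auto simp: cyclically_decreasing_elements_def reduced_word_def)
  have bound: "\<exists>ws. v = wd ws \<and> cyclically_decreasing_word n ws \<and> ?l v = length ws \<and> length ws \<le> n - 1"
    if "v \<in> ?C" for v
    using that cyclically_decreasing_length[OF n2]
    unfolding cyclically_decreasing_elements_def reduced_word_def by fastforce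
  show ?thesis
  proof (intro equalityI subsetI)
    fix w assume "w \<in> (\<lambda>r. wd (wordA n r)) ` {..<n}"
    then obtain r where r: "r < n" "w = wd (wordA n r)" by blast
    show "w \<in> length_maximal (n - 1) \<alpha> \<theta> ?C"
      unfolding length_maximal_def r(2)
      using word[OF r(1)] bound by (intro CollectI conjI ballI) (metis)+
  next
    fix w assume w: "w \<in> length_maximal (n - 1) \<alpha> \<theta> ?C"
    then have wC: "w \<in> ?C" and max: "\<And>v. v \<in> ?C \<Longrightarrow> ?l v \<le> ?l w" by (auto simp: length_maximal_def)
    obtain ws where ws: "w = wd ws" "cyclically_decreasing_word n ws" "?l w = length ws" "length ws \<le> n - 1"
      using bound[OF wC] by blast
    have "n - 1 \<le> ?l w" using max[OF word(1)[of 0]] word(2)[of 0] n2 by simp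
    then have "length ws = n - 1" using ws by simp
    then obtain r where "r < n" "ws = wordA n r" using cyclically_decreasing_maximal[OF n2 ws(2)] by blast
    then show "w \<in> (\<lambda>r. wd (wordA n r)) ` {..<n}" using ws by blast
  qed
qed

lemma nu_e1: "nu (first_coweight (n - 1) \<alpha>) = e 1"
  by (rule nu_first_coweight[OF span_alpha]) (use alpha_e[of 1] n2 in auto)

lemma Orb_eq: "Orb = e ` {1..n}"
proof
  show "Orb \<subseteq> e ` {1..n}"
    by (rule coweight_orbit_subset) (use nu_e1 n2 E_reflection in auto)
  have "e i \<in> Orb" if i: "i \<in> {1..n}" for i
  proof -
    have "wd (rev [1..<i]) (e 1) = e i" using i by (intro wd_move_down) auto
    moreover have "wd (rev [1..<i]) \<in> W" using i by (intro finite_letters) auto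
    ultimately show ?thesis using coweight_orbit_W nu_in_orbit nu_e1 by metis
  qed
  then show "e ` {1..n} \<subseteq> Orb" by blast
qed

lemma Z_ideal_A: "Z_ideal (n - 1) \<alpha> \<theta> = bruhat_ideal (n - 1) \<alpha> \<theta> ((\<lambda>r. wd (wordA n r)) ` {..<n})"
proof -
  have wdA: "wd (wordA n r) ` A0 = (\<lambda>x. x + e (Suc r)) ` A0" if "r < n" for r
  proof -
    have "wd (wordA n r) = (\<lambda>x. tau x + e (Suc r))" using wordA_tau[OF that] by blast
    then have "wd (wordA n r) ` A0 = (\<lambda>x. x + e (Suc r)) ` tau ` A0" by (simp add: image_image)
    then show ?thesis by (simp only: tau_A0)
  qed
  have "{u \<in> W_af. \<exists>\<mu>\<in>Orb. u ` A0 = (\<lambda>x. x + \<mu>) ` A0} = (\<lambda>r. wd (wordA n r)) ` {..<n}"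
  proof (rule translates_eq[OF p_A0 free])
    show "(\<lambda>r. wd (wordA n r)) ` {..<n} \<subseteq> W_af" using wordA_lists wd_in_W_af by blast
  next
    fix g assume "g \<in> (\<lambda>r. wd (wordA n r)) ` {..<n}"
    then obtain r where r: "r < n" "g = wd (wordA n r)" by blast
    then have "e (Suc r) \<in> Orb" unfolding Orb_eq by (intro imageI) simp
    then show "\<exists>\<mu>\<in>Orb. g ` A0 = (\<lambda>x. x + \<mu>) ` A0" using wdA[OF r(1)] r(2) by blast
  next
    fix \<mu> assume "\<mu> \<in> Orb"
    then obtain i where i: "i \<in> {1..n}" "\<mu> = e i" unfolding Orb_eq by blast
    then have "i - 1 < n" "Suc (i - 1) = i" by auto
    then show "\<exists>g\<in>(\<lambda>r. wd (wordA n r)) ` {..<n}. g ` A0 = (\<lambda>x. x + \<mu>) ` A0"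
      using wdA[of "i - 1"] i(2) by (intro bexI[of _ "wd (wordA n (i - 1))"]) auto
  qed
  then show ?thesis unfolding Z_ideal_def by simp
qed

end

lemma type_A_chain:
  fixes \<alpha> :: "nat \<Rightarrow> 'a::euclidean_space"
  assumes dat: "classical_root_datum TypeA (n - 1) \<alpha> \<theta>" and n: "2 \<le> n"
  obtains e where "type_A \<alpha> \<theta> e n"
proof -
  interpret integral_datum "n - 1" \<alpha> \<theta> using dat by (rule integral_datumI)
  define d where "d = (\<alpha> 1 \<bullet> \<alpha> 1) / 2"
  have gram: "\<alpha> i \<bullet> \<alpha> j = (if i = j then 2 * d else if i = Suc j \<or> j = Suc i then - d else 0)"
    if "i \<in> {1..<n}" "j \<in> {1..<n}" for i j
    by (rule classical_gram[OF dat _ _ d_def that]) (use n in auto)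
  have "inj_on \<alpha> {1..n - 1}" "independent (\<alpha> ` {1..n - 1})"
    using dat by (auto simp: classical_root_datum_def)
  then obtain f where f: "\<And>i. i \<in> {1..n - 1} \<Longrightarrow> \<alpha> i \<bullet> f = (if Suc i = n then - d else 0)"
    by (rule linear_functional_exists[where c = "\<lambda>i. if Suc i = n then - d else 0"]) auto
  have f': "\<alpha> j \<bullet> f = (if Suc j = n then - d else 0)" if "j \<in> {1..<n}" for j
  proof -
    have "j \<in> {1..n - 1}" using that by auto
    then show ?thesis by (rule f)
  qed
  define e where "e = (\<lambda>i. f + (\<Sum>k\<in>{i..<n}. \<alpha> k))"
  have c1: "\<alpha> j = e j - e (Suc j)" if "j \<in> {1..<n}" for j
    by (rule chain_coordinates(1)[OF gram _ f' that]) (simp_all add: e_def)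
  have c2: "\<alpha> j \<bullet> e i = (if i = j then d else if i = Suc j then - d else 0)"
    if "i \<in> {1..n}" "j \<in> {1..<n}" for i j
    by (rule chain_coordinates(2)[OF gram _ f' that]) (simp_all add: e_def)
  have span: "span (e ` {1..n}) = UNIV"
  proof (rule span_chain[OF span_alpha])
    fix i assume "i \<in> {1..n - 1}"
    then have i: "i \<in> {1..<n}" by auto
    then have "e i \<in> span (e ` {1..n})" "e (Suc i) \<in> span (e ` {1..n})" by (auto intro!: span_base)
    then show "\<alpha> i \<in> span (e ` {1..n})" using c1[OF i] by (simp add: span_diff)
  qed
  have d: "0 < d" using nonzero[of 1] n by (simp add: d_def)
  interpret chain "n - 1" \<alpha> \<theta> e n d
    using n d c1 c2 span by unfold_locales auto
  \<comment> \<open>This word fixes \<open>e 1\<close> and carries \<open>e 2\<close> to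
    \<open>e n\<close>, so it exhibits \<open>e 1 - e n\<close> as a conjugate of
    \<open>\<alpha> 1\<close>.\<close>
  have W: "wd (rev [2..<n]) \<in> W" using n by (intro chain_letters) auto
  have "wd (rev [2..<n]) (e 1) = e 1" using n by (intro wd_fix) auto
  moreover have "wd (rev [2..<n]) (e 2) = e n" using n by (intro wd_move_down) auto
  ultimately have w: "wd (rev [2..<n]) (\<alpha> 1) = e 1 - e n"
    using alpha_diff[of 1] n linear_diff[OF W_linear[OF W]] by (simp add: numeral_2_eq_2)
  have norm: "(e 1 - e n) \<bullet> (e 1 - e n) = 2 * d"
    using W_inner[OF W, of "\<alpha> 1" "\<alpha> 1"] n by (simp only: w) (simp add: d_def)
  have root: "e 1 - e n \<in> finite_roots (n - 1) \<alpha>"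
    unfolding w[symmetric] using n by (intro finite_rootI W) auto
  have "highest_root (n - 1) \<alpha> \<theta>" using dat by (simp add: classical_root_datum_def)
  then have \<theta>: "\<theta> = e 1 - e n"
  proof (rule highest_root_unique[OF _ root])
    fix i assume "i \<in> {1..n - 1}"
    then have i: "i \<in> {1..<n}" by auto
    show "0 \<le> (e 1 - e n) \<bullet> \<alpha> i"
      using alpha_e[of 1 i] alpha_e[of n i] i n d by (simp add: inner_diff_right inner_commute[of _ "\<alpha> i"])
    show "\<alpha> i \<bullet> \<alpha> i \<le> (e 1 - e n) \<bullet> (e 1 - e n)" unfolding norm alpha_norm[OF i] ..
  qed
  have "d = 1" using theta_norm norm by (simp add: \<theta>)
  then have "type_A \<alpha> \<theta> e n"
    using chain_axioms \<theta> by (simp add: type_A_def type_A_axioms_def)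
  then show ?thesis by (rule that)
qed

theorem proposition7p1:
  fixes \<alpha> :: "nat \<Rightarrow> 'a::euclidean_space" and \<theta> :: 'a and n :: nat
  shows
   "(2 \<le> n \<and> classical_root_datum TypeA (n - 1) \<alpha> \<theta> \<longrightarrow>
       (\<lambda>r. word_element \<alpha> \<theta> (wordA n r)) ` {..<n}
         = length_maximal (n - 1) \<alpha> \<theta> (cyclically_decreasing_elements n \<alpha> \<theta>) \<and>
       Z_ideal (n - 1) \<alpha> \<theta>
         = bruhat_ideal (n - 1) \<alpha> \<theta> ((\<lambda>r. word_element \<alpha> \<theta> (wordA n r)) ` {..<n})) \<and>
    (3 \<le> n \<and> classical_root_datum TypeB n \<alpha> \<theta> \<longrightarrow>
       (\<forall>ws\<in>wordsB n. reduced_word n \<alpha> \<theta> ws) \<and>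
       Z_ideal n \<alpha> \<theta> = bruhat_ideal n \<alpha> \<theta> (word_element \<alpha> \<theta> ` wordsB n)) \<and>
    (2 \<le> n \<and> classical_root_datum TypeC n \<alpha> \<theta> \<longrightarrow>
       reduced_word n \<alpha> \<theta> (wordC n) \<and>
       Z_ideal n \<alpha> \<theta>
         = bruhat_ideal n \<alpha> \<theta>
             (conjugates (affine_weyl_group n \<alpha>) (word_element \<alpha> \<theta> (wordC n)))) \<and>
    (4 \<le> n \<and> classical_root_datum TypeD n \<alpha> \<theta> \<longrightarrow>
       Z_ideal n \<alpha> \<theta> = bruhat_ideal n \<alpha> \<theta> (word_element \<alpha> \<theta> ` wordsD n))"
proof (intro conjI impI ballI; elim conjE)
  assume n: "2 \<le> n" and dat: "classical_root_datum TypeA (n - 1) \<alpha> \<theta>"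
  obtain e where "type_A \<alpha> \<theta> e n" using type_A_chain[OF dat n] .
  then interpret type_A \<alpha> \<theta> e n .
  show "(\<lambda>r. word_element \<alpha> \<theta> (wordA n r)) ` {..<n}
      = length_maximal (n - 1) \<alpha> \<theta> (cyclically_decreasing_elements n \<alpha> \<theta>)"
    by (rule length_maximal_eq)
  show "Z_ideal (n - 1) \<alpha> \<theta>
      = bruhat_ideal (n - 1) \<alpha> \<theta> ((\<lambda>r. word_element \<alpha> \<theta> (wordA n r)) ` {..<n})"
    by (rule Z_ideal_A)
next
  assume n: "3 \<le> n" and dat: "classical_root_datum TypeB n \<alpha> \<theta>"
  obtain e where e: "signed_chain \<alpha> \<theta> e n 1 1" "\<theta> = e 1 + e 2" using type_B_chain[OF dat n] .
  interpret type_B \<alpha> \<theta> e n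
    by (intro type_B.intro type_B_axioms.intro e n)
  show "reduced_word n \<alpha> \<theta> ws" if "ws \<in> wordsB n" for ws using that by (rule reduced)
  show "Z_ideal n \<alpha> \<theta> = bruhat_ideal n \<alpha> \<theta> (word_element \<alpha> \<theta> ` wordsB n)"
    by (rule Z_ideal_B)
next
  assume n: "2 \<le> n" and dat: "classical_root_datum TypeC n \<alpha> \<theta>"
  obtain e where e: "signed_chain \<alpha> \<theta> e n (1 / 2) 2" "\<theta> = 2 *\<^sub>R e 1" using type_C_chain[OF dat n] .
  interpret type_C \<alpha> \<theta> e n
    by (intro type_C.intro type_C_axioms.intro e)
  show "reduced_word n \<alpha> \<theta> (wordC n)" by (rule reduced)
  show "Z_ideal n \<alpha> \<theta>
      = bruhat_ideal n \<alpha> \<theta> (conjugates (affine_weyl_group n \<alpha>) (word_element \<alpha> \<theta> (wordC n)))"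
    by (rule Z_ideal_C)
next
  assume n: "4 \<le> n" and dat: "classical_root_datum TypeD n \<alpha> \<theta>"
  obtain e where e: "fork_chain \<alpha> \<theta> e n 1" "\<theta> = e 1 + e 2" using type_D_chain[OF dat n] .
  interpret type_D \<alpha> \<theta> e n
    by (intro type_D.intro type_D_axioms.intro e)
  show "Z_ideal n \<alpha> \<theta> = bruhat_ideal n \<alpha> \<theta> (word_element \<alpha> \<theta> ` wordsD n)"
    by (rule Z_ideal_D)
qed

end
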